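(* Suppose that for all compact $J\subset I$, $K\subset X$ there exist $C,r>0$ such that $\big|\log\frac{d_s(x,y)}{d_{s'}(x,y)}\big|\le C|s-s'|$ for $s,s'\in J$ and (distinct) $x,y\in K$ with $\inf_{s\in J}d_s(x,y)<r$, and that for all compact $J\subset I$, $K\subset X$ there exists $C'>0$ such that $|h(s,x)-h(s',x)|\le C'|s-s'|$ for $s,s'\in J$, $x\in K$. Then $hI\times_{\mathcal F}X$ is strongly causal: the chronological diamonds $I(p,q)=\{z\in I\times X:\ p\ll z\ll q\}$, $p,q\in I\times X$, form a basis of the topology of $I\times X$.
   Context: Setting. $X$ is a locally compact topological space, $I\subset\mathbb R$ an open interval, $h:I\times X\to(0,\infty)$ continuous, and $\mathcal F=\{d_s\}_{s\in I}$ a family of metrics on $X$ whose induced length metrics generate the topology of $X$. Under the log-Lipschitz condition in the claim, absolute continuity of a curve $\beta:[a,b]\to X$ does not depend on the chosen metric in $\mathcal F$. $I\times X$ carries the product topology. For an absolutely continuous $\beta:[a,b]\to X$ let $|\beta_t'|_{d_s}$ be its metric speed with respect to $d_s$, and define the generalized metric speed $v_\beta(s,t)=\limsup_{\delta\to0}\frac1\delta\int_t^{t+\delta}|\beta_u'|_{d_s}\,\mathrm du$. An absolutely continuous curve $\gamma=(\alpha,\beta):[a,b]\to I\times X$ with $\alpha'>0$ a.e. is a future directed timelike curve if $v_\beta(\alpha_t,t)^2<h(\gamma_t)^2\alpha'(t)^2$ a.e. Write $p\ll q$ if there is a future directed timelike curve from $p$ to $q$. $hI\times_{\mathcal F}X$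 denotes $I\times X$ with the causal structure so defined. *)

theory Defs
  imports "HOL-Analysis.Analysis"
begin

section \<open>Length metrics\<close>

text \<open>
  The metrics of the family live on the carrier type of the topological space but are unrelated to
  any type class metric, so they are functions satisfying the locale \<^locale>\<open>Metric_space\<close>.
\<close>

definition curve_length :: "('a \<Rightarrow> 'a \<Rightarrow> real) \<Rightarrow> (real \<Rightarrow> 'a) \<Rightarrow> real \<Rightarrow> real \<Rightarrow> ennreal" where
  "curve_length d c a b =
     (SUP ts \<in> {ts. sorted ts \<and> set ts \<subseteq> {a..b}}.
        \<Sum>i < length ts - 1. ennreal (d (c (ts ! i)) (c (ts ! Suc i))))"

text \<open>
  An extended metric: points that are not joined by a \<open>d\<close>-continuous rectifiable curve have
  distance \<open>\<infinity>\<close>.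
\<close>

definition length_metric :: "('a \<Rightarrow> 'a \<Rightarrow> real) \<Rightarrow> 'a \<Rightarrow> 'a \<Rightarrow> ennreal" where
  "length_metric d x y =
     (INF c \<in> {c. pathin (Metric_space.mtopology UNIV d) c \<and> c 0 = x \<and> c 1 = y}.
        curve_length d c 0 1)"

definition generates_topology :: "('a::topological_space \<Rightarrow> 'a \<Rightarrow> ennreal) \<Rightarrow> bool" where
  "generates_topology \<rho> \<longleftrightarrow>
     (\<forall>U. open U \<longleftrightarrow> (\<forall>x\<in>U. \<exists>\<epsilon>>0. {y. \<rho> x y < ennreal \<epsilon>} \<subseteq> U))"


section \<open>Absolutely continuous curves and metric speed\<close>

definition abs_continuous_curve ::
  "('a \<Rightarrow> 'a \<Rightarrow> real) \<Rightarrow> (real \<Rightarrow> 'a) \<Rightarrow> real \<Rightarrow> real \<Rightarrow> bool" where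
  "abs_continuous_curve d c a b \<longleftrightarrow>
     (\<forall>\<epsilon>>0. \<exists>\<delta>>0. \<forall>(n::nat) u v.
        (\<forall>i<n. a \<le> u i \<and> u i \<le> v i \<and> v i \<le> b) \<and>
        disjoint_family_on (\<lambda>i. {u i<..<v i}) {..<n} \<and>
        (\<Sum>i<n. v i - u i) < \<delta>
        \<longrightarrow> (\<Sum>i<n. d (c (u i)) (c (v i))) < \<epsilon>)"

text \<open>
  For an absolutely continuous curve the limit exists at almost every time; elsewhere the value is
  arbitrary and plays no role.
\<close>

definition metric_speed :: "('a \<Rightarrow> 'a \<Rightarrow> real) \<Rightarrow> (real \<Rightarrow> 'a) \<Rightarrow> real \<Rightarrow> real" where
  "metric_speed d c t = Lim (at t) (\<lambda>u. d (c u) (c t) / \<bar>u - t\<bar>)"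

text \<open>
  The limit superior is over \<open>\<delta> \<noteq> 0\<close> of either sign. The interval integral is oriented, so for
  \<open>\<delta> < 0\<close> the quotient is again an average, taken over the interval from \<open>t + \<delta>\<close> to \<open>t\<close>.
\<close>

definition gen_metric_speed ::
  "(real \<Rightarrow> 'a \<Rightarrow> 'a \<Rightarrow> real) \<Rightarrow> (real \<Rightarrow> 'a) \<Rightarrow> real \<Rightarrow> real \<Rightarrow> ereal" where
  "gen_metric_speed d c s t =
     Limsup (at 0) (\<lambda>\<delta>. ereal (1 / \<delta> *
       (LINT u = ereal t..ereal (t + \<delta>)|lebesgue. metric_speed (d s) c u)))"


section \<open>The causal structure of \<open>hI \<times>\<^sub>F X\<close>\<close>

text \<open>
  Absolute continuity of a curve in the product is absolute continuity of both components. For the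
  second one it is required for every metric of the family; under the log-Lipschitz condition
  this is the same as requiring it for one of them.

  Both almost everywhere conditions are stated on the open parameter interval, so that derivatives
  and metric speeds do not involve values of the curve outside its domain.
\<close>

definition timelike_curve ::
  "real set \<Rightarrow> (real \<times> 'a \<Rightarrow> real) \<Rightarrow> (real \<Rightarrow> 'a \<Rightarrow> 'a \<Rightarrow> real)
     \<Rightarrow> (real \<Rightarrow> real \<times> 'a) \<Rightarrow> real \<Rightarrow> real \<Rightarrow> bool" where
  "timelike_curve I h d \<gamma> a b \<longleftrightarrow>
     (let \<alpha> = fst \<circ> \<gamma>; \<beta> = snd \<circ> \<gamma> in
       a < b \<and> \<gamma> ` {a..b} \<subseteq> I \<times> UNIV \<and>
       abs_continuous_curve dist \<alpha> a b \<and>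
       (\<forall>s\<in>I. abs_continuous_curve (d s) \<beta> a b) \<and>
       (AE t in lebesgue. t \<in> {a<..<b} \<longrightarrow> \<alpha> differentiable (at t) \<and> deriv \<alpha> t > 0) \<and>
       (AE t in lebesgue. t \<in> {a<..<b} \<longrightarrow>
          (gen_metric_speed d \<beta> (\<alpha> t) t)\<^sup>2 < ereal ((h (\<gamma> t))\<^sup>2 * (deriv \<alpha> t)\<^sup>2)))"

definition chron ::
  "real set \<Rightarrow> (real \<times> 'a \<Rightarrow> real) \<Rightarrow> (real \<Rightarrow> 'a \<Rightarrow> 'a \<Rightarrow> real)
     \<Rightarrow> real \<times> 'a \<Rightarrow> real \<times> 'a \<Rightarrow> bool" where
  "chron I h d p q \<longleftrightarrow> (\<exists>\<gamma> a b. timelike_curve I h d \<gamma> a b \<and> \<gamma> a = p \<and> \<gamma> b = q)"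

definition diamond ::
  "real set \<Rightarrow> (real \<times> 'a \<Rightarrow> real) \<Rightarrow> (real \<Rightarrow> 'a \<Rightarrow> 'a \<Rightarrow> real)
     \<Rightarrow> real \<times> 'a \<Rightarrow> real \<times> 'a \<Rightarrow> (real \<times> 'a) set" where
  "diamond I h d p q = {z \<in> I \<times> UNIV. chron I h d p z \<and> chron I h d z q}"

definition strongly_causal ::
  "real set \<Rightarrow> (real \<times> 'a::topological_space \<Rightarrow> real) \<Rightarrow> (real \<Rightarrow> 'a \<Rightarrow> 'a \<Rightarrow> real) \<Rightarrow> bool" where
  "strongly_causal I h d \<longleftrightarrow>
     openin (prod_topology (top_of_set I) (euclidean :: 'a topology)) =
       arbitrary union_of (\<lambda>U. \<exists>p \<in> I \<times> UNIV. \<exists>q \<in> I \<times> UNIV. U = diamond I h d p q)"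

end

theory Submission
  imports Defs
begin

text \<open>
  Two things have to be shown: that every point has arbitrarily small diamonds around it, and that
  diamonds are open. Both rest on the fact that an absolutely continuous curve has a metric derivative
  almost everywhere for each metric of the family, and that its length is at most the integral of this
  metric speed. Neither holds by definition, because the metric speed is an unspecified value wherever
  the limit fails to exist. It is derived from the representation of monotone absolutely continuous
  functions as integrals (a density with respect to Lebesgue measure exists by the theorem of Radon and
  Nikodym) and from Lebesgue differentiation; see \<open>mono_abs_continuous_integral\<close>,
  \<open>Lebesgue_differentiation\<close> and \<open>metric_derivative_exists\<close>.

  The generalized speed \<open>v(s, t)\<close> is a limit of averages, so the log-Lipschitz condition turns into the
  inequality \<open>v(s, t) \<le> exp (C \<bar>s - s'\<bar>) v(s', t)\<close> for \<^emph>\<open>all\<close> times \<open>t\<close> and all parameters \<open>s\<close>, \<open>s'\<close> at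
  once (\<open>gen_metric_speed_ratio_bound\<close>). This makes it possible to substitute for \<open>s\<close> the time component
  of a curve although \<open>v(s, t)\<close> agrees with the metric speed only outside a null set that depends on \<open>s\<close>.

  Small diamonds: between the times \<open>s0 - \<eta>\<close> and \<open>s0 + \<eta>\<close> the spatial part of a timelike curve starting
  at \<open>x0\<close> has length at most a constant times \<open>\<eta>\<close> for the metric with parameter \<open>s0\<close>, as long as it stays
  in a compact neighbourhood of \<open>x0\<close>. The length metric generates the topology, so for small \<open>\<eta>\<close> the curve
  cannot leave a prescribed neighbourhood (\<open>small_diamond_exists\<close>).

  Open diamonds: near a point \<open>z\<close> one can move along curves that are short for the length metric. To use
  this at the end of a timelike curve from \<open>p\<close> to \<open>z\<close>, some time must be left over, whereas the strict
  inequality between speed and time derivative holds pointwise with no uniform gap. But the speed,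
  divided by \<open>h\<close>, is log-Lipschitz in the time component. As for differential inequalities, the time
  component can therefore be lowered along the whole curve by an amount controlled through an
  integrating factor, so that the same spatial point is reached strictly earlier
  (\<open>timelike_curve_arrive_earlier\<close>). This proves that futures are open (\<open>chron_future_open\<close>), and
  reversing time gives the same for pasts.
\<close>

section \<open>The length of a curve as a function of its parameter interval\<close>

locale metric_on_type = Metric_space UNIV d for d :: "'a \<Rightarrow> 'a \<Rightarrow> real"

text \<open>
  Defined by recursion on the list, so that partitions can be cut and joined without index arithmetic.
\<close>

fun chord_sum :: "('a \<Rightarrow> 'a \<Rightarrow> real) \<Rightarrow> (real \<Rightarrow> 'a) \<Rightarrow> real list \<Rightarrow> ennreal" where
  "chord_sum d c [] = 0"
| "chord_sum d c [x] = 0"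
| "chord_sum d c (x # y # ts) = ennreal (d (c x) (c y)) + chord_sum d c (y # ts)"

lemma chord_sum_eq_sum:
  "chord_sum d c ts = (\<Sum>i < length ts - 1. ennreal (d (c (ts ! i)) (c (ts ! Suc i))))"
proof (induction ts rule: induct_list012)
  case (3 x y ts)
  then show ?case by (simp add: sum.lessThan_Suc_shift del: sum.lessThan_Suc)
qed auto

lemma curve_length_eq_SUP_chord_sum:
  "curve_length d c a b = (SUP ts \<in> {ts. sorted ts \<and> set ts \<subseteq> {a..b}}. chord_sum d c ts)"
  by (simp add: curve_length_def chord_sum_eq_sum)

lemma chord_sum_le_curve_length:
  "sorted ts \<Longrightarrow> set ts \<subseteq> {a..b} \<Longrightarrow> chord_sum d c ts \<le> curve_length d c a b"
  unfolding curve_length_eq_SUP_chord_sum by (rule SUP_upper) auto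

lemma chord_sum_append_ge: "chord_sum d c xs + chord_sum d c ys \<le> chord_sum d c (xs @ ys)"
proof (induction xs rule: induct_list012)
  case (2 x)
  then show ?case by (cases ys) auto
qed (auto simp: add.assoc add_left_mono)

lemma dist_le_curve_length:
  "a \<le> b \<Longrightarrow> ennreal (d (c a) (c b)) \<le> curve_length d c a b"
  using chord_sum_le_curve_length[of "[a, b]" a b d c] by simp

lemma curve_length_mono:
  "a' \<le> a \<Longrightarrow> b \<le> b' \<Longrightarrow> curve_length d c a b \<le> curve_length d c a' b'"
  unfolding curve_length_eq_SUP_chord_sum by (rule SUP_subset_mono) auto

lemma curve_length_degenerate: "v < u \<Longrightarrow> curve_length d c u v = 0"
proof -
  assume "v < u"
  then have "{ts. sorted ts \<and> set ts \<subseteq> {u..v}} = {[]}" by auto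
  then show ?thesis by (simp add: curve_length_eq_SUP_chord_sum)
qed

lemma sorted_split_at:
  fixes ts :: "real list"
  assumes "sorted ts"
  obtains xs ys where "ts = xs @ ys" "\<And>t. t \<in> set xs \<Longrightarrow> t \<le> v" "\<And>t. t \<in> set ys \<Longrightarrow> v < t"
proof -
  define xs ys where "xs = takeWhile (\<lambda>t. t \<le> v) ts" and "ys = dropWhile (\<lambda>t. t \<le> v) ts"
  have split: "ts = xs @ ys" by (simp add: xs_def ys_def)
  have "t \<le> v" if "t \<in> set xs" for t
    using that unfolding xs_def by (auto dest: set_takeWhileD)
  moreover have "v < t" if "t \<in> set ys" for t
  proof (cases ys)
    case (Cons y zs)
    then have "\<not> y \<le> v" unfolding ys_def by (simp add: dropWhile_eq_Cons_conv)
    moreover have "sorted (y # zs)" using assms split Cons by (simp add: sorted_append)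
    ultimately show ?thesis using that Cons by auto
  qed (use that in auto)
  ultimately show ?thesis using split that by blast
qed

definition short_intervals ::
  "real \<Rightarrow> real \<Rightarrow> real \<Rightarrow> 'i set \<Rightarrow> ('i \<Rightarrow> real) \<Rightarrow> ('i \<Rightarrow> real) \<Rightarrow> bool" where
  "short_intervals a b \<delta> S u v \<longleftrightarrow>
     finite S \<and> (\<forall>i\<in>S. a \<le> u i \<and> u i \<le> v i \<and> v i \<le> b) \<and>
     disjoint_family_on (\<lambda>i. {u i<..<v i}) S \<and> (\<Sum>i\<in>S. v i - u i) < \<delta>"

text \<open>
  The definition of absolute continuity indexes families of intervals by initial segments of the
  natural numbers; refining each interval of a family is simpler for arbitrary finite index sets.
\<close>

lemma abs_continuous_curve_finite:
  assumes "abs_continuous_curve d c a b" "e > 0"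
  shows "\<exists>\<delta>>0. \<forall>(S :: 'i set) u v. short_intervals a b \<delta> S u v \<longrightarrow>
    (\<Sum>i\<in>S. d (c (u i)) (c (v i))) < e"
proof -
  obtain \<delta> where \<delta>: "\<delta> > 0" "\<And>(n::nat) u v. (\<forall>i<n. a \<le> u i \<and> u i \<le> v i \<and> v i \<le> b) \<and>
        disjoint_family_on (\<lambda>i. {u i<..<v i}) {..<n} \<and> (\<Sum>i<n. v i - u i) < \<delta>
        \<Longrightarrow> (\<Sum>i<n. d (c (u i)) (c (v i))) < e"
    using assms unfolding abs_continuous_curve_def by blast
  have "(\<Sum>i\<in>S. d (c (u i)) (c (v i))) < e"
    if "short_intervals a b \<delta> S u v" for S :: "'i set" and u v
  proof -
    from that have "finite S" and uv: "\<And>i. i \<in> S \<Longrightarrow> a \<le> u i \<and> u i \<le> v i \<and> v i \<le> b"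
      and disj: "disjoint_family_on (\<lambda>i. {u i<..<v i}) S" and sum: "(\<Sum>i\<in>S. v i - u i) < \<delta>"
      by (auto simp: short_intervals_def)
    obtain h where h: "bij_betw h {..<card S} S"
      using ex_bij_betw_nat_finite[OF \<open>finite S\<close>] by (auto simp: atLeast0LessThan)
    have "h i \<in> S" if "i < card S" for i
      using h that by (auto simp: bij_betw_def)
    moreover have "disjoint_family_on (\<lambda>i. {u (h i)<..<v (h i)}) {..<card S}"
      using disj h unfolding disjoint_family_on_def bij_betw_def inj_on_def by blast
    moreover have "(\<Sum>i<card S. v (h i) - u (h i)) < \<delta>"
      using sum by (simp add: sum.reindex_bij_betw[OF h, of "\<lambda>i. v i - u i"])
    ultimately have "(\<Sum>i<card S. d (c (u (h i))) (c (v (h i)))) < e"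
      using uv by (intro \<delta>(2)) auto
    then show ?thesis
      by (simp add: sum.reindex_bij_betw[OF h, of "\<lambda>i. d (c (u i)) (c (v i))"])
  qed
  with \<delta>(1) show ?thesis by blast
qed

lemma abs_continuous_curve_iff:
  "abs_continuous_curve d c a b \<longleftrightarrow> (\<forall>e>0. \<exists>\<delta>>0. \<forall>(S :: nat set) u v. short_intervals a b \<delta> S u v \<longrightarrow>
     (\<Sum>i\<in>S. d (c (u i)) (c (v i))) < e)" (is "_ \<longleftrightarrow> ?R")
proof
  assume ?R
  show "abs_continuous_curve d c a b"
    unfolding abs_continuous_curve_def
  proof (intro allI impI)
    fix e :: real assume "e > 0"
    with \<open>?R\<close> obtain \<delta> where \<delta>: "\<delta> > 0" "\<forall>(S :: nat set) u v. short_intervals a b \<delta> S u v \<longrightarrow>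
        (\<Sum>i\<in>S. d (c (u i)) (c (v i))) < e" by blast
    have "(\<Sum>i<n. d (c (u i)) (c (v i))) < e"
      if "(\<forall>i<n. a \<le> u i \<and> u i \<le> v i \<and> v i \<le> b) \<and> disjoint_family_on (\<lambda>i. {u i<..<v i}) {..<n} \<and>
        (\<Sum>i<n. v i - u i) < \<delta>" for n :: nat and u v
      using that by (intro \<delta>(2)[rule_format]) (simp add: short_intervals_def)
    with \<delta>(1) show "\<exists>\<delta>>0. \<forall>(n::nat) u v. (\<forall>i<n. a \<le> u i \<and> u i \<le> v i \<and> v i \<le> b) \<and>
        disjoint_family_on (\<lambda>i. {u i<..<v i}) {..<n} \<and> (\<Sum>i<n. v i - u i) < \<delta>
        \<longrightarrow> (\<Sum>i<n. d (c (u i)) (c (v i))) < e" by blast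
  qed
qed (intro allI impI abs_continuous_curve_finite)

text \<open>
  The suprema are pulled out one index at a time; the term \<open>r\<close> carries the terms already fixed through
  the induction.
\<close>

lemma sum_SUP_le:
  fixes f :: "'i \<Rightarrow> 'b \<Rightarrow> ennreal"
  assumes "finite S" "\<And>i. i \<in> S \<Longrightarrow> A i \<noteq> {}"
    and "\<And>g. (\<And>i. i \<in> S \<Longrightarrow> g i \<in> A i) \<Longrightarrow> r + (\<Sum>i\<in>S. f i (g i)) \<le> e"
  shows "r + (\<Sum>i\<in>S. SUP x\<in>A i. f i x) \<le> e"
  using assms
proof (induction S arbitrary: r rule: finite_induct)
  case (insert j S)
  have "r + f j x + (\<Sum>i\<in>S. SUP x\<in>A i. f i x) \<le> e" if x: "x \<in> A j" for x
  proof (rule insert.IH)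
    fix g assume g: "\<And>i. i \<in> S \<Longrightarrow> g i \<in> A i"
    have "r + (\<Sum>i\<in>insert j S. f i ((g(j := x)) i)) \<le> e"
      using g x insert.hyps by (intro insert.prems(2)) auto
    also have "(\<Sum>i\<in>insert j S. f i ((g(j := x)) i)) = f j x + (\<Sum>i\<in>S. f i (g i))"
      using insert.hyps by (auto intro!: arg_cong2[where f = "(+)"] sum.cong)
    finally show "r + f j x + (\<Sum>i\<in>S. f i (g i)) \<le> e"
      by (simp add: add.assoc)
  qed (use insert in auto)
  then have "(SUP x\<in>A j. r + f j x + (\<Sum>i\<in>S. SUP x\<in>A i. f i x)) \<le> e"
    by (rule SUP_least)
  moreover have "A j \<noteq> {}" using insert.prems by auto
  ultimately show ?case
    using insert.hyps
    by (simp add: ennreal_SUP_add_left ennreal_SUP_add_right[symmetric] add.assoc)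
qed auto

context metric_on_type
begin

lemma chord_sum_insert:
  "chord_sum d c (xs @ ys) \<le> chord_sum d c (xs @ [v]) + chord_sum d c (v # ys)"
proof (induction xs rule: induct_list012)
  case 1
  then show ?case by (cases ys) auto
next
  case (2 x)
  show ?case
  proof (cases ys)
    case (Cons y zs)
    have "ennreal (d (c x) (c y)) \<le> ennreal (d (c x) (c v)) + ennreal (d (c v) (c y))"
      using ennreal_leI[OF triangle[of "c x" "c v" "c y"]] by (simp add: ennreal_plus)
    then show ?thesis
      using Cons by (simp add: add.assoc[symmetric] add_right_mono)
  qed auto
next
  case 3
  then show ?case by (simp add: add.assoc add_left_mono)
qed

text \<open>
  A partition of a long interval is cut at an intermediate time by inserting that time, which by the
  triangle inequality can only increase the sum.
\<close>

lemma curve_length_add: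
  assumes "u \<le> v" "v \<le> w"
  shows "curve_length d c u w = curve_length d c u v + curve_length d c v w"
proof (rule antisym)
  show "curve_length d c u w \<le> curve_length d c u v + curve_length d c v w"
    unfolding curve_length_eq_SUP_chord_sum[of d c u w]
  proof (rule SUP_least, clarify)
    fix ts :: "real list" assume ts: "sorted ts" "set ts \<subseteq> {u..w}"
    obtain xs ys where split: "ts = xs @ ys"
      and xs: "\<And>t. t \<in> set xs \<Longrightarrow> t \<le> v" and ys: "\<And>t. t \<in> set ys \<Longrightarrow> v < t"
      using sorted_split_at[OF ts(1)] by metis
    have "chord_sum d c ts \<le> chord_sum d c (xs @ [v]) + chord_sum d c (v # ys)"
      unfolding split by (rule chord_sum_insert)
    also have "\<dots> \<le> curve_length d c u v + curve_length d c v w"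
      using ts xs ys assms unfolding split
      by (intro add_mono chord_sum_le_curve_length) (auto simp: sorted_append less_imp_le)
    finally show "chord_sum d c ts \<le> curve_length d c u v + curve_length d c v w" .
  qed
next
  have "chord_sum d c xs + chord_sum d c ys \<le> curve_length d c u w"
    if "sorted xs" "set xs \<subseteq> {u..v}" "sorted ys" "set ys \<subseteq> {v..w}" for xs ys
  proof -
    have "chord_sum d c xs + chord_sum d c ys \<le> chord_sum d c (xs @ ys)"
      by (rule chord_sum_append_ge)
    also have "\<dots> \<le> curve_length d c u w"
    proof (rule chord_sum_le_curve_length)
      show "sorted (xs @ ys)"
        using that by (fastforce simp: sorted_append)
      show "set (xs @ ys) \<subseteq> {u..w}"
        using that assms by fastforce
    qed
    finally show ?thesis .
  qed
  moreover have "{ts. sorted ts \<and> set ts \<subseteq> {r..t}} \<noteq> {}" for r t :: real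
    by (simp, rule exI[of _ "[]"], simp)
  ultimately show "curve_length d c u v + curve_length d c v w \<le> curve_length d c u w"
    unfolding curve_length_eq_SUP_chord_sum[of d c u v] curve_length_eq_SUP_chord_sum[of d c v w]
    by (simp add: ennreal_SUP_add_left[symmetric] ennreal_SUP_add_right SUP_le_iff)
qed

text \<open>
  Refining every interval of a family by a partition yields a family of at most the same total
  length, so the bound in the definition of absolute continuity passes from chords to lengths.
\<close>

lemma abs_continuous_curve_length:
  assumes "abs_continuous_curve d c a b" "e > 0"
  shows "\<exists>\<delta>>0. \<forall>(S :: 'i set) u v. short_intervals a b \<delta> S u v \<longrightarrow>
    (\<Sum>i\<in>S. curve_length d c (u i) (v i)) \<le> ennreal e"
proof -
  obtain \<delta> where \<delta>: "\<delta> > 0"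
    "\<And>(S :: ('i \<times> nat) set) u v. short_intervals a b \<delta> S u v \<Longrightarrow> (\<Sum>i\<in>S. d (c (u i)) (c (v i))) < e"
    using abs_continuous_curve_finite[OF assms, where ?'i = "'i \<times> nat"] by blast
  have "(\<Sum>i\<in>S. curve_length d c (u i) (v i)) \<le> ennreal e"
    if "short_intervals a b \<delta> S u v" for S :: "'i set" and u v
  proof -
    from that have fin: "finite S" and uv: "\<And>i. i \<in> S \<Longrightarrow> a \<le> u i \<and> u i \<le> v i \<and> v i \<le> b"
      and disj: "disjoint_family_on (\<lambda>i. {u i<..<v i}) S" and sum: "(\<Sum>i\<in>S. v i - u i) < \<delta>"
      by (auto simp: short_intervals_def)
    define A where "A = (\<lambda>i. {ts. sorted ts \<and> set ts \<subseteq> {u i..v i}})"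
    have "(\<Sum>i\<in>S. chord_sum d c (g i)) \<le> ennreal e" if g: "\<And>i. i \<in> S \<Longrightarrow> g i \<in> A i" for g
    proof -
      define T where "T = Sigma S (\<lambda>i. {..<length (g i) - 1})"
      define u' v' where "u' = (\<lambda>(i, k). g i ! k)" and "v' = (\<lambda>(i, k). g i ! Suc k)"
      have fT: "finite T" using fin by (simp add: T_def)
      have mem: "u i \<le> g i ! k \<and> g i ! k \<le> v i" if "i \<in> S" "k < length (g i)" for i k
        using g[OF that(1)] nth_mem[OF that(2)] unfolding A_def by auto
      have nth_mono: "g i ! k \<le> g i ! l" if "i \<in> S" "k \<le> l" "l < length (g i)" for i k l
        using g[OF that(1)] that sorted_nth_mono unfolding A_def by blast
      have uv': "a \<le> u' p \<and> u' p \<le> v' p \<and> v' p \<le> b" if p: "p \<in> T" for p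
      proof -
        obtain i k where ik: "p = (i, k)" "i \<in> S" "Suc k < length (g i)"
          using p unfolding T_def by fastforce
        then show ?thesis
          using uv[of i] mem[of i k] mem[of i "Suc k"] nth_mono[of i k "Suc k"]
          unfolding u'_def v'_def by auto
      qed
      have "{u' p<..<v' p} \<inter> {u' q<..<v' q} = {}" if pq: "p \<in> T" "q \<in> T" "p \<noteq> q" for p q
      proof -
        obtain i k j l where ik: "p = (i, k)" "i \<in> S" "Suc k < length (g i)"
            and jl: "q = (j, l)" "j \<in> S" "Suc l < length (g j)"
          using pq unfolding T_def by fastforce
        show ?thesis
        proof (cases "i = j")
          case True
          then have "k < l \<or> l < k" using ik jl pq by auto
          then have "v' p \<le> u' q \<or> v' q \<le> u' p"
            using nth_mono[of i "Suc k" l] nth_mono[of i "Suc l" k] ik jl True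
            unfolding u'_def v'_def by auto
          then show ?thesis by auto
        next
          case False
          have "{u' p<..<v' p} \<subseteq> {u i<..<v i}" "{u' q<..<v' q} \<subseteq> {u j<..<v j}"
            using mem[of i k] mem[of i "Suc k"] mem[of j l] mem[of j "Suc l"] ik jl
            unfolding u'_def v'_def by auto
          then show ?thesis
            using disj False ik jl unfolding disjoint_family_on_def by blast
        qed
      qed
      then have disj': "disjoint_family_on (\<lambda>p. {u' p<..<v' p}) T"
        unfolding disjoint_family_on_def by blast
      have "(\<Sum>k<length (g i) - 1. g i ! Suc k - g i ! k) \<le> v i - u i" if i: "i \<in> S" for i
      proof (cases "g i")
        case Nil
        then show ?thesis using uv[OF i] by simp
      next
        case (Cons y ys)
        then show ?thesis
          using mem[OF i, of 0] mem[OF i, of "length (g i) - 1"]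
            sum_lessThan_telescope[of "\<lambda>k. g i ! k" "length (g i) - 1"]
          by simp
      qed
      then have "(\<Sum>i\<in>S. \<Sum>k<length (g i) - 1. g i ! Suc k - g i ! k) \<le> (\<Sum>i\<in>S. v i - u i)"
        by (rule sum_mono)
      also have "(\<Sum>i\<in>S. \<Sum>k<length (g i) - 1. g i ! Suc k - g i ! k) = (\<Sum>p\<in>T. v' p - u' p)"
        unfolding T_def u'_def v'_def by (simp add: sum.Sigma fin case_prod_unfold)
      finally have "(\<Sum>p\<in>T. v' p - u' p) < \<delta>"
        using sum by linarith
      with fT uv' disj' have "short_intervals a b \<delta> T u' v'"
        by (simp add: short_intervals_def)
      from \<delta>(2)[OF this]
      have "(\<Sum>p\<in>T. ennreal (d (c (u' p)) (c (v' p)))) \<le> ennreal e"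
        by (subst sum_ennreal) (auto intro!: ennreal_leI)
      also have "(\<Sum>p\<in>T. ennreal (d (c (u' p)) (c (v' p)))) = (\<Sum>i\<in>S. chord_sum d c (g i))"
        unfolding T_def u'_def v'_def chord_sum_eq_sum
        by (simp add: sum.Sigma fin case_prod_unfold del: sum_ennreal)
      finally show ?thesis .
    qed
    moreover have "A i \<noteq> {}" for i
      unfolding A_def by (simp, rule exI[of _ "[]"], simp)
    ultimately have "0 + (\<Sum>i\<in>S. SUP ts\<in>A i. chord_sum d c ts) \<le> ennreal e"
      by (intro sum_SUP_le[OF fin]) auto
    then show ?thesis
      by (simp add: A_def curve_length_eq_SUP_chord_sum)
  qed
  with \<delta>(1) show ?thesis by blast
qed

text \<open>
  Intervals shorter than the modulus for \<open>\<epsilon> = 1\<close> have length at most \<open>1\<close>, and finitely many of them cover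
  the parameter interval.
\<close>

lemma abs_continuous_curve_rectifiable:
  assumes "abs_continuous_curve d c a b"
  shows "curve_length d c a b < top"
proof (cases "a \<le> b")
  case True
  obtain \<delta> where \<delta>: "\<delta> > 0"
    "\<And>(S :: unit set) u v. short_intervals a b \<delta> S u v \<Longrightarrow> (\<Sum>i\<in>S. curve_length d c (u i) (v i)) \<le> ennreal 1"
    using abs_continuous_curve_length[OF assms zero_less_one, where ?'i = "unit"] by blast
  have short: "curve_length d c u v < top" if "a \<le> u" "u \<le> v" "v \<le> b" "v - u < \<delta>" for u v
    using \<delta>(2)[of "{()}" "\<lambda>_. u" "\<lambda>_. v"] that
    by (simp add: short_intervals_def disjoint_family_on_def order_le_less_trans[OF _ ennreal_one_less_top])
  have "curve_length d c a t < top" if "a \<le> t" "t \<le> b" "t \<le> a + real n * (\<delta> / 2)" for n t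
    using that
  proof (induction n arbitrary: t)
    case 0
    then show ?case using short[of a a] \<delta>(1) by simp
  next
    case (Suc n)
    define s where "s = max a (t - \<delta> / 2)"
    have s: "a \<le> s" "s \<le> t" "s \<le> a + real n * (\<delta> / 2)" "t - s < \<delta>"
      using Suc.prems \<delta>(1) by (auto simp: s_def max_def field_simps)
    have "curve_length d c a s < top"
      using s Suc.prems by (intro Suc.IH) auto
    moreover have "curve_length d c s t < top"
      using s Suc.prems by (intro short) auto
    ultimately show ?case
      using curve_length_add[OF s(1,2)] by (simp add: ennreal_add_less_top)
  qed
  moreover obtain n where "(b - a) / (\<delta> / 2) \<le> real n"
    using real_arch_simple by blast
  then have "b \<le> a + real n * (\<delta> / 2)"
    using \<delta>(1) by (simp add: field_simps)
  ultimately show ?thesis using True by blast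
qed (simp add: curve_length_degenerate)

lemma arclength_increment:
  assumes "curve_length d c a b < top" "a \<le> u" "u \<le> v" "v \<le> b"
  shows "ennreal (enn2real (curve_length d c a v) - enn2real (curve_length d c a u))
           = curve_length d c u v"
    and "d (c u) (c v) \<le> enn2real (curve_length d c a v) - enn2real (curve_length d c a u)"
proof -
  have fin: "curve_length d c x y < top" if "a \<le> x" "y \<le> b" for x y
    using curve_length_mono[of a x y b d c] that assms(1) by (meson order_le_less_trans)
  have "enn2real (curve_length d c a v) - enn2real (curve_length d c a u)
          = enn2real (curve_length d c u v)"
    using fin assms by (simp add: curve_length_add[OF assms(2,3)] enn2real_plus)
  then show eq: "ennreal (enn2real (curve_length d c a v) - enn2real (curve_length d c a u))
           = curve_length d c u v"
    using fin[of u v] assms by simp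
  have "ennreal (d (c u) (c v)) \<le> curve_length d c u v"
    by (rule dist_le_curve_length) fact
  then show "d (c u) (c v) \<le> enn2real (curve_length d c a v) - enn2real (curve_length d c a u)"
    unfolding eq[symmetric]
    by (metis curve_length_mono assms(2-4) diff_ge_0_iff_ge enn2real_mono ennreal_le_iff fin order_refl)
qed

lemma abs_continuous_curve_arclength:
  assumes "abs_continuous_curve d c a b"
  obtains V :: "real \<Rightarrow> real" where "abs_continuous_curve dist V a b"
    "\<And>u v. a \<le> u \<Longrightarrow> u \<le> v \<Longrightarrow> v \<le> b \<Longrightarrow> d (c u) (c v) \<le> V v - V u"
proof -
  define V where "V t = enn2real (curve_length d c a t)" for t
  note inc = arclength_increment[OF abs_continuous_curve_rectifiable[OF assms], folded V_def]
  have "abs_continuous_curve dist V a b"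
    unfolding abs_continuous_curve_iff
  proof (intro allI impI)
    fix e :: real assume "e > 0"
    obtain \<delta> where \<delta>: "\<delta> > 0" "\<And>(S :: nat set) u v. short_intervals a b \<delta> S u v \<Longrightarrow>
        (\<Sum>i\<in>S. curve_length d c (u i) (v i)) \<le> ennreal (e / 2)"
      using abs_continuous_curve_length[OF assms half_gt_zero[OF \<open>e > 0\<close>], where ?'i = nat] by blast
    have "(\<Sum>i\<in>S. dist (V (u i)) (V (v i))) < e"
      if S: "short_intervals a b \<delta> S u v" for S :: "nat set" and u v
    proof -
      have uv: "\<forall>i\<in>S. a \<le> u i \<and> u i \<le> v i \<and> v i \<le> b" using S by (simp add: short_intervals_def)
      have nn: "0 \<le> V (v i) - V (u i)" if "i \<in> S" for i
      proof -
        have "d (c (u i)) (c (v i)) \<le> V (v i) - V (u i)" using uv that by (intro inc(2)) auto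
        then show ?thesis using nonneg[of "c (u i)" "c (v i)"] by linarith
      qed
      have "ennreal (\<Sum>i\<in>S. V (v i) - V (u i)) = (\<Sum>i\<in>S. ennreal (V (v i) - V (u i)))"
        using nn by (intro sum_ennreal[symmetric]) auto
      also have "\<dots> = (\<Sum>i\<in>S. curve_length d c (u i) (v i))"
        using uv by (intro sum.cong refl inc(1)) auto
      also have "\<dots> \<le> ennreal (e / 2)" by (rule \<delta>(2)[OF S])
      finally have "(\<Sum>i\<in>S. V (v i) - V (u i)) \<le> e / 2"
        using \<open>e > 0\<close> by (simp add: ennreal_le_iff)
      moreover have "(\<Sum>i\<in>S. dist (V (u i)) (V (v i))) = (\<Sum>i\<in>S. V (v i) - V (u i))"
        using nn by (intro sum.cong) (auto simp: dist_real_def)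
      ultimately show ?thesis using \<open>e > 0\<close> by linarith
    qed
    with \<delta>(1) show "\<exists>\<delta>>0. \<forall>(S :: nat set) u v. short_intervals a b \<delta> S u v \<longrightarrow>
        (\<Sum>i\<in>S. dist (V (u i)) (V (v i))) < e" by blast
  qed
  then show ?thesis using inc(2) by (rule that)
qed

text \<open>
  A partition that almost exhausts the length misses little when a further time close to \<open>t\<close> is
  inserted, and the part of the refined partition between that time and \<open>t\<close> is a single chord, which
  is short because the curve is continuous.
\<close>

lemma continuous_on_arclength:
  assumes fin: "curve_length d c a b < top"
    and cont: "\<And>t e. t \<in> {a..b} \<Longrightarrow> e > 0 \<Longrightarrow>
      \<exists>\<delta>>0. \<forall>u\<in>{a..b}. \<bar>u - t\<bar> < \<delta> \<longrightarrow> d (c u) (c t) < e"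
  shows "continuous_on {a..b} (\<lambda>t. enn2real (curve_length d c a t))"
  unfolding continuous_on_iff
proof (intro ballI allI impI)
  define V where "V t = enn2real (curve_length d c a t)" for t
  note inc = arclength_increment[OF fin, folded V_def]
  fix t e :: real assume t: "t \<in> {a..b}" and e: "e > 0"
  have fin': "curve_length d c x y < top" if "a \<le> x" "y \<le> b" for x y
    using curve_length_mono[of a x y b d c] that fin by (meson order_le_less_trans)
  obtain ts where ts: "sorted ts" "set ts \<subseteq> {a..b}"
    and exhaust: "curve_length d c a b < chord_sum d c ts + ennreal (e / 2)"
  proof -
    have "\<exists>ts\<in>{ts. sorted ts \<and> set ts \<subseteq> {a..b}}. curve_length d c a b < chord_sum d c ts + ennreal (e / 2)"
    proof (rule SUP_approx_ennreal)
      show "{ts. sorted ts \<and> set ts \<subseteq> {a..b}} \<noteq> {}"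
        by (simp, rule exI[of _ "[]"], simp)
      show "curve_length d c a b = (SUP ts\<in>{ts. sorted ts \<and> set ts \<subseteq> {a..b}}. chord_sum d c ts)"
        by (rule curve_length_eq_SUP_chord_sum)
    qed (use e fin in auto)
    then show ?thesis using that by blast
  qed
  obtain \<delta>1 where \<delta>1: "\<delta>1 > 0" "\<And>x. x \<in> set ts \<Longrightarrow> x \<noteq> t \<Longrightarrow> \<delta>1 \<le> dist t x"
    using finite_set_avoid[of "set ts" t] by auto
  obtain \<delta>2 where \<delta>2: "\<delta>2 > 0" "\<And>u. u \<in> {a..b} \<Longrightarrow> \<bar>u - t\<bar> < \<delta>2 \<Longrightarrow> d (c u) (c t) < e / 2"
    using cont[OF t, of "e / 2"] e by auto
  have "\<bar>V u - V t\<bar> < e" if u: "u \<in> {a..b}" "\<bar>u - t\<bar> < \<delta>1" "\<bar>u - t\<bar> < \<delta>2" for u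
  proof -
    obtain xs ys where split: "ts = xs @ ys"
      and xs: "\<And>x. x \<in> set xs \<Longrightarrow> x \<le> u" and ys: "\<And>y. y \<in> set ys \<Longrightarrow> u < y"
      using sorted_split_at[OF ts(1)] by metis
    have gap: "x = t \<or> \<bar>u - t\<bar> < \<bar>x - t\<bar>" if "x \<in> set ts" for x
      using \<delta>1(2)[OF that] u(2) unfolding dist_real_def by linarith
    define m M where "m = min u t" and "M = max u t"
    have mM: "a \<le> m" "m \<le> M" "M \<le> b" using u t by (auto simp: m_def M_def)
    have xs': "x \<le> m" if "x \<in> set xs" for x
      using xs[OF that] gap[of x] that split by (auto simp: m_def)
    have ys': "M \<le> y" if "y \<in> set ys" for y
      using ys[OF that] gap[of y] that split by (auto simp: M_def)
    have "chord_sum d c ts \<le> chord_sum d c (xs @ [m]) + chord_sum d c ([m] @ ys)"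
      unfolding split using chord_sum_insert by simp
    also have "\<dots> \<le> chord_sum d c (xs @ [m]) + (chord_sum d c ([m] @ [M]) + chord_sum d c (M # ys))"
      by (intro add_left_mono chord_sum_insert)
    also have "\<dots> \<le> curve_length d c a m + (ennreal (d (c m) (c M)) + curve_length d c M b)"
      using ts xs' ys' mM unfolding split
      by (intro add_mono chord_sum_le_curve_length) (auto simp: sorted_append)
    finally have "curve_length d c a b
        \<le> curve_length d c a m + (ennreal (d (c m) (c M)) + curve_length d c M b) + ennreal (e / 2)"
      by (rule order_trans[OF order_less_imp_le[OF exhaust] add_right_mono])
    moreover have "curve_length d c a b
        = curve_length d c a m + (curve_length d c m M + curve_length d c M b)"
      using curve_length_add[of a m b c] curve_length_add[of m M b c] mM by simp
    ultimately have "(curve_length d c a m + curve_length d c M b) + curve_length d c m M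
        \<le> (curve_length d c a m + curve_length d c M b) + ennreal (d (c m) (c M) + e / 2)"
      using e by (simp add: ac_simps ennreal_plus)
    moreover have "curve_length d c a m + curve_length d c M b < top"
      using fin' mM by (simp add: ennreal_add_less_top)
    ultimately have "curve_length d c m M \<le> ennreal (d (c m) (c M) + e / 2)"
      by (auto simp: ennreal_add_left_cancel_le)
    then have "ennreal (V M - V m) \<le> ennreal (d (c m) (c M) + e / 2)"
      using inc(1) mM by simp
    then have "V M - V m \<le> d (c m) (c M) + e / 2"
      using e by (subst (asm) ennreal_le_iff) auto
    moreover have "d (c m) (c M) = d (c u) (c t)"
      by (auto simp: m_def M_def min_def max_def commute)
    moreover have "\<bar>V u - V t\<bar> = V M - V m"
      using order_trans[OF nonneg inc(2)[OF mM]] by (auto simp: m_def M_def min_def max_def)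
    ultimately show ?thesis using \<delta>2(2)[OF u(1,3)] by linarith
  qed
  with \<delta>1(1) \<delta>2(1) show "\<exists>\<delta>>0. \<forall>u\<in>{a..b}. dist u t < \<delta> \<longrightarrow>
      dist (enn2real (curve_length d c a u)) (enn2real (curve_length d c a t)) < e"
    unfolding V_def by (intro exI[of _ "min \<delta>1 \<delta>2"]) (auto simp: dist_real_def)
qed

end

section \<open>Criteria for absolute continuity\<close>

text \<open>
  Every interval of a family of small total length is itself short, so the estimate is only required
  for parameters that are closer than some \<open>\<rho>\<close>.
\<close>

lemma abs_continuous_curve_locally_dominated:
  assumes ac: "abs_continuous_curve d1 c1 a b" "abs_continuous_curve d2 c2 a b"
    and "A \<ge> 0" "B \<ge> 0" "\<rho> > 0"
    and le: "\<And>u v. a \<le> u \<Longrightarrow> u \<le> v \<Longrightarrow> v \<le> b \<Longrightarrow> v - u < \<rho> \<Longrightarrow>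
      d (c u) (c v) \<le> A * d1 (c1 u) (c1 v) + B * d2 (c2 u) (c2 v)"
  shows "abs_continuous_curve d c a b"
  unfolding abs_continuous_curve_iff
proof (intro allI impI)
  fix e :: real assume "e > 0"
  define e' where "e' = e / (A + B + 1)"
  have e': "e' > 0" "(A + B) * e' < e"
    using \<open>e > 0\<close> assms(3,4) by (auto simp: e'_def field_simps)
  obtain \<delta>1 where \<delta>1: "\<delta>1 > 0" "\<forall>(S :: nat set) u v. short_intervals a b \<delta>1 S u v \<longrightarrow>
      (\<Sum>i\<in>S. d1 (c1 (u i)) (c1 (v i))) < e'"
    using abs_continuous_curve_finite[OF ac(1) e'(1)] by (elim exE conjE) (rule that)
  obtain \<delta>2 where \<delta>2: "\<delta>2 > 0" "\<forall>(S :: nat set) u v. short_intervals a b \<delta>2 S u v \<longrightarrow>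
      (\<Sum>i\<in>S. d2 (c2 (u i)) (c2 (v i))) < e'"
    using abs_continuous_curve_finite[OF ac(2) e'(1)] by (elim exE conjE) (rule that)
  have "(\<Sum>i\<in>S. d (c (u i)) (c (v i))) < e"
    if S: "short_intervals a b (min \<rho> (min \<delta>1 \<delta>2)) S u v" for S :: "nat set" and u v
  proof -
    have fin: "finite S" and uv: "\<And>i. i \<in> S \<Longrightarrow> a \<le> u i \<and> u i \<le> v i \<and> v i \<le> b"
      and sum: "(\<Sum>i\<in>S. v i - u i) < \<rho>"
      and S1: "short_intervals a b \<delta>1 S u v" and S2: "short_intervals a b \<delta>2 S u v"
      using S by (auto simp: short_intervals_def)
    have "v i - u i < \<rho>" if "i \<in> S" for i
    proof -
      have "v i - u i \<le> (\<Sum>i\<in>S. v i - u i)"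
        using uv that fin by (intro member_le_sum) auto
      then show ?thesis using sum by linarith
    qed
    then have "(\<Sum>i\<in>S. d (c (u i)) (c (v i)))
        \<le> (\<Sum>i\<in>S. A * d1 (c1 (u i)) (c1 (v i)) + B * d2 (c2 (u i)) (c2 (v i)))"
      using uv by (intro sum_mono le) auto
    also have "\<dots> = A * (\<Sum>i\<in>S. d1 (c1 (u i)) (c1 (v i))) + B * (\<Sum>i\<in>S. d2 (c2 (u i)) (c2 (v i)))"
      by (simp add: sum.distrib sum_distrib_left)
    also have "\<dots> \<le> A * e' + B * e'"
      using \<delta>1(2)[rule_format, OF S1] \<delta>2(2)[rule_format, OF S2] assms(3,4)
      by (intro add_mono mult_left_mono) auto
    also have "\<dots> < e" using e'(2) by (simp add: algebra_simps)
    finally show ?thesis .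
  qed
  with \<delta>1(1) \<delta>2(1) \<open>\<rho> > 0\<close> show "\<exists>\<delta>>0. \<forall>(S :: nat set) u v. short_intervals a b \<delta> S u v \<longrightarrow>
      (\<Sum>i\<in>S. d (c (u i)) (c (v i))) < e"
    by (intro exI[of _ "min \<rho> (min \<delta>1 \<delta>2)"]) auto
qed

lemma abs_continuous_curve_dominated:
  assumes "abs_continuous_curve d1 c1 a b" "abs_continuous_curve d2 c2 a b"
    and "A \<ge> 0" "B \<ge> 0"
    and "\<And>u v. a \<le> u \<Longrightarrow> u \<le> v \<Longrightarrow> v \<le> b \<Longrightarrow>
      d (c u) (c v) \<le> A * d1 (c1 u) (c1 v) + B * d2 (c2 u) (c2 v)"
  shows "abs_continuous_curve d c a b"
  by (rule abs_continuous_curve_locally_dominated[OF assms(1-4) zero_less_one], rule assms(5))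

lemma abs_continuous_curve_id: "abs_continuous_curve dist (\<lambda>t::real. t) a b"
  unfolding abs_continuous_curve_iff
proof (intro allI impI)
  fix e :: real assume "e > 0"
  have "(\<Sum>i\<in>S. dist (u i) (v i)) < e" if "short_intervals a b e S u v" for S :: "nat set" and u v
  proof -
    have "(\<Sum>i\<in>S. dist (u i) (v i)) = (\<Sum>i\<in>S. v i - u i)"
      using that by (intro sum.cong) (auto simp: dist_real_def short_intervals_def)
    with that show ?thesis by (simp add: short_intervals_def)
  qed
  with \<open>e > 0\<close> show "\<exists>\<delta>>0. \<forall>(S :: nat set) u v. short_intervals a b \<delta> S u v \<longrightarrow>
      (\<Sum>i\<in>S. dist (u i) (v i)) < e" by blast
qed

lemma abs_continuous_curve_Lipschitz:
  assumes "B \<ge> 0" "\<And>u v. a \<le> u \<Longrightarrow> u \<le> v \<Longrightarrow> v \<le> b \<Longrightarrow> d (c u) (c v) \<le> B * (v - u)"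
  shows "abs_continuous_curve d c a b"
proof (rule abs_continuous_curve_dominated[OF abs_continuous_curve_id abs_continuous_curve_id])
  show "d (c u) (c v) \<le> 0 * dist u v + B * dist u v" if "a \<le> u" "u \<le> v" "v \<le> b" for u v
    using assms(2)[OF that] that by (simp add: dist_real_def)
qed (use assms in auto)

lemma abs_continuous_curve_cong:
  assumes "abs_continuous_curve d c a b" "\<And>t. a \<le> t \<Longrightarrow> t \<le> b \<Longrightarrow> c' t = c t"
  shows "abs_continuous_curve d c' a b"
  by (rule abs_continuous_curve_dominated[OF assms(1,1), where A = 1 and B = 0]) (auto simp: assms(2))

lemma (in metric_on_type) abs_continuous_curve_append:
  assumes ac: "abs_continuous_curve d c a m" "abs_continuous_curve d c m b" and "a \<le> m" "m \<le> b"
  shows "abs_continuous_curve d c a b"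
  unfolding abs_continuous_curve_iff
proof (intro allI impI)
  fix e :: real assume "e > 0"
  then have e2: "e / 2 > 0" by simp
  obtain \<delta>1 where \<delta>1: "\<delta>1 > 0" "\<forall>(S :: nat set) u v. short_intervals a m \<delta>1 S u v \<longrightarrow>
      (\<Sum>i\<in>S. d (c (u i)) (c (v i))) < e / 2"
    using abs_continuous_curve_finite[OF ac(1) e2] by (elim exE conjE) (rule that)
  obtain \<delta>2 where \<delta>2: "\<delta>2 > 0" "\<forall>(S :: nat set) u v. short_intervals m b \<delta>2 S u v \<longrightarrow>
      (\<Sum>i\<in>S. d (c (u i)) (c (v i))) < e / 2"
    using abs_continuous_curve_finite[OF ac(2) e2] by (elim exE conjE) (rule that)
  have "(\<Sum>i\<in>S. d (c (u i)) (c (v i))) < e"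
    if S: "short_intervals a b (min \<delta>1 \<delta>2) S u v" for S :: "nat set" and u v
  proof -
    have fin: "finite S" and uv: "\<forall>i\<in>S. a \<le> u i \<and> u i \<le> v i \<and> v i \<le> b"
      "disjoint_family_on (\<lambda>i. {u i<..<v i}) S" "(\<Sum>i\<in>S. v i - u i) < min \<delta>1 \<delta>2"
      using S by (auto simp: short_intervals_def)
    have le: "d (c (u i)) (c (v i)) \<le> d (c (min (u i) m)) (c (min (v i) m)) + d (c (max (u i) m)) (c (max (v i) m))"
      if "i \<in> S" for i
    proof -
      have "u i \<le> v i" using uv(1) that by blast
      then consider "v i \<le> m" | "m \<le> u i" | "u i \<le> m" "m \<le> v i" by linarith
      then show ?thesis
      proof cases
        case 3
        then show ?thesis using triangle[of "c (u i)" "c m" "c (v i)"] by (simp add: min_def max_def)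
      qed (use \<open>u i \<le> v i\<close> in \<open>auto simp: min_def max_def\<close>)
    qed
    have disj1: "disjoint_family_on (\<lambda>i. {min (u i) m<..<min (v i) m}) S"
      using uv(2) by (rule disjoint_family_on_bisimulation) auto
    have disj2: "disjoint_family_on (\<lambda>i. {max (u i) m<..<max (v i) m}) S"
      using uv(2) by (rule disjoint_family_on_bisimulation) auto
    have sum1: "(\<Sum>i\<in>S. min (v i) m - min (u i) m) \<le> (\<Sum>i\<in>S. v i - u i)"
      and sum2: "(\<Sum>i\<in>S. max (v i) m - max (u i) m) \<le> (\<Sum>i\<in>S. v i - u i)"
      using uv(1) by (auto intro!: sum_mono simp: min_def max_def)
    have "(\<Sum>i\<in>S. d (c (min (u i) m)) (c (min (v i) m))) < e / 2"
    proof (rule \<delta>1(2)[rule_format])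
      show "short_intervals a m \<delta>1 S (\<lambda>i. min (u i) m) (\<lambda>i. min (v i) m)"
        using fin uv(1,3) disj1 sum1 \<open>a \<le> m\<close> unfolding short_intervals_def by (auto simp: min_le_iff_disj)
    qed
    moreover have "(\<Sum>i\<in>S. d (c (max (u i) m)) (c (max (v i) m))) < e / 2"
    proof (rule \<delta>2(2)[rule_format])
      show "short_intervals m b \<delta>2 S (\<lambda>i. max (u i) m) (\<lambda>i. max (v i) m)"
        using fin uv(1,3) disj2 sum2 \<open>m \<le> b\<close> unfolding short_intervals_def by (auto simp: le_max_iff_disj)
    qed
    moreover have "(\<Sum>i\<in>S. d (c (u i)) (c (v i)))
        \<le> (\<Sum>i\<in>S. d (c (min (u i) m)) (c (min (v i) m)) + d (c (max (u i) m)) (c (max (v i) m)))"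
      using le by (intro sum_mono) auto
    ultimately show ?thesis by (simp add: sum.distrib)
  qed
  with \<delta>1(1) \<delta>2(1) show "\<exists>\<delta>>0. \<forall>(S :: nat set) u v. short_intervals a b \<delta> S u v \<longrightarrow>
      (\<Sum>i\<in>S. d (c (u i)) (c (v i))) < e"
    by (intro exI[of _ "min \<delta>1 \<delta>2"]) auto
qed

lemma abs_continuous_curve_reverse:
  assumes ac: "abs_continuous_curve d c a b" and comm: "\<And>x y. d x y = d y x"
  shows "abs_continuous_curve d (\<lambda>t. c (- t)) (- b) (- a)"
  unfolding abs_continuous_curve_iff
proof (intro allI impI)
  fix e :: real assume "e > 0"
  obtain \<delta> where \<delta>: "\<delta> > 0" "\<forall>(S :: nat set) u v. short_intervals a b \<delta> S u v \<longrightarrow>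
      (\<Sum>i\<in>S. d (c (u i)) (c (v i))) < e"
    using abs_continuous_curve_finite[OF ac \<open>e > 0\<close>] by (elim exE conjE) (rule that)
  have "(\<Sum>i\<in>S. d (c (- u i)) (c (- v i))) < e"
    if S: "short_intervals (- b) (- a) \<delta> S u v" for S :: "nat set" and u v
  proof -
    have disj: "{- v i<..<- u i} \<inter> {- v j<..<- u j} = {}" if "i \<in> S" "j \<in> S" "i \<noteq> j" for i j
    proof -
      have "{- v i<..<- u i} \<inter> {- v j<..<- u j} = uminus ` ({u i<..<v i} \<inter> {u j<..<v j})"
        by (auto simp: image_iff intro!: bexI[of _ "- _"])
      then show ?thesis using S that unfolding short_intervals_def disjoint_family_on_def by simp
    qed
    have "short_intervals a b \<delta> S (\<lambda>i. - v i) (\<lambda>i. - u i)"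
      using S disj unfolding short_intervals_def disjoint_family_on_def by force
    then have "(\<Sum>i\<in>S. d (c (- v i)) (c (- u i))) < e" by (rule \<delta>(2)[rule_format])
    then show ?thesis by (simp add: comm[of "c (- u _)"])
  qed
  with \<delta>(1) show "\<exists>\<delta>>0. \<forall>(S :: nat set) u v. short_intervals (- b) (- a) \<delta> S u v \<longrightarrow>
      (\<Sum>i\<in>S. d (c (- u i)) (c (- v i))) < e"
    by blast
qed

lemma abs_continuous_curve_uniform:
  assumes "abs_continuous_curve d c a b" "e > 0"
  shows "\<exists>\<delta>>0. \<forall>u v. a \<le> u \<and> u \<le> v \<and> v \<le> b \<and> v - u < \<delta> \<longrightarrow> d (c u) (c v) < e"
proof -
  obtain \<delta> where \<delta>: "\<delta> > 0" "\<forall>(S :: unit set) u v. short_intervals a b \<delta> S u v \<longrightarrow>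
      (\<Sum>i\<in>S. d (c (u i)) (c (v i))) < e"
    using abs_continuous_curve_finite[OF assms] by (elim exE conjE) (rule that)
  have "d (c u) (c v) < e" if "a \<le> u" "u \<le> v" "v \<le> b" "v - u < \<delta>" for u v
    using \<delta>(2)[rule_format, of "{()}" "\<lambda>_. u" "\<lambda>_. v"] that
    by (simp add: short_intervals_def disjoint_family_on_def)
  with \<delta>(1) show ?thesis by blast
qed

lemma abs_continuous_imp_continuous_on:
  assumes "abs_continuous_curve dist (F :: real \<Rightarrow> real) a b"
  shows "continuous_on {a..b} F"
  unfolding continuous_on_iff
proof (intro ballI allI impI)
  fix x e :: real assume x: "x \<in> {a..b}" and "e > 0"
  obtain \<delta> where \<delta>: "\<delta> > 0" "\<And>u v. a \<le> u \<and> u \<le> v \<and> v \<le> b \<and> v - u < \<delta> \<Longrightarrow> dist (F u) (F v) < e"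
    using abs_continuous_curve_uniform[OF assms \<open>e > 0\<close>] by blast
  have "dist (F y) (F x) < e" if "y \<in> {a..b}" "dist y x < \<delta>" for y
    using \<delta>(2)[of x y] \<delta>(2)[of y x] x that
    by (cases "x \<le> y") (auto simp: dist_real_def abs_minus_commute)
  with \<delta>(1) show "\<exists>d>0. \<forall>y\<in>{a..b}. dist y x < d \<longrightarrow> dist (F y) (F x) < e" by blast
qed

lemma metric_on_type_dist: "metric_on_type (dist :: 'a::metric_space \<Rightarrow> 'a \<Rightarrow> real)"
  by unfold_locales (auto simp: dist_commute dist_triangle)

section \<open>Absolutely continuous real functions are integrals\<close>

text \<open>
  A null set lies in an open set of small measure, and the covering lemma provides countably many
  nonoverlapping compact intervals between the two. Absolute continuity bounds the increments of \<open>F\<close>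
  over any finitely many of them.
\<close>

lemma interval_measure_null_set:
  assumes mono: "mono F" and cont: "continuous_on UNIV F"
    and ac: "abs_continuous_curve dist F a b" and "a < b"
    and N: "N \<in> null_sets lborel" "N \<subseteq> {a..b}"
  shows "emeasure (interval_measure F) N = 0"
proof -
  let ?\<mu> = "interval_measure F"
  have Icc: "emeasure ?\<mu> {u..v} = ennreal (F v - F u)" if "u \<le> v" for u v
    using emeasure_interval_measure_Icc[OF that _ cont] monoD[OF mono] by simp
  have "emeasure ?\<mu> N \<le> ennreal e" if "e > 0" for e :: real
  proof -
    obtain \<delta> where \<delta>: "\<delta> > 0"
      "\<And>(S :: real set set) u v. short_intervals a b \<delta> S u v \<Longrightarrow>
        (\<Sum>i\<in>S. dist (F (u i)) (F (v i))) < e"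
      using abs_continuous_curve_finite[OF ac \<open>e > 0\<close>, where ?'i = "real set"] by blast
    have Nb: "N \<in> sets borel" using N by auto
    obtain U where U: "open U" "N \<subseteq> U" "emeasure lborel (U - N) < ennreal \<delta>"
      using outer_regular_lborel[OF Nb \<delta>(1)] by metis
    have "emeasure lborel U = emeasure lborel (U - N)"
      using U Nb N by (intro emeasure_Diff_null_set[symmetric]) auto
    with U have Ulen: "emeasure lborel U < ennreal \<delta>" by simp
    define g where "g x = (if x \<in> U then U else UNIV)" for x
    have gauge: "gauge g" using U(1) unfolding gauge_def g_def by auto
    obtain D where D: "countable D" "\<Union>D \<subseteq> cbox a b"
        "\<And>K. K \<in> D \<Longrightarrow> interior K \<noteq> {} \<and> (\<exists>c d. K = cbox c d)"
        "pairwise (\<lambda>A B. interior A \<inter> interior B = {}) D"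
        "\<And>K. K \<in> D \<Longrightarrow> \<exists>x \<in> N \<inter> K. K \<subseteq> g x" "N \<subseteq> \<Union>D"
    proof (rule covering_lemma[of N a b g, OF _ _ gauge])
      show "N \<subseteq> cbox a b" "box a b \<noteq> {}" using N(2) \<open>a < b\<close> by auto
    qed blast
    have K: "K = {Inf K..Sup K} \<and> Inf K < Sup K \<and> interior K = {Inf K<..<Sup K} \<and> K \<subseteq> U \<and> K \<subseteq> {a..b}"
      if KD: "K \<in> D" for K
    proof -
      obtain x y where xy: "K = {x..y}" "interior K \<noteq> {}" using D(3)[OF KD] by auto
      then have "x < y" by (metis interior_atLeastAtMost_real greaterThanLessThan_empty_iff not_le)
      moreover have "K \<subseteq> U"
      proof -
        from D(5)[OF KD] obtain z where z: "z \<in> N" "K \<subseteq> g z" by blast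
        then have "z \<in> U" using U(2) by blast
        with z show ?thesis by (simp add: g_def)
      qed
      moreover have "K \<subseteq> {a..b}"
        using order_trans[OF Union_upper[OF KD] D(2)] by simp
      ultimately show ?thesis using xy by auto
    qed
    have fin: "emeasure ?\<mu> (\<Union>D') \<le> ennreal e" if D': "finite D'" "D' \<subseteq> D" for D'
    proof -
      have sub: "K \<in> D" if "K \<in> D'" for K using that D' by auto
      have disj: "disjoint_family_on (\<lambda>K. {Inf K<..<Sup K}) D'"
      proof -
        have "{Inf A<..<Sup A} \<inter> {Inf B<..<Sup B} = {}" if "A \<in> D'" "B \<in> D'" "A \<noteq> B" for A B
          using pairwiseD[OF D(4) sub[OF that(1)] sub[OF that(2)] that(3)]
            K[OF sub[OF that(1)]] K[OF sub[OF that(2)]] by metis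
        then show ?thesis unfolding disjoint_family_on_def by blast
      qed
      have len: "0 \<le> Sup K - Inf K" if "K \<in> D'" for K
        using K[OF sub[OF that]] by linarith
      have "ennreal (\<Sum>K\<in>D'. Sup K - Inf K) = (\<Sum>K\<in>D'. ennreal (Sup K - Inf K))"
        using len by (intro sum_ennreal[symmetric]) auto
      also have "\<dots> = (\<Sum>K\<in>D'. emeasure lborel {Inf K<..<Sup K})"
        using len by (intro sum.cong) auto
      also have "\<dots> = emeasure lborel (\<Union>K\<in>D'. {Inf K<..<Sup K})"
        using disj D' by (intro sum_emeasure) auto
      also have "\<dots> \<le> emeasure lborel U"
      proof (rule emeasure_mono)
        show "(\<Union>K\<in>D'. {Inf K<..<Sup K}) \<subseteq> U"
        proof (rule UN_least)
          fix L assume "L \<in> D'"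
          then have "{Inf L<..<Sup L} \<subseteq> L" "L \<subseteq> U"
            using K[OF sub[of L]] interior_subset[of L] by auto
          then show "{Inf L<..<Sup L} \<subseteq> U" by blast
        qed
      qed (use U in auto)
      finally have "ennreal (\<Sum>K\<in>D'. Sup K - Inf K) < ennreal \<delta>"
        using Ulen by (rule order_le_less_trans)
      then have "(\<Sum>K\<in>D'. Sup K - Inf K) < \<delta>"
        using len by (subst (asm) ennreal_less_iff) (auto intro!: sum_nonneg)
      moreover have "a \<le> Inf L \<and> Inf L \<le> Sup L \<and> Sup L \<le> b" if "L \<in> D'" for L
      proof -
        note KL = K[OF sub[OF that]]
        then have "Inf L \<in> L" "Sup L \<in> L"
          by (metis atLeastAtMost_iff less_imp_le order_refl)+
        with KL show ?thesis by auto
      qed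
      ultimately have "short_intervals a b \<delta> D' Inf Sup"
        using D' disj by (auto simp: short_intervals_def)
      then have small: "(\<Sum>K\<in>D'. dist (F (Inf K)) (F (Sup K))) < e"
        by (rule \<delta>(2))
      have "emeasure ?\<mu> (\<Union>D') = emeasure ?\<mu> (\<Union>K\<in>D'. {Inf K..Sup K})"
        using K sub by (metis (no_types, lifting) SUP_cong image_ident)
      also have "\<dots> \<le> (\<Sum>K\<in>D'. emeasure ?\<mu> {Inf K..Sup K})"
        using D' by (intro emeasure_subadditive_finite) auto
      also have "\<dots> = (\<Sum>K\<in>D'. ennreal (dist (F (Inf K)) (F (Sup K))))"
      proof (rule sum.cong)
        fix L assume "L \<in> D'"
        then have "Inf L \<le> Sup L" using len by fastforce
        then show "emeasure ?\<mu> {Inf L..Sup L} = ennreal (dist (F (Inf L)) (F (Sup L)))"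
          using Icc monoD[OF mono] by (simp add: dist_real_def)
      qed simp
      also have "\<dots> = ennreal (\<Sum>K\<in>D'. dist (F (Inf K)) (F (Sup K)))"
        by (rule sum_ennreal) auto
      also have "\<dots> \<le> ennreal e" using small by (intro ennreal_leI) auto
      finally show ?thesis .
    qed
    have meas: "K \<in> sets ?\<mu>" if "K \<in> D" for K
    proof -
      from D(3)[OF that] obtain x y where "K = cbox x y" by blast
      then show ?thesis by simp
    qed
    have "emeasure ?\<mu> (\<Union>D) \<le> ennreal e"
    proof (cases "D = {}")
      case False
      define E where "E n = \<Union>(from_nat_into D ` {..<n})" for n :: nat
      have inD: "from_nat_into D n \<in> D" for n using False by (rule from_nat_into)
      have "(SUP n. emeasure ?\<mu> (E n)) = emeasure ?\<mu> (\<Union>n. E n)"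
      proof (rule SUP_emeasure_incseq)
        show "range E \<subseteq> sets ?\<mu>"
          unfolding E_def using meas inD by (auto intro!: sets.finite_Union)
        show "incseq E"
          unfolding E_def incseq_def by fastforce
      qed
      moreover have "(\<Union>n. E n) = \<Union>D"
      proof -
        have "(\<Union>n. E n) = \<Union>(range (from_nat_into D))" unfolding E_def by auto
        then show ?thesis using range_from_nat_into[OF False D(1)] by simp
      qed
      moreover have "emeasure ?\<mu> (E n) \<le> ennreal e" for n
        unfolding E_def using inD by (intro fin) auto
      ultimately show ?thesis by (metis SUP_least)
    qed simp
    moreover have "\<Union>D \<in> sets ?\<mu>"
      using D(1) meas by (intro sets.countable_Union) auto
    ultimately show ?thesis
      using emeasure_mono[OF D(6), of ?\<mu>] by (meson order_trans)
  qed
  then have "emeasure ?\<mu> N \<le> 0"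
    by - (rule ennreal_le_epsilon, simp only: add_0)
  then show ?thesis by simp
qed

text \<open>
  The Stieltjes measure of a monotone absolutely continuous function has a density by the theorem of
  Radon and Nikodym.
\<close>

lemma mono_abs_continuous_integral:
  fixes F :: "real \<Rightarrow> real"
  assumes ac: "abs_continuous_curve dist F a b" and "a < b"
    and mono: "\<And>u v. a \<le> u \<Longrightarrow> u \<le> v \<Longrightarrow> v \<le> b \<Longrightarrow> F u \<le> F v"
  obtains f where "f integrable_on {a..b}" "\<And>x. 0 \<le> f x"
    "\<And>u v. a \<le> u \<Longrightarrow> u \<le> v \<Longrightarrow> v \<le> b \<Longrightarrow> (f has_integral (F v - F u)) {u..v}"
proof -
  define G where "G x = F (max a (min b x))" for x
  have G_eq: "G x = F x" if "x \<in> {a..b}" for x using that by (auto simp: G_def)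
  have G_mono: "mono G" unfolding G_def
    using \<open>a < b\<close> by (intro monoI mono) (auto simp: max_def min_def)
  have G_cont: "continuous_on UNIV G" unfolding G_def
    using \<open>a < b\<close>
    by (intro continuous_on_compose2[OF abs_continuous_imp_continuous_on[OF ac]] continuous_intros) auto
  have G_ac: "abs_continuous_curve dist G a b"
    by (rule abs_continuous_curve_dominated[OF ac ac, where A = 1 and B = 0]) (auto simp: G_eq)
  define \<mu> where "\<mu> = interval_measure G"
  have \<mu>Icc: "emeasure \<mu> {u..v} = ennreal (G v - G u)" if "u \<le> v" for u v
    unfolding \<mu>_def using emeasure_interval_measure_Icc[OF that _ G_cont] monoD[OF G_mono] by simp
  have sets_\<mu>: "sets \<mu> = sets borel" by (simp add: \<mu>_def)
  have outside: "emeasure \<mu> ((\<Union>n::nat. {a - n..a}) \<union> (\<Union>n::nat. {b..b + n})) = 0"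
  proof -
    have "emeasure \<mu> (\<Union>n::nat. {a - n..a}) = 0" "emeasure \<mu> (\<Union>n::nat. {b..b + n}) = 0"
      using \<open>a < b\<close>
      by (auto intro!: emeasure_UN_eq_0 simp: \<mu>Icc sets_\<mu>) (simp_all add: G_def)
    then show ?thesis
      by (intro antisym[OF order_trans[OF emeasure_subadditive]]) (auto simp: sets_\<mu>)
  qed
  have cover: "UNIV = {a..b} \<union> ((\<Union>n::nat. {a - n..a}) \<union> (\<Union>n::nat. {b..b + n}))"
  proof -
    have "x \<in> {a..b} \<union> ((\<Union>n::nat. {a - n..a}) \<union> (\<Union>n::nat. {b..b + n}))" for x
    proof -
      obtain n :: nat where "\<bar>x\<bar> + \<bar>a\<bar> + \<bar>b\<bar> \<le> n" using real_arch_simple by blast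
      then have "x \<in> {a..b} \<or> x \<in> {a - n..a} \<or> x \<in> {b..b + n}" by auto
      then show ?thesis by blast
    qed
    then show ?thesis by blast
  qed
  have "absolutely_continuous lborel \<mu>"
    unfolding absolutely_continuous_def
  proof
    fix N :: "real set" assume N: "N \<in> null_sets lborel"
    then have Nb: "N \<in> sets borel" by auto
    have "emeasure \<mu> (N \<inter> {a..b}) = 0"
      unfolding \<mu>_def
      using N by (intro interval_measure_null_set[OF G_mono G_cont G_ac \<open>a < b\<close>])
        (auto intro: null_set_Int2)
    moreover have "emeasure \<mu> N \<le> emeasure \<mu> ((N \<inter> {a..b}) \<union>
        ((\<Union>n::nat. {a - n..a}) \<union> (\<Union>n::nat. {b..b + n})))"
      using Nb cover by (intro emeasure_mono) (auto simp: sets_\<mu>)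
    moreover have "\<dots> \<le> emeasure \<mu> (N \<inter> {a..b}) +
        emeasure \<mu> ((\<Union>n::nat. {a - n..a}) \<union> (\<Union>n::nat. {b..b + n}))"
      using Nb by (intro emeasure_subadditive) (auto simp: sets_\<mu>)
    ultimately have "emeasure \<mu> N = 0" using outside by simp
    then show "N \<in> null_sets \<mu>" using Nb by (auto simp: null_sets_def sets_\<mu>)
  qed
  then obtain g where g: "g \<in> borel_measurable lborel" "density lborel g = \<mu>"
    using sigma_finite_measure.Radon_Nikodym[OF sigma_finite_lborel, of \<mu>] by (auto simp: sets_\<mu>)
  have total: "emeasure \<mu> UNIV < top"
  proof -
    have "emeasure \<mu> UNIV \<le> emeasure \<mu> {a..b} +
        emeasure \<mu> ((\<Union>n::nat. {a - n..a}) \<union> (\<Union>n::nat. {b..b + n}))"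
      by (subst cover) (intro emeasure_subadditive, auto simp: sets_\<mu>)
    also have "\<dots> < top" using outside \<mu>Icc[of a b] \<open>a < b\<close> by simp
    finally show ?thesis .
  qed
  have "(\<integral>\<^sup>+x. g x \<partial>lborel) = emeasure \<mu> UNIV"
    using emeasure_density[OF g(1), of UNIV] g(2) by simp
  with total have "AE x in lborel. g x \<noteq> \<infinity>"
    using g(1) by (intro nn_integral_PInf_AE) auto
  then have enn: "AE x in lborel. ennreal (enn2real (g x)) = g x"
    by eventually_elim (simp add: less_top)
  define f where "f = (\<lambda>x. enn2real (g x))"
  have f_meas: "f \<in> borel_measurable borel" using g(1) by (simp add: f_def measurable_lborel1)
  have f_int: "(f has_integral (F v - F u)) {u..v}" if uv: "a \<le> u" "u \<le> v" "v \<le> b" for u v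
  proof -
    have "(\<integral>\<^sup>+x. ennreal (indicator {u..v} x * f x) \<partial>lborel) = (\<integral>\<^sup>+x. g x * indicator {u..v} x \<partial>lborel)"
      using enn by (intro nn_integral_cong_AE) (auto simp: f_def elim!: eventually_mono split: split_indicator)
    also have "\<dots> = emeasure \<mu> {u..v}"
      using emeasure_density[OF g(1), of "{u..v}"] g(2) by simp
    also have "\<dots> = ennreal (F v - F u)" using \<mu>Icc[OF uv(2)] uv by (simp add: G_eq)
    finally have "((\<lambda>x. indicator {u..v} x * f x) has_integral (F v - F u)) UNIV"
      using f_meas mono[OF uv] by (intro nn_integral_has_integral) (auto simp: f_def)
    moreover have "(\<lambda>x. indicator {u..v} x * f x) = (\<lambda>x. if x \<in> {u..v} then f x else 0)"
      by (auto simp: indicator_def)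
    ultimately show ?thesis
      by (simp only: has_integral_restrict_UNIV)
  qed
  show ?thesis
  proof
    show "f integrable_on {a..b}" using f_int[of a b] \<open>a < b\<close> by (auto simp: integrable_on_def)
    show "0 \<le> f x" for x by (simp add: f_def)
  qed (use f_int in auto)
qed

text \<open>
  With \<open>V\<close> the arc length, that is, the total variation, \<open>F = (V + F) - V\<close> is a difference of monotone
  functions that are again absolutely continuous.
\<close>

lemma abs_continuous_integral:
  fixes F :: "real \<Rightarrow> real"
  assumes ac: "abs_continuous_curve dist F a b" and "a < b"
  obtains f where "f absolutely_integrable_on {a..b}"
    "\<And>u v. a \<le> u \<Longrightarrow> u \<le> v \<Longrightarrow> v \<le> b \<Longrightarrow> (f has_integral (F v - F u)) {u..v}"
proof -
  interpret metric_on_type "dist :: real \<Rightarrow> real \<Rightarrow> real"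
    by (rule metric_on_type_dist)
  obtain V where V: "abs_continuous_curve dist V a b"
    "\<And>u v. a \<le> u \<Longrightarrow> u \<le> v \<Longrightarrow> v \<le> b \<Longrightarrow> dist (F u) (F v) \<le> V v - V u"
    using abs_continuous_curve_arclength[OF ac] by metis
  have "V u \<le> V v" if "a \<le> u" "u \<le> v" "v \<le> b" for u v
    using V(2)[OF that] zero_le_dist[of "F u" "F v"] by linarith
  then obtain f1 where f1: "f1 integrable_on {a..b}" "\<And>x. 0 \<le> f1 x"
    "\<And>u v. a \<le> u \<Longrightarrow> u \<le> v \<Longrightarrow> v \<le> b \<Longrightarrow> (f1 has_integral (V v - V u)) {u..v}"
    using mono_abs_continuous_integral[OF V(1) \<open>a < b\<close>] by metis
  have ac2: "abs_continuous_curve dist (\<lambda>t. V t + F t) a b"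
    by (rule abs_continuous_curve_dominated[OF V(1) ac, where A = 1 and B = 1])
      (auto simp: dist_real_def)
  have "V u + F u \<le> V v + F v" if "a \<le> u" "u \<le> v" "v \<le> b" for u v
    using V(2)[OF that] by (simp add: dist_real_def abs_le_iff)
  then obtain f2 where f2: "f2 integrable_on {a..b}" "\<And>x. 0 \<le> f2 x"
    "\<And>u v. a \<le> u \<Longrightarrow> u \<le> v \<Longrightarrow> v \<le> b \<Longrightarrow> (f2 has_integral ((V v + F v) - (V u + F u))) {u..v}"
    using mono_abs_continuous_integral[OF ac2 \<open>a < b\<close>] by metis
  show ?thesis
  proof
    show "(\<lambda>x. f2 x - f1 x) absolutely_integrable_on {a..b}"
      using f1 f2 by (intro set_integral_diff nonnegative_absolutely_integrable_1) auto
    show "((\<lambda>x. f2 x - f1 x) has_integral (F v - F u)) {u..v}" if "a \<le> u" "u \<le> v" "v \<le> b" for u v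
      using has_integral_diff[OF f2(3)[OF that] f1(3)[OF that]] by (simp add: algebra_simps)
  qed
qed

section \<open>Lebesgue differentiation\<close>

lemma right_average_converges:
  fixes f :: "real \<Rightarrow> real"
  assumes "\<And>a b. f integrable_on {a..b}"
  obtains N where "negligible N"
    "\<And>x e. x \<notin> N \<Longrightarrow> 0 < e \<Longrightarrow>
       \<exists>d>0. \<forall>h. 0 < h \<and> h < d \<longrightarrow> \<bar>integral {x..x + h} f / h - f x\<bar> < e"
  using integrable_ccontinuous_explicit[of f] assms by (auto simp: divide_inverse mult.commute)

lemma negligible_uminus:
  fixes N :: "real set"
  assumes "negligible N"
  shows "negligible (uminus ` N)"
  by (rule negligible_differentiable_image_negligible[OF _ assms]) (auto intro: derivative_intros)

text \<open>
  Averages over intervals to the right converge almost everywhere; those to the left are averages to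
  the right of the reflected function.
\<close>

lemma Lebesgue_differentiation:
  fixes f :: "real \<Rightarrow> real"
  assumes "f integrable_on {a..b}"
  shows "AE t in lebesgue. t \<in> {a<..<b} \<longrightarrow>
           ((\<lambda>x. integral {a..x} f) has_real_derivative f t) (at t)"
proof -
  define g where "g x = (if x \<in> {a..b} then f x else 0)" for x
  have "g integrable_on UNIV"
    unfolding g_def using assms by (simp only: integrable_restrict_UNIV)
  then have g: "g integrable_on {u..v}" for u v
    using integrable_on_subinterval by blast
  have g': "(\<lambda>x. g (- x)) integrable_on {u..v}" for u v
    using g[of "- v" "- u"] Henstock_Kurzweil_Integration.integrable_reflect_real[of g "- u" "- v"]
    by simp
  obtain N1 where N1: "negligible N1" "\<And>x e. x \<notin> N1 \<Longrightarrow> 0 < e \<Longrightarrow>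
       \<exists>d>0. \<forall>h. 0 < h \<and> h < d \<longrightarrow> \<bar>integral {x..x + h} g / h - g x\<bar> < e"
    using right_average_converges[OF g] by metis
  obtain N2 where N2: "negligible N2" "\<And>x e. x \<notin> N2 \<Longrightarrow> 0 < e \<Longrightarrow>
       \<exists>d>0. \<forall>h. 0 < h \<and> h < d \<longrightarrow> \<bar>integral {x..x + h} (\<lambda>x. g (- x)) / h - g (- x)\<bar> < e"
    using right_average_converges[OF g'] by metis
  have "((\<lambda>x. integral {a..x} f) has_real_derivative f t) (at t)"
    if t: "t \<in> {a<..<b}" "t \<notin> N1" "- t \<notin> N2" for t
    unfolding DERIV_def
  proof (rule LIM_I)
    fix e :: real assume "e > 0"
    obtain d1 where d1: "d1 > 0"
      "\<And>h. 0 < h \<Longrightarrow> h < d1 \<Longrightarrow> \<bar>integral {t..t + h} g / h - g t\<bar> < e"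
      using N1(2)[OF t(2) \<open>e > 0\<close>] by blast
    obtain d2 where d2: "d2 > 0"
      "\<And>h. 0 < h \<Longrightarrow> h < d2 \<Longrightarrow> \<bar>integral {- t..- t + h} (\<lambda>x. g (- x)) / h - g t\<bar> < e"
      using N2(2)[OF t(3) \<open>e > 0\<close>] by auto
    define d where "d = min (min d1 d2) (min (t - a) (b - t))"
    have d: "d > 0" using d1(1) d2(1) t(1) by (auto simp: d_def)
    have gt: "g t = f t" using t(1) by (simp add: g_def)
    have inc: "integral {a..v} f - integral {a..u} f = integral {u..v} g"
      if "a \<le> u" "u \<le> v" "v \<le> b" for u v
    proof -
      have "f integrable_on {a..v}" using integrable_on_subinterval[OF assms] that by auto
      then have "integral {a..u} f + integral {u..v} f = integral {a..v} f"
        using that by (intro Henstock_Kurzweil_Integration.integral_combine) auto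
      moreover have "integral {u..v} f = integral {u..v} g"
        using that by (intro integral_cong) (auto simp: g_def)
      ultimately show ?thesis by simp
    qed
    have "norm ((integral {a..t + h} f - integral {a..t} f) / h - f t) < e" if h: "h \<noteq> 0" "norm (h - 0) < d" for h
    proof (cases "h > 0")
      case True
      then show ?thesis
        using d1(2)[of h] h t(1) inc[of t "t + h"] by (simp add: d_def gt)
    next
      case False
      have "integral {- t..- t + - h} (\<lambda>x. g (- x)) = integral {t + h..t} g"
        using Henstock_Kurzweil_Integration.integral_reflect_real[of t "t + h" g] by simp
      then show ?thesis
        using d2(2)[of "- h"] h t(1) inc[of "t + h" t] False
        by (simp add: d_def minus_diff_eq[symmetric, of "integral {a..t + h} f"] gt del: minus_diff_eq)
    qed
    with d show "\<exists>s>0. \<forall>h. h \<noteq> 0 \<and> norm (h - 0) < s \<longrightarrow>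
        norm ((integral {a..t + h} f - integral {a..t} f) / h - f t) < e" by blast
  qed
  then have "{t. \<not> (t \<in> {a<..<b} \<longrightarrow> ((\<lambda>x. integral {a..x} f) has_real_derivative f t) (at t))}
      \<subseteq> N1 \<union> uminus ` N2"
    by (metis (mono_tags, lifting) UnI1 UnI2 image_eqI mem_Collect_eq minus_minus subsetI)
  moreover have "negligible (N1 \<union> uminus ` N2)"
    using N1(1) N2(1) by (intro negligible_Un negligible_uminus)
  ultimately show ?thesis
    unfolding eventually_ae_filter_negligible by blast
qed

lemma abs_continuous_derivative:
  fixes F :: "real \<Rightarrow> real"
  assumes ac: "abs_continuous_curve dist F a b" and "a < b"
  obtains f where "f absolutely_integrable_on {a..b}"
    "\<And>u v. a \<le> u \<Longrightarrow> u \<le> v \<Longrightarrow> v \<le> b \<Longrightarrow> (f has_integral (F v - F u)) {u..v}"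
    "AE t in lebesgue. t \<in> {a<..<b} \<longrightarrow> (F has_real_derivative f t) (at t)"
proof -
  obtain f where f: "f absolutely_integrable_on {a..b}"
    "\<And>u v. a \<le> u \<Longrightarrow> u \<le> v \<Longrightarrow> v \<le> b \<Longrightarrow> (f has_integral (F v - F u)) {u..v}"
    using abs_continuous_integral[OF assms] by metis
  have "f integrable_on {a..b}" using f(2)[of a b] \<open>a < b\<close> by (auto simp: integrable_on_def)
  from Lebesgue_differentiation[OF this]
  have "AE t in lebesgue. t \<in> {a<..<b} \<longrightarrow> (F has_real_derivative f t) (at t)"
  proof eventually_elim
    case (elim t)
    show ?case
    proof
      assume t: "t \<in> {a<..<b}"
      then have der: "((\<lambda>x. F a + integral {a..x} f) has_real_derivative f t) (at t)"
        using elim by (auto intro!: derivative_eq_intros)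
      have "F a + integral {a..x} f = F x" if "x \<in> {a<..<b}" for x
        using integral_unique[OF f(2)[of a x]] that by simp
      then show "(F has_real_derivative f t) (at t)"
        using has_field_derivative_transform_within_open[OF der open_greaterThanLessThan t] by blast
    qed
  qed
  with f show ?thesis by (rule that)
qed

lemma AE_interval_negligible:
  fixes a b :: real
  assumes "AE t in lebesgue. t \<in> {a<..<b} \<longrightarrow> P t"
  obtains N where "negligible N" "\<And>t. t \<in> {a..b} - N \<Longrightarrow> P t"
proof -
  obtain N where N: "negligible N" "{t. \<not> (t \<in> {a<..<b} \<longrightarrow> P t)} \<subseteq> N"
    using assms unfolding eventually_ae_filter_negligible by blast
  have "P t" if "t \<in> {a..b} - (N \<union> {a, b})" for t
  proof -
    have "t \<in> {a<..<b}" "t \<notin> N" using that by auto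
    then show ?thesis using N(2) by blast
  qed
  then show ?thesis using N(1) by (intro that[of "N \<union> {a, b}"] negligible_Un) auto
qed

lemma DERIV_quotient_tendsto:
  assumes "(F has_real_derivative D) (at t)"
  shows "((\<lambda>u. \<bar>F u - F t\<bar> / \<bar>u - t\<bar>) \<longlongrightarrow> \<bar>D\<bar>) (at t)"
  using tendsto_rabs[OF assms[unfolded has_field_derivative_iff]] by (simp add: abs_divide)

section \<open>The metric speed of an absolutely continuous curve\<close>

context metric_on_type
begin

lemma dist_diff_le: "\<bar>d x z - d y z\<bar> \<le> d x y"
  using triangle[of x y z] triangle[of y x z] by (simp add: commute abs_le_iff)

text \<open>
  The distances to countably many points that are dense on the curve are absolutely continuous
  functions of time. Almost everywhere they are all differentiable, and the supremum \<open>m\<close> of the absolute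
  values of their derivatives is the metric speed. By the triangle inequality the difference quotients
  of these functions are at most those of the curve, so the lower limit of the latter is at least \<open>m\<close>.
  Conversely, the distance of two points is the supremum of the differences of their distances to the
  points of the dense set, so it is at most the integral of \<open>m\<close>; at the Lebesgue points of \<open>m\<close> this
  bounds the upper limit.
\<close>

lemma metric_derivative_exists:
  assumes ac: "abs_continuous_curve d c a b" and "a < b"
  obtains m where "m integrable_on {a..b}" "\<And>t. 0 \<le> m t"
    "\<And>u v. a \<le> u \<Longrightarrow> u \<le> v \<Longrightarrow> v \<le> b \<Longrightarrow> d (c u) (c v) \<le> integral {u..v} m"
    "AE t in lebesgue. t \<in> {a<..<b} \<longrightarrow> ((\<lambda>u. d (c u) (c t) / \<bar>u - t\<bar>) \<longlongrightarrow> m t) (at t)"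
proof -
  define Q where "Q = \<rat> \<inter> {a..b}"
  obtain q0 where "q0 \<in> \<rat>" "a < q0" "q0 < b" using Rats_dense_in_real[OF \<open>a < b\<close>] by blast
  then have "Q \<noteq> {}" by (auto simp: Q_def)
  have "countable Q" unfolding Q_def by (intro countable_Int1 countable_rat)
  define q where "q = from_nat_into Q"
  have q: "range q = Q" unfolding q_def using \<open>Q \<noteq> {}\<close> \<open>countable Q\<close> by (rule range_from_nat_into)
  define \<phi> where "\<phi> n t = d (c t) (c (q n))" for n t
  have \<phi>_ac: "abs_continuous_curve dist (\<phi> n) a b" for n
    by (rule abs_continuous_curve_dominated[OF ac ac, where A = 1 and B = 0])
      (auto simp: \<phi>_def dist_real_def dist_diff_le)
  define P where "P n g \<longleftrightarrow> g absolutely_integrable_on {a..b} \<and>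
      (\<forall>u v. a \<le> u \<and> u \<le> v \<and> v \<le> b \<longrightarrow> (g has_integral (\<phi> n v - \<phi> n u)) {u..v}) \<and>
      (AE t in lebesgue. t \<in> {a<..<b} \<longrightarrow> (\<phi> n has_real_derivative g t) (at t))" for n g
  define f where "f n = (SOME g. P n g)" for n
  have "\<exists>g. P n g" for n
    by (rule abs_continuous_derivative[OF \<phi>_ac[of n] \<open>a < b\<close>]) (unfold P_def, blast)
  then have "P n (f n)" for n
    unfolding f_def by (rule someI_ex)
  then have f: "\<And>n. f n absolutely_integrable_on {a..b}"
      "\<And>n u v. a \<le> u \<Longrightarrow> u \<le> v \<Longrightarrow> v \<le> b \<Longrightarrow> (f n has_integral (\<phi> n v - \<phi> n u)) {u..v}"
      "\<And>n. AE t in lebesgue. t \<in> {a<..<b} \<longrightarrow> (\<phi> n has_real_derivative f n t) (at t)"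
    unfolding P_def by auto
  obtain V where V: "abs_continuous_curve dist V a b"
    "\<And>u v. a \<le> u \<Longrightarrow> u \<le> v \<Longrightarrow> v \<le> b \<Longrightarrow> d (c u) (c v) \<le> V v - V u"
    using abs_continuous_curve_arclength[OF ac] by metis
  obtain w where w: "w absolutely_integrable_on {a..b}"
      "AE t in lebesgue. t \<in> {a<..<b} \<longrightarrow> (V has_real_derivative w t) (at t)"
    using abs_continuous_derivative[OF V(1) \<open>a < b\<close>] by metis
  define E where "E = {t \<in> {a<..<b}. (V has_real_derivative w t) (at t) \<and>
      (\<forall>n. (\<phi> n has_real_derivative f n t) (at t))}"
  have "AE t in lebesgue. \<forall>n. t \<in> {a<..<b} \<longrightarrow> (\<phi> n has_real_derivative f n t) (at t)"
    unfolding AE_all_countable by (intro allI f(3))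
  with w(2) have AE_E: "AE t in lebesgue. t \<in> {a<..<b} \<longrightarrow> t \<in> E"
    by eventually_elim (auto simp: E_def)
  obtain N where N: "negligible N" "\<And>t. t \<in> {a..b} - N \<Longrightarrow> t \<in> E"
    using AE_interval_negligible[OF AE_E] by blast
  have f_le_w: "\<bar>f n t\<bar> \<le> \<bar>w t\<bar>" if "t \<in> E" for n t
  proof (rule tendsto_le)
    show "((\<lambda>u. \<bar>V u - V t\<bar> / \<bar>u - t\<bar>) \<longlongrightarrow> \<bar>w t\<bar>) (at t)"
      "((\<lambda>u. \<bar>\<phi> n u - \<phi> n t\<bar> / \<bar>u - t\<bar>) \<longlongrightarrow> \<bar>f n t\<bar>) (at t)"
      using that by (auto simp: E_def intro!: DERIV_quotient_tendsto)
    have "eventually (\<lambda>u. u \<in> {a<..<b}) (at t)"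
      using that by (intro eventually_at_in_open') (auto simp: E_def)
    then show "eventually (\<lambda>u. \<bar>\<phi> n u - \<phi> n t\<bar> / \<bar>u - t\<bar> \<le> \<bar>V u - V t\<bar> / \<bar>u - t\<bar>) (at t)"
    proof eventually_elim
      case (elim u)
      have "\<bar>\<phi> n u - \<phi> n t\<bar> \<le> d (c u) (c t)" unfolding \<phi>_def by (rule dist_diff_le)
      also have "\<dots> \<le> \<bar>V u - V t\<bar>"
        using V(2)[of u t] V(2)[of t u] elim that
        by (cases "u \<le> t") (auto simp: E_def commute)
      finally show ?case by (rule divide_right_mono) simp
    qed
  qed simp
  define g where "g n t = (if t \<in> E then \<bar>f n t\<bar> else 0)" for n t
  have g_abs: "integral {u..v} (g n) = integral {u..v} (\<lambda>t. \<bar>f n t\<bar>)" "g n integrable_on {u..v}"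
    if "a \<le> u" "v \<le> b" for n u v
  proof -
    have fi: "(\<lambda>t. \<bar>f n t\<bar>) integrable_on {u..v}"
    proof (rule integrable_on_subinterval)
      show "(\<lambda>t. \<bar>f n t\<bar>) integrable_on {a..b}"
        using f(1)[of n] by (simp add: absolutely_integrable_on_def)
    qed (use that in auto)
    have eq: "g n t = \<bar>f n t\<bar>" if "t \<in> {u..v} - N" for t
      using N(2)[of t] that \<open>a \<le> u\<close> \<open>v \<le> b\<close> by (auto simp: g_def)
    show "g n integrable_on {u..v}" by (rule integrable_spike[OF fi N(1) eq])
    show "integral {u..v} (g n) = integral {u..v} (\<lambda>t. \<bar>f n t\<bar>)"
      by (rule integral_spike[OF N(1)]) (use eq in auto)
  qed
  have g_le: "g n t \<le> (if t \<in> E then \<bar>w t\<bar> else 0)" for n t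
    using f_le_w by (auto simp: g_def)
  have bdd: "bdd_above (range (\<lambda>n. g n t))" for t
    using g_le[of _ t] by (intro bdd_aboveI2)
  define m where "m t = (SUP n. g n t)" for t
  have g_le_m: "g n t \<le> m t" for n t
    unfolding m_def by (rule cSUP_upper[OF _ bdd]) simp
  have m_nonneg: "0 \<le> m t" for t
    using g_le_m[of 0 t] by (auto simp: g_def intro: order_trans split: if_splits)
  have m_le: "m t \<le> \<bar>w t\<bar>" for t
    unfolding m_def by (rule cSUP_least) (auto intro!: order_trans[OF g_le])
  have m_int: "m integrable_on {a..b}"
  proof (rule measurable_bounded_by_integrable_imp_integrable)
    have "g n \<in> borel_measurable (lebesgue_on {a..b})" for n
      using g_abs(2)[of a b n] by (intro integrable_imp_measurable) auto
    then show "m \<in> borel_measurable (lebesgue_on {a..b})"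
      unfolding m_def[abs_def] using bdd by (intro borel_measurable_cSUP) auto
    show "(\<lambda>t. \<bar>w t\<bar>) integrable_on {a..b}"
      using w(1) by (simp add: absolutely_integrable_on_def)
    show "norm (m t) \<le> \<bar>w t\<bar>" for t using m_nonneg[of t] m_le[of t] by simp
  qed auto
  have d_le: "d (c u) (c v) \<le> integral {u..v} m" if uv: "a \<le> u" "u \<le> v" "v \<le> b" for u v
  proof (rule field_le_epsilon)
    fix e :: real assume "e > 0"
    obtain \<delta> where \<delta>: "\<delta> > 0"
      "\<And>u v. a \<le> u \<Longrightarrow> u \<le> v \<Longrightarrow> v \<le> b \<Longrightarrow> v - u < \<delta> \<Longrightarrow> d (c u) (c v) < e / 2"
      using abs_continuous_curve_uniform[OF ac, of "e / 2"] \<open>e > 0\<close> by auto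
    have "max a (v - \<delta>) < min b (v + \<delta>)" using uv \<delta>(1) \<open>a < b\<close> by auto
    then obtain r where r: "r \<in> \<rat>" "max a (v - \<delta>) < r" "r < min b (v + \<delta>)"
      using Rats_dense_in_real by blast
    then have "r \<in> range q" by (auto simp: q Q_def)
    then obtain n where n: "r = q n" by blast
    have close: "d (c v) (c (q n)) < e / 2"
      using \<delta>(2)[of v r] \<delta>(2)[of r v] r uv n by (cases "v \<le> r") (auto simp: commute)
    have "d (c u) (c v) \<le> \<phi> n u + d (c v) (c (q n))"
      using triangle[of "c u" "c (q n)" "c v"] by (simp add: \<phi>_def commute)
    also have "\<phi> n u \<le> \<phi> n v + \<bar>\<phi> n v - \<phi> n u\<bar>" by simp
    also have "\<bar>\<phi> n v - \<phi> n u\<bar> = \<bar>integral {u..v} (f n)\<bar>"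
      using integral_unique[OF f(2)[OF uv, of n]] by simp
    also have "\<dots> \<le> integral {u..v} (\<lambda>t. \<bar>f n t\<bar>)"
    proof -
      have "f n absolutely_integrable_on {u..v}"
        using absolutely_integrable_on_subinterval[OF f(1)[of n]] uv by auto
      then show ?thesis
        using integral_norm_bound_integral[of "f n" "{u..v}" "\<lambda>t. \<bar>f n t\<bar>"]
        by (simp add: absolutely_integrable_on_def)
    qed
    also have "\<dots> = integral {u..v} (g n)" using g_abs(1)[of u v n] uv by simp
    also have "\<dots> \<le> integral {u..v} m"
      using g_abs(2)[of u v n] uv integrable_on_subinterval[OF m_int, of u v] g_le_m
      by (intro integral_le) auto
    finally show "d (c u) (c v) \<le> integral {u..v} m + e"
      using close by (simp add: \<phi>_def)
  qed
  note AE_E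
  moreover have "AE t in lebesgue. t \<in> {a<..<b} \<longrightarrow>
      ((\<lambda>x. integral {a..x} m) has_real_derivative m t) (at t)"
    by (rule Lebesgue_differentiation[OF m_int])
  ultimately have lim: "AE t in lebesgue. t \<in> {a<..<b} \<longrightarrow>
      ((\<lambda>u. d (c u) (c t) / \<bar>u - t\<bar>) \<longlongrightarrow> m t) (at t)"
  proof eventually_elim
    case (elim t)
    show ?case
    proof
      assume t: "t \<in> {a<..<b}"
      with elim have tE: "t \<in> E"
        and M: "((\<lambda>x. integral {a..x} m) has_real_derivative m t) (at t)" by auto
      have ev: "eventually (\<lambda>u. u \<in> {a<..<b}) (at t)"
        using t by (intro eventually_at_in_open') auto
      show "((\<lambda>u. d (c u) (c t) / \<bar>u - t\<bar>) \<longlongrightarrow> m t) (at t)"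
      proof (rule order_tendstoI)
        fix y assume "y < m t"
        then obtain n where n: "y < g n t"
          unfolding m_def using less_cSUP_iff[OF _ bdd[of t]] by auto
        then have "y < \<bar>f n t\<bar>" using tE by (simp add: g_def)
        moreover have "((\<lambda>u. \<bar>\<phi> n u - \<phi> n t\<bar> / \<bar>u - t\<bar>) \<longlongrightarrow> \<bar>f n t\<bar>) (at t)"
          using tE by (auto simp: E_def intro!: DERIV_quotient_tendsto)
        ultimately have "eventually (\<lambda>u. y < \<bar>\<phi> n u - \<phi> n t\<bar> / \<bar>u - t\<bar>) (at t)"
          by (rule order_tendstoD(1)[rotated])
        then show "eventually (\<lambda>u. y < d (c u) (c t) / \<bar>u - t\<bar>) (at t)"
        proof eventually_elim
          case (elim u)
          have "\<bar>\<phi> n u - \<phi> n t\<bar> / \<bar>u - t\<bar> \<le> d (c u) (c t) / \<bar>u - t\<bar>"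
            unfolding \<phi>_def by (intro divide_right_mono dist_diff_le) auto
          with elim show ?case by linarith
        qed
      next
        fix y assume "m t < y"
        then have "eventually (\<lambda>u. \<bar>integral {a..u} m - integral {a..t} m\<bar> / \<bar>u - t\<bar> < y) (at t)"
          using order_tendstoD(2)[OF DERIV_quotient_tendsto[OF M]] m_nonneg[of t] by simp
        with ev show "eventually (\<lambda>u. d (c u) (c t) / \<bar>u - t\<bar> < y) (at t)"
        proof eventually_elim
          case (elim u)
          have inc: "integral {r..s} m = integral {a..s} m - integral {a..r} m"
            if "a \<le> r" "r \<le> s" "s \<le> b" for r s
            using Henstock_Kurzweil_Integration.integral_combine[of a r s m] integrable_on_subinterval[OF m_int, of a s] that by simp
          have "d (c u) (c t) \<le> \<bar>integral {a..u} m - integral {a..t} m\<bar>"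
            using d_le[of u t] d_le[of t u] inc[of u t] inc[of t u] elim(1) t
            by (cases "u \<le> t") (auto simp: commute)
          then have "d (c u) (c t) / \<bar>u - t\<bar> \<le> \<bar>integral {a..u} m - integral {a..t} m\<bar> / \<bar>u - t\<bar>"
            by (rule divide_right_mono) simp
          with elim(2) show ?case by linarith
        qed
      qed
    qed
  qed
  show ?thesis using m_int m_nonneg d_le lim by (rule that)
qed

text \<open>
  As the metric speed is defined by \<^const>\<open>Lim\<close>, whose value is unspecified where no limit exists, the
  existence of the metric derivative is what gives it any meaning.
\<close>

lemma
  assumes ac: "abs_continuous_curve d c a b" and "a < b"
  shows metric_speed_integrable: "metric_speed d c absolutely_integrable_on {a..b}"
    and dist_le_integral_metric_speed:
      "\<And>u v. a \<le> u \<Longrightarrow> u \<le> v \<Longrightarrow> v \<le> b \<Longrightarrow> d (c u) (c v) \<le> integral {u..v} (metric_speed d c)"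
    and metric_speed_tendsto: "AE t in lebesgue. t \<in> {a<..<b} \<longrightarrow>
      ((\<lambda>u. d (c u) (c t) / \<bar>u - t\<bar>) \<longlongrightarrow> metric_speed d c t) (at t)"
proof -
  obtain m where m: "m integrable_on {a..b}" "\<And>t. 0 \<le> m t"
    "\<And>u v. a \<le> u \<Longrightarrow> u \<le> v \<Longrightarrow> v \<le> b \<Longrightarrow> d (c u) (c v) \<le> integral {u..v} m"
    "AE t in lebesgue. t \<in> {a<..<b} \<longrightarrow> ((\<lambda>u. d (c u) (c t) / \<bar>u - t\<bar>) \<longlongrightarrow> m t) (at t)"
    by (rule metric_derivative_exists[OF assms]) blast
  have eq: "metric_speed d c t = m t" if "((\<lambda>u. d (c u) (c t) / \<bar>u - t\<bar>) \<longlongrightarrow> m t) (at t)" for t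
    unfolding metric_speed_def using that by (intro tendsto_Lim) auto
  show "AE t in lebesgue. t \<in> {a<..<b} \<longrightarrow>
      ((\<lambda>u. d (c u) (c t) / \<bar>u - t\<bar>) \<longlongrightarrow> metric_speed d c t) (at t)"
    using m(4) by eventually_elim (auto simp: eq)
  have AE_m: "AE t in lebesgue. t \<in> {a<..<b} \<longrightarrow> metric_speed d c t = m t"
    using m(4) by eventually_elim (auto simp: eq)
  obtain N where N: "negligible N" "\<And>t. t \<in> {a..b} - N \<Longrightarrow> metric_speed d c t = m t"
    using AE_interval_negligible[OF AE_m] by blast
  have "m absolutely_integrable_on {a..b}"
    using m(1,2) by (intro nonnegative_absolutely_integrable_1) auto
  then show "metric_speed d c absolutely_integrable_on {a..b}"
    by (rule absolutely_integrable_spike[OF _ N(1)]) (use N(2) in auto)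
  show "d (c u) (c v) \<le> integral {u..v} (metric_speed d c)" if "a \<le> u" "u \<le> v" "v \<le> b" for u v
  proof -
    have "integral {u..v} (metric_speed d c) = integral {u..v} m"
      using N that by (intro integral_spike[OF N(1)]) auto
    with m(3)[OF that] show ?thesis by simp
  qed
qed

end

section \<open>The generalized metric speed\<close>

lemma interval_lebesgue_integral_eq_integral:
  fixes f :: "real \<Rightarrow> real"
  assumes "f absolutely_integrable_on {x..y}" "x \<le> y"
  shows "(LINT u = ereal x..ereal y|lebesgue. f u) = integral {x..y} f"
proof -
  have "f absolutely_integrable_on {x<..<y}"
    by (rule set_integrable_subset[OF assms(1)]) auto
  then have "(LINT u : {x<..<y}|lebesgue. f u) = integral {x<..<y} f"
    by (rule set_lebesgue_integral_eq_integral)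
  then show ?thesis
    using assms(2) by (simp add: interval_lebesgue_integral_def integral_open_interval_real)
qed

lemma interval_lebesgue_integral_reverse:
  fixes f :: "real \<Rightarrow> real"
  shows "(LINT u = ereal x..ereal y|M. f u) = - (LINT u = ereal y..ereal x|M. f u)"
  by (cases x y rule: linorder_cases)
    (simp_all add: interval_lebesgue_integral_def set_lebesgue_integral_def)

lemma oriented_integral_eq_diff:
  fixes f :: "real \<Rightarrow> real"
  assumes f: "f absolutely_integrable_on {a..b}" and xy: "x \<in> {a..b}" "y \<in> {a..b}"
  shows "(LINT u = ereal x..ereal y|lebesgue. f u) = integral {a..y} f - integral {a..x} f"
proof -
  have fi: "f integrable_on {a..b}" using f by (simp add: absolutely_integrable_on_def)
  have le: "(LINT u = ereal r..ereal s|lebesgue. f u) = integral {a..s} f - integral {a..r} f"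
    if rs: "a \<le> r" "r \<le> s" "s \<le> b" for r s
  proof -
    have "f absolutely_integrable_on {r..s}"
      by (rule absolutely_integrable_on_subinterval[OF f]) (use rs in auto)
    then have "(LINT u = ereal r..ereal s|lebesgue. f u) = integral {r..s} f"
      using rs(2) by (rule interval_lebesgue_integral_eq_integral)
    moreover have "f integrable_on {a..s}"
      by (rule integrable_on_subinterval[OF fi]) (use rs in auto)
    then have "integral {a..r} f + integral {r..s} f = integral {a..s} f"
      using rs by (intro Henstock_Kurzweil_Integration.integral_combine) auto
    ultimately show ?thesis by simp
  qed
  show ?thesis
  proof (cases "x \<le> y")
    case True
    then show ?thesis using le[of x y] xy by auto
  next
    case False
    then show ?thesis
      using le[of y x] xy interval_lebesgue_integral_reverse[of lebesgue x y f] by auto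
  qed
qed

lemma eventually_at_0_interval:
  fixes t :: real
  assumes "t \<in> {a<..<b}"
  shows "eventually (\<lambda>\<delta>. \<delta> \<noteq> 0 \<and> t + \<delta> \<in> {a<..<b}) (at 0)"
proof -
  have "open {\<delta>. t + \<delta> \<in> {a<..<b}}"
  proof -
    have "{\<delta>. t + \<delta> \<in> {a<..<b}} = {a - t<..<b - t}" by auto
    then show ?thesis by simp
  qed
  then have "eventually (\<lambda>\<delta>. \<delta> \<in> {\<delta>. t + \<delta> \<in> {a<..<b}}) (at 0)"
    by (rule eventually_at_in_open') (use assms in simp)
  moreover have "eventually (\<lambda>\<delta>::real. \<delta> \<noteq> 0) (at 0)"
    by (simp add: eventually_at_filter)
  ultimately show ?thesis by eventually_elim simp
qed

locale metric_family_curve =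
  fixes d :: "real \<Rightarrow> 'a \<Rightarrow> 'a \<Rightarrow> real" and S :: "real set" and c :: "real \<Rightarrow> 'a" and a b :: real
  assumes metric: "\<And>s. s \<in> S \<Longrightarrow> metric_on_type (d s)"
    and ac: "\<And>s. s \<in> S \<Longrightarrow> abs_continuous_curve (d s) c a b"
    and ab: "a < b"
begin

definition travelled :: "real \<Rightarrow> real \<Rightarrow> real" where
  "travelled s t = integral {a..t} (metric_speed (d s) c)"

lemma travelled_diff:
  assumes "s \<in> S" "a \<le> u" "u \<le> v" "v \<le> b"
  shows "travelled s v - travelled s u = integral {u..v} (metric_speed (d s) c)"
proof -
  interpret metric_on_type "d s" using metric assms by auto
  have "metric_speed (d s) c integrable_on {a..b}"
    using metric_speed_integrable[OF ac ab] assms by (simp add: absolutely_integrable_on_def)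
  then have "metric_speed (d s) c integrable_on {a..v}"
    by (rule integrable_on_subinterval) (use assms in auto)
  then show ?thesis
    using Henstock_Kurzweil_Integration.integral_combine[of a u v "metric_speed (d s) c"] assms
    by (simp add: travelled_def)
qed

lemma dist_le_travelled:
  assumes "s \<in> S" "a \<le> u" "u \<le> v" "v \<le> b"
  shows "d s (c u) (c v) \<le> travelled s v - travelled s u"
  unfolding travelled_diff[OF assms]
  by (rule metric_on_type.dist_le_integral_metric_speed[OF metric ac ab]) (use assms in auto)

lemma travelled_mono:
  assumes "s \<in> S" "a \<le> u" "u \<le> v" "v \<le> b"
  shows "travelled s u \<le> travelled s v"
proof -
  interpret metric_on_type "d s" using metric assms by auto
  show ?thesis using order_trans[OF nonneg dist_le_travelled[OF assms]] by simp
qed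

lemma continuous_on_travelled:
  assumes "s \<in> S"
  shows "continuous_on {a..b} (travelled s)"
proof -
  interpret metric_on_type "d s" using metric assms by auto
  have "metric_speed (d s) c integrable_on {a..b}"
    using metric_speed_integrable[OF ac ab] assms by (simp add: absolutely_integrable_on_def)
  then show ?thesis unfolding travelled_def[abs_def] by (rule indefinite_integral_continuous_1)
qed

lemma gen_metric_speed_eq:
  assumes "s \<in> S" "t \<in> {a<..<b}"
  shows "gen_metric_speed d c s t =
    Limsup (at 0) (\<lambda>\<delta>. ereal ((travelled s (t + \<delta>) - travelled s t) / \<delta>))"
  unfolding gen_metric_speed_def
proof (rule Limsup_eq)
  interpret metric_on_type "d s" using metric assms by auto
  show "\<forall>\<^sub>F \<delta> in at 0. ereal (1 / \<delta> * (LINT u = ereal t..ereal (t + \<delta>)|lebesgue. metric_speed (d s) c u)) =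
      ereal ((travelled s (t + \<delta>) - travelled s t) / \<delta>)"
    using eventually_at_0_interval[OF assms(2)]
  proof eventually_elim
    case (elim \<delta>)
    have "(LINT u = ereal t..ereal (t + \<delta>)|lebesgue. metric_speed (d s) c u)
        = travelled s (t + \<delta>) - travelled s t"
      unfolding travelled_def
      by (rule oriented_integral_eq_diff[OF metric_speed_integrable[OF ac ab]]) (use assms elim in auto)
    then show ?case by simp
  qed
qed

lemma gen_metric_speed_nonneg:
  assumes "s \<in> S" "t \<in> {a<..<b}"
  shows "0 \<le> gen_metric_speed d c s t"
  unfolding gen_metric_speed_eq[OF assms]
proof (rule le_Limsup)
  show "\<forall>\<^sub>F \<delta> in at 0. 0 \<le> ereal ((travelled s (t + \<delta>) - travelled s t) / \<delta>)"
    using eventually_at_0_interval[OF assms(2)]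
  proof eventually_elim
    case (elim \<delta>)
    then show ?case
      using travelled_mono[of s t "t + \<delta>"] travelled_mono[of s "t + \<delta>" t] assms
      by (cases "\<delta> > 0") (auto simp: divide_nonpos_neg)
  qed
qed simp

lemma gen_metric_speed_AE:
  assumes "s \<in> S"
  shows "AE t in lebesgue. t \<in> {a<..<b} \<longrightarrow> gen_metric_speed d c s t = ereal (metric_speed (d s) c t)"
proof -
  interpret metric_on_type "d s" using metric assms by auto
  have "metric_speed (d s) c integrable_on {a..b}"
    using metric_speed_integrable[OF ac ab] assms by (simp add: absolutely_integrable_on_def)
  from Lebesgue_differentiation[OF this] show ?thesis
  proof eventually_elim
    case (elim t)
    show ?case
    proof
      assume t: "t \<in> {a<..<b}"
      have "((\<lambda>\<delta>. (travelled s (t + \<delta>) - travelled s t) / \<delta>) \<longlongrightarrow> metric_speed (d s) c t) (at 0)"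
        using elim t unfolding travelled_def[abs_def] DERIV_def by simp
      then have "((\<lambda>\<delta>. ereal ((travelled s (t + \<delta>) - travelled s t) / \<delta>)) \<longlongrightarrow> ereal (metric_speed (d s) c t)) (at 0)"
        by (rule tendsto_ereal)
      then show "gen_metric_speed d c s t = ereal (metric_speed (d s) c t)"
        unfolding gen_metric_speed_eq[OF assms t] by (intro lim_imp_Limsup) auto
    qed
  qed
qed

text \<open>
  An inequality between metric speeds that holds almost everywhere near a time carries over to the
  averages around it. So it holds for the generalized speeds at that time, without an exceptional
  null set that might depend on the metrics.
\<close>

lemma gen_metric_speed_le_mult:
  assumes s: "s \<in> S" "s' \<in> S" and t: "t \<in> {u<..<v}" "a \<le> u" "v \<le> b" and "k \<ge> 0"
    and le: "AE x in lebesgue. x \<in> {u<..<v} \<longrightarrow> metric_speed (d s) c x \<le> k * metric_speed (d s') c x"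
  shows "gen_metric_speed d c s t \<le> ereal k * gen_metric_speed d c s' t"
proof -
  have tab: "t \<in> {a<..<b}" using t by auto
  have int: "metric_speed (d r) c integrable_on {x..y}" if "r \<in> S" "a \<le> x" "y \<le> b" for r x y
  proof (rule integrable_on_subinterval)
    show "metric_speed (d r) c integrable_on {a..b}"
      using metric_on_type.metric_speed_integrable[OF metric[OF that(1)] ac[OF that(1)] ab]
      by (simp add: absolutely_integrable_on_def)
  qed (use that in auto)
  obtain N where N: "negligible N"
    "\<And>x. x \<in> {u..v} - N \<Longrightarrow> metric_speed (d s) c x \<le> k * metric_speed (d s') c x"
    using AE_interval_negligible[OF le] by blast
  have inc: "travelled s y - travelled s x \<le> k * (travelled s' y - travelled s' x)"
    if xy: "u \<le> x" "x \<le> y" "y \<le> v" for x y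
  proof -
    define f where "f r = (if r \<in> N then k * metric_speed (d s') c r else metric_speed (d s) c r)" for r
    have "integral {x..y} (metric_speed (d s) c) = integral {x..y} f"
      by (rule integral_spike[OF N(1)]) (auto simp: f_def)
    also have "f integrable_on {x..y}"
      by (rule integrable_spike[OF int[OF s(1), of x y] N(1)]) (use xy t in \<open>auto simp: f_def\<close>)
    then have "integral {x..y} f \<le> integral {x..y} (\<lambda>r. k * metric_speed (d s') c r)"
    proof (rule integral_le)
      show "(\<lambda>r. k * metric_speed (d s') c r) integrable_on {x..y}"
        using int[OF s(2), of x y] xy t by (intro integrable_on_mult_right) auto
      show "f r \<le> k * metric_speed (d s') c r" if "r \<in> {x..y}" for r
        using N(2)[of r] that xy by (auto simp: f_def)
    qed
    finally show ?thesis
      using travelled_diff[OF s(1), of x y] travelled_diff[OF s(2), of x y] xy t by simp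
  qed
  have "gen_metric_speed d c s t
      \<le> Limsup (at 0) (\<lambda>\<delta>. ereal k * ereal ((travelled s' (t + \<delta>) - travelled s' t) / \<delta>))"
    unfolding gen_metric_speed_eq[OF s(1) tab]
  proof (rule Limsup_mono)
    show "\<forall>\<^sub>F \<delta> in at 0. ereal ((travelled s (t + \<delta>) - travelled s t) / \<delta>)
        \<le> ereal k * ereal ((travelled s' (t + \<delta>) - travelled s' t) / \<delta>)"
      using eventually_at_0_interval[OF t(1)]
    proof eventually_elim
      case (elim \<delta>)
      show ?case
      proof (cases "\<delta> > 0")
        case True
        then show ?thesis
          using inc[of t "t + \<delta>"] elim t(1) by (simp add: divide_right_mono)
      next
        case False
        then have "k * (travelled s' (t + \<delta>) - travelled s' t) \<le> travelled s (t + \<delta>) - travelled s t"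
          using inc[of "t + \<delta>" t] elim t(1) by (simp add: algebra_simps)
        then show ?thesis
          using divide_right_mono_neg[of _ _ \<delta>] False by simp
      qed
    qed
  qed
  also have "\<dots> = ereal k * gen_metric_speed d c s' t"
    unfolding gen_metric_speed_eq[OF s(2) tab] using \<open>k \<ge> 0\<close> by (intro Limsup_ereal_mult_left) auto
  finally show ?thesis .
qed

end

lemma Lim_cong:
  assumes "eventually (\<lambda>x. f x = g x) F"
  shows "Lim F f = Lim F g"
  unfolding Topological_Spaces.Lim_def using tendsto_cong[OF assms] by simp

lemma metric_speed_cong:
  assumes "\<And>x. x \<in> {a<..<b} \<Longrightarrow> c x = c' x" "t \<in> {a<..<b}"
  shows "metric_speed d c t = metric_speed d c' t"
  unfolding metric_speed_def
proof (rule Lim_cong)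
  have "eventually (\<lambda>u. u \<in> {a<..<b}) (at t)"
    using assms(2) by (intro eventually_at_in_open') auto
  then show "\<forall>\<^sub>F u in at t. d (c u) (c t) / \<bar>u - t\<bar> = d (c' u) (c' t) / \<bar>u - t\<bar>"
  proof eventually_elim
    case (elim u)
    then show ?case using assms(1)[of u] assms(1)[OF assms(2)] by simp
  qed
qed

lemma interval_lebesgue_integral_cong_open:
  fixes f :: "real \<Rightarrow> real"
  assumes "\<And>u. u \<in> {min x y<..<max x y} \<Longrightarrow> f u = g u"
  shows "(LINT u = ereal x..ereal y|lebesgue. f u) = (LINT u = ereal x..ereal y|lebesgue. g u)"
  using assms by (simp add: interval_lebesgue_integral_def set_lebesgue_integral_cong)

lemma gen_metric_speed_cong:
  assumes c: "\<And>x. x \<in> {a<..<b} \<Longrightarrow> c x = c' x" and t: "t \<in> {a<..<b}"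
  shows "gen_metric_speed d c s t = gen_metric_speed d c' s t"
  unfolding gen_metric_speed_def
proof (rule Limsup_eq)
  show "\<forall>\<^sub>F \<delta> in at 0. ereal (1 / \<delta> * (LINT u = ereal t..ereal (t + \<delta>)|lebesgue. metric_speed (d s) c u))
      = ereal (1 / \<delta> * (LINT u = ereal t..ereal (t + \<delta>)|lebesgue. metric_speed (d s) c' u))"
    using eventually_at_0_interval[OF t]
  proof eventually_elim
    case (elim \<delta>)
    have "(LINT u = ereal t..ereal (t + \<delta>)|lebesgue. metric_speed (d s) c u)
        = (LINT u = ereal t..ereal (t + \<delta>)|lebesgue. metric_speed (d s) c' u)"
    proof (rule interval_lebesgue_integral_cong_open)
      fix x assume "x \<in> {min t (t + \<delta>)<..<max t (t + \<delta>)}"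
      then have "x \<in> {a<..<b}" using elim t by auto
      then show "metric_speed (d s) c x = metric_speed (d s) c' x"
        using metric_speed_cong[of a b c c' x "d s"] c by blast
    qed
    then show ?case by simp
  qed
qed

lemma metric_speed_reflect: "metric_speed d (\<lambda>u. c (- u)) t = metric_speed d c (- t)"
proof -
  have "((\<lambda>u. d (c (- u)) (c (- t)) / \<bar>u - t\<bar>) \<longlongrightarrow> l) (at t) \<longleftrightarrow>
      ((\<lambda>u. d (c u) (c (- t)) / \<bar>u - - t\<bar>) \<longlongrightarrow> l) (at (- t))" for l
    unfolding filtermap_at_minus[symmetric] filterlim_filtermap
    by (simp add: abs_minus_commute)
  then show ?thesis by (simp add: metric_speed_def Topological_Spaces.Lim_def)
qed

lemma interval_lebesgue_integral_reflect:
  fixes f :: "real \<Rightarrow> real"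
  shows "(LINT u = ereal x..ereal y|lebesgue. f (- u)) = (LINT u = ereal (- y)..ereal (- x)|lebesgue. f u)"
proof -
  have le: "(LINT u : {x<..<y}|lebesgue. f (- u)) = (LINT u : {- y<..<- x}|lebesgue. f u)" for x y
  proof -
    have "(LINT u|lebesgue. indicat_real {- y<..<- x} u *\<^sub>R f u)
        = (LINT u|lebesgue. indicat_real {- y<..<- x} (- u) *\<^sub>R f (- u))"
      using lebesgue_integral_real_affine[of "-1" "\<lambda>u. indicat_real {- y<..<- x} u *\<^sub>R f u" 0] by simp
    moreover have "indicat_real {- y<..<- x} (- u) = indicat_real {x<..<y} u" for u
      by (auto simp: indicator_def)
    ultimately show ?thesis by (simp add: set_lebesgue_integral_def)
  qed
  show ?thesis by (auto simp: interval_lebesgue_integral_def le)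
qed

lemma Limsup_filtermap_eq:
  fixes q :: "'b \<Rightarrow> 'c::complete_lattice"
  shows "Limsup (filtermap g F) q = Limsup F (\<lambda>x. q (g x))"
  unfolding Limsup_def eventually_filtermap
proof (rule INF_eq)
  fix P assume "P \<in> {P. eventually (\<lambda>x. P (g x)) F}"
  then show "\<exists>R\<in>{P. eventually P F}. (SUP x\<in>Collect R. q (g x)) \<le> Sup (q ` Collect P)"
    by (intro bexI[of _ "\<lambda>x. P (g x)"]) (auto intro!: SUP_least SUP_upper)
next
  fix P assume P: "P \<in> {P. eventually P F}"
  show "\<exists>R\<in>{P. eventually (\<lambda>x. P (g x)) F}. Sup (q ` Collect R) \<le> (SUP x\<in>Collect P. q (g x))"
  proof (rule bexI[of _ "\<lambda>y. \<exists>x. P x \<and> y = g x"])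
    show "Sup (q ` {y. \<exists>x. P x \<and> y = g x}) \<le> (SUP x\<in>Collect P. q (g x))"
      by (auto intro!: SUP_least SUP_upper)
    show "(\<lambda>y. \<exists>x. P x \<and> y = g x) \<in> {P. eventually (\<lambda>x. P (g x)) F}"
      using P by (auto elim!: eventually_mono)
  qed
qed

text \<open>
  Reflecting the curve and the metric parameter reflects the averages, and the limit superior is over
  averages on both sides.
\<close>

lemma gen_metric_speed_reflect:
  "gen_metric_speed (\<lambda>s. d (- s)) (\<lambda>u. c (- u)) s t = gen_metric_speed d c (- s) (- t)"
proof -
  define q where "q \<delta> = ereal (1 / \<delta> *
      (LINT u = ereal (- t)..ereal (- t + \<delta>)|lebesgue. metric_speed (d (- s)) c u))" for \<delta>
  have "ereal (1 / \<delta> * (LINT u = ereal t..ereal (t + \<delta>)|lebesgue.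
      metric_speed (d (- s)) (\<lambda>u. c (- u)) u)) = q (- \<delta>)" for \<delta>
    unfolding metric_speed_reflect interval_lebesgue_integral_reflect q_def
    by (subst interval_lebesgue_integral_reverse) simp
  then have "gen_metric_speed (\<lambda>s. d (- s)) (\<lambda>u. c (- u)) s t = Limsup (at 0) (\<lambda>\<delta>. q (- \<delta>))"
    unfolding gen_metric_speed_def by simp
  also have "\<dots> = Limsup (filtermap uminus (at (0::real))) q"
    by (simp add: Limsup_filtermap_eq)
  also have "filtermap uminus (at (0::real)) = at 0"
    using filtermap_at_minus[of "0::real"] by simp
  finally show ?thesis unfolding gen_metric_speed_def q_def .
qed

section \<open>Short curves and length metrics\<close>

context metric_on_type
begin

lemma chord_sum_le_increment:
  assumes "sorted (t # ts)" "a \<le> t" "set (t # ts) \<subseteq> {..b}"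
    and "\<And>u v. a \<le> u \<Longrightarrow> u \<le> v \<Longrightarrow> v \<le> b \<Longrightarrow> d (c u) (c v) \<le> F v - F u"
  shows "chord_sum d c (t # ts) \<le> ennreal (F b - F t)"
  using assms(1-3)
proof (induction ts arbitrary: t)
  case (Cons s ts)
  have le: "d (c t) (c s) \<le> F s - F t" "d (c s) (c b) \<le> F b - F s"
    using Cons.prems by (auto intro!: assms(4))
  have nn: "0 \<le> F s - F t" "0 \<le> F b - F s"
    by (rule order_trans[OF nonneg le(1)], rule order_trans[OF nonneg le(2)])
  have "chord_sum d c (t # s # ts) \<le> ennreal (F s - F t) + ennreal (F b - F s)"
    using Cons.prems le(1) by (auto intro!: add_mono ennreal_leI Cons.IH)
  also have "\<dots> = ennreal (F b - F t)"
    using nn by (simp flip: ennreal_plus)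
  finally show ?case .
qed simp

lemma curve_length_le_increment:
  assumes "a \<le> b" "\<And>u v. a \<le> u \<Longrightarrow> u \<le> v \<Longrightarrow> v \<le> b \<Longrightarrow> d (c u) (c v) \<le> F v - F u"
  shows "curve_length d c a b \<le> ennreal (F b - F a)"
  unfolding curve_length_eq_SUP_chord_sum
proof (rule SUP_least, clarify)
  fix ts :: "real list" assume ts: "sorted ts" "set ts \<subseteq> {a..b}"
  have "chord_sum d c ts \<le> chord_sum d c (a # ts)"
    by (cases ts) auto
  also have "\<dots> \<le> ennreal (F b - F a)"
    using ts assms by (intro chord_sum_le_increment[where a = a]) auto
  finally show "chord_sum d c ts \<le> ennreal (F b - F a)" .
qed

lemma pathin_iff:
  "pathin mtopology c \<longleftrightarrow>
    (\<forall>t\<in>{0..1}. \<forall>e>0. \<exists>\<delta>>0. \<forall>u\<in>{0..1}. \<bar>u - t\<bar> < \<delta> \<longrightarrow> d (c u) (c t) < e)"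
proof
  assume L: "pathin mtopology c"
  show "\<forall>t\<in>{0..1}. \<forall>e>0. \<exists>\<delta>>0. \<forall>u\<in>{0..1}. \<bar>u - t\<bar> < \<delta> \<longrightarrow> d (c u) (c t) < e"
  proof (intro ballI allI impI)
    fix t e :: real assume "t \<in> {0..1}" "e > 0"
    with L have "\<exists>U. openin (top_of_set {0..1}) U \<and> t \<in> U \<and> (\<forall>u\<in>U. c u \<in> mball (c t) e)"
      unfolding pathin_def continuous_map_to_metric by simp
    then obtain U where U: "openin (top_of_set {0..1}) U" "t \<in> U" "\<forall>u\<in>U. c u \<in> mball (c t) e"
      by blast
    from U(1) have "\<forall>x\<in>U. \<exists>\<delta>>0. \<forall>y\<in>{0..1}. dist y x < \<delta> \<longrightarrow> y \<in> U"
      unfolding openin_euclidean_subtopology_iff by blast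
    then obtain \<delta> where "\<delta> > 0" "\<forall>u\<in>{0..1}. dist u t < \<delta> \<longrightarrow> u \<in> U"
      using U(2) by blast
    with U(3) show "\<exists>\<delta>>0. \<forall>u\<in>{0..1}. \<bar>u - t\<bar> < \<delta> \<longrightarrow> d (c u) (c t) < e"
      by (intro exI[of _ \<delta>]) (auto simp: dist_real_def commute)
  qed
next
  assume R: "\<forall>t\<in>{0..1}. \<forall>e>0. \<exists>\<delta>>0. \<forall>u\<in>{0..1}. \<bar>u - t\<bar> < \<delta> \<longrightarrow> d (c u) (c t) < e"
  show "pathin mtopology c"
    unfolding pathin_def continuous_map_to_metric
  proof (intro ballI allI impI)
    fix t e :: real assume t: "t \<in> topspace (top_of_set {0..1})" and "e > 0"
    from t have "t \<in> {0..1}" by simp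
    with R \<open>e > 0\<close> obtain \<delta> where \<delta>: "\<delta> > 0" "\<forall>u\<in>{0..1}. \<bar>u - t\<bar> < \<delta> \<longrightarrow> d (c u) (c t) < e"
      by blast
    show "\<exists>U. openin (top_of_set {0..1}) U \<and> t \<in> U \<and> (\<forall>u\<in>U. c u \<in> mball (c t) e)"
    proof (intro exI conjI ballI)
      show "openin (top_of_set {0..1}) ({0..1} \<inter> ball t \<delta>)" by (rule openin_open_Int) simp
      show "t \<in> {0..1} \<inter> ball t \<delta>" using t \<delta>(1) by simp
      show "c u \<in> mball (c t) e" if "u \<in> {0..1} \<inter> ball t \<delta>" for u
        using \<delta>(2) that by (auto simp: dist_real_def commute abs_minus_commute)
    qed
  qed
qed

lemma length_metric_le_increment:
  fixes F :: "real \<Rightarrow> real"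
  assumes "a \<le> b" and cont: "continuous_on {a..b} F"
    and le: "\<And>u v. a \<le> u \<Longrightarrow> u \<le> v \<Longrightarrow> v \<le> b \<Longrightarrow> d (c u) (c v) \<le> F v - F u"
  shows "length_metric d (c a) (c b) \<le> ennreal (F b - F a)"
proof -
  define p where "p r = a + r * (b - a)" for r
  have p: "p r \<in> {a..b}" if "r \<in> {0..1}" for r
    using that \<open>a \<le> b\<close> mult_right_mono[of r 1 "b - a"] by (auto simp: p_def)
  have p_mono: "p r \<le> p s" if "r \<le> s" for r s
    using that \<open>a \<le> b\<close> by (auto simp: p_def intro: mult_right_mono)
  have le_abs: "d (c u) (c v) \<le> \<bar>F u - F v\<bar>" if "u \<in> {a..b}" "v \<in> {a..b}" for u v
    using le[of u v] le[of v u] that by (cases "u \<le> v") (auto simp: commute)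
  have "continuous_on {0..1} (\<lambda>r. F (p r))"
    by (rule continuous_on_compose2[OF cont]) (use p in \<open>auto simp: p_def intro!: continuous_intros\<close>)
  then have Fp: "\<exists>\<delta>>0. \<forall>u\<in>{0..1}. \<bar>u - t\<bar> < \<delta> \<longrightarrow> \<bar>F (p u) - F (p t)\<bar> < e"
    if "t \<in> {0..1}" "e > 0" for t e
    using that unfolding continuous_on_iff dist_real_def by blast
  have "pathin mtopology (\<lambda>r. c (p r))"
    unfolding pathin_iff
  proof (intro ballI allI impI)
    fix t e :: real assume t: "t \<in> {0..1}" and "e > 0"
    then obtain \<delta> where \<delta>: "\<delta> > 0" "\<forall>u\<in>{0..1}. \<bar>u - t\<bar> < \<delta> \<longrightarrow> \<bar>F (p u) - F (p t)\<bar> < e"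
      using Fp by blast
    have "d (c (p u)) (c (p t)) < e" if "u \<in> {0..1}" "\<bar>u - t\<bar> < \<delta>" for u
      using \<delta>(2) that le_abs[OF p p, OF that(1) t] by fastforce
    with \<delta>(1) show "\<exists>\<delta>>0. \<forall>u\<in>{0..1}. \<bar>u - t\<bar> < \<delta> \<longrightarrow> d (c (p u)) (c (p t)) < e"
      by blast
  qed
  moreover have "c (p 0) = c a" "c (p 1) = c b" by (simp_all add: p_def)
  ultimately have "length_metric d (c a) (c b) \<le> curve_length d (\<lambda>r. c (p r)) 0 1"
    unfolding length_metric_def by (intro INF_lower) simp
  also have "\<dots> \<le> ennreal (F (p 1) - F (p 0))"
  proof (rule curve_length_le_increment)
    show "d (c (p u)) (c (p v)) \<le> F (p v) - F (p u)" if "0 \<le> u" "u \<le> v" "v \<le> 1" for u v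
      using p[of u] p[of v] p_mono[of u v] that by (intro le) auto
  qed simp
  finally show ?thesis by (simp add: p_def)
qed

lemma length_metric_le_abs:
  fixes F :: "real \<Rightarrow> real"
  assumes cont: "continuous_on {a..b} F"
    and le: "\<And>u v. a \<le> u \<Longrightarrow> u \<le> v \<Longrightarrow> v \<le> b \<Longrightarrow> d (c u) (c v) \<le> F v - F u"
    and uv: "u \<in> {a..b}" "v \<in> {a..b}"
  shows "length_metric d (c u) (c v) \<le> ennreal \<bar>F v - F u\<bar>"
proof (cases "u \<le> v")
  case True
  have "length_metric d (c u) (c v) \<le> ennreal (F v - F u)"
    using uv le by (intro length_metric_le_increment[OF True continuous_on_subset[OF cont]]) auto
  also have "\<dots> \<le> ennreal \<bar>F v - F u\<bar>" by (intro ennreal_leI) simp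
  finally show ?thesis .
next
  case False
  have "length_metric d (c (- (- u))) (c (- (- v))) \<le> ennreal ((- F (- (- v))) - (- F (- (- u))))"
  proof (rule length_metric_le_increment[where c = "\<lambda>x. c (- x)" and F = "\<lambda>x. - F (- x)"])
    show "- u \<le> - v" using False by simp
    show "continuous_on {- u..- v} (\<lambda>x. - F (- x))"
      using uv by (intro continuous_intros continuous_on_compose2[OF cont]) auto
    show "d (c (- x)) (c (- y)) \<le> (- F (- y)) - (- F (- x))" if "- u \<le> x" "x \<le> y" "y \<le> - v" for x y
      using le[of "- y" "- x"] that uv by (simp add: commute)
  qed
  also have "\<dots> \<le> ennreal \<bar>F v - F u\<bar>" by (intro ennreal_leI) simp
  finally show ?thesis by simp
qed

definition short_curve :: "real \<Rightarrow> (real \<Rightarrow> 'a) \<Rightarrow> 'a \<Rightarrow> 'a \<Rightarrow> bool" where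
  "short_curve L c x y \<longleftrightarrow> 0 \<le> L \<and> c 0 = x \<and> c L = y \<and>
     (\<forall>u v. 0 \<le> u \<and> u \<le> v \<and> v \<le> L \<longrightarrow> d (c u) (c v) \<le> v - u)"

text \<open>
  Parametrization by arc length. The arc length of a rectifiable path is continuous, hence takes
  every value between \<open>0\<close> and the total length; the path is constant where it takes a value twice.
\<close>

lemma short_curve_exists:
  assumes "length_metric d x y < ennreal e"
  obtains L c where "short_curve L c x y" "L < e"
proof -
  obtain c where c: "pathin mtopology c" "c 0 = x" "c 1 = y" "curve_length d c 0 1 < ennreal e"
    using assms unfolding length_metric_def INF_less_iff by auto
  then have fin: "curve_length d c 0 1 < top"
    using less_trans[OF c(4) ennreal_less_top] by blast
  define V where "V t = enn2real (curve_length d c 0 t)" for t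
  have V_cont: "continuous_on {0..1} V"
    unfolding V_def[abs_def]
    using c(1) by (intro continuous_on_arclength[OF fin]) (auto simp: pathin_iff)
  note V_inc = arclength_increment(2)[OF fin, folded V_def]
  have V_mono: "V u \<le> V v" if "0 \<le> u" "u \<le> v" "v \<le> 1" for u v
    using order_trans[OF nonneg V_inc[OF that]] by simp
  have V0: "V 0 = 0"
  proof -
    have "curve_length d c 0 0 \<le> ennreal (0 - 0)"
    proof (rule curve_length_le_increment[where F = "\<lambda>_. 0"])
      fix u v :: real assume "0 \<le> u" "u \<le> v" "v \<le> 0"
      then have "u = 0" "v = 0" by auto
      then show "d (c u) (c v) \<le> 0 - 0" by simp
    qed simp
    then show ?thesis by (simp add: V_def)
  qed
  define L where "L = V 1"
  have L: "0 \<le> L" "L < e"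
  proof -
    show "0 \<le> L" by (simp add: L_def V_def)
    have "ennreal L = curve_length d c 0 1" using fin by (simp add: L_def V_def)
    with c(4) have "ennreal L < ennreal e" by simp
    then show "L < e" using \<open>0 \<le> L\<close> by (simp add: ennreal_less_iff)
  qed
  define T where "T r = (SOME t. t \<in> {0..1} \<and> V t = r)" for r
  have T: "T r \<in> {0..1} \<and> V (T r) = r" if "0 \<le> r" "r \<le> L" for r
    unfolding T_def
  proof (rule someI_ex)
    have "\<exists>t\<ge>0. t \<le> 1 \<and> V t = r"
      using that V_cont by (intro IVT') (auto simp: V0 L_def)
    then show "\<exists>t. t \<in> {0..1} \<and> V t = r" by auto
  qed
  have same: "c t = c t'" if "t \<in> {0..1}" "t' \<in> {0..1}" "V t = V t'" for t t'
  proof -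
    have "d (c t) (c t') \<le> 0"
    proof (cases "t \<le> t'")
      case True
      have "d (c t) (c t') \<le> V t' - V t"
        by (rule V_inc) (use True that(1,2) in simp_all)
      with that(3) show ?thesis by linarith
    next
      case False
      have "d (c t') (c t) \<le> V t - V t'"
        by (rule V_inc) (use False that(1,2) in simp_all)
      with that(3) show ?thesis unfolding commute[of "c t" "c t'"] by linarith
    qed
    then have "d (c t) (c t') = 0" using nonneg by (rule order_antisym)
    then show ?thesis by simp
  qed
  have "short_curve L (\<lambda>r. c (T r)) x y"
    unfolding short_curve_def
  proof (intro conjI allI impI)
    show "c (T 0) = x" using same[of "T 0" 0] T[of 0] L V0 c(2) by auto
    show "c (T L) = y" using same[of "T L" 1] T[of L] L c(3) by (auto simp: L_def)
    fix u v assume uv: "0 \<le> u \<and> u \<le> v \<and> v \<le> L"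
    then have Tu: "T u \<in> {0..1}" "V (T u) = u" and Tv: "T v \<in> {0..1}" "V (T v) = v"
      using T[of u] T[of v] by auto
    show "d (c (T u)) (c (T v)) \<le> v - u"
    proof (cases "T u \<le> T v")
      case True
      then show ?thesis using V_inc[of "T u" "T v"] Tu Tv by auto
    next
      case False
      then show ?thesis using V_inc[of "T v" "T u"] Tu Tv uv by (auto simp: commute)
    qed
  qed (use L in auto)
  then show ?thesis using L(2) by (rule that)
qed

lemma short_curveD:
  "short_curve L c x y \<Longrightarrow> 0 \<le> u \<Longrightarrow> u \<le> v \<Longrightarrow> v \<le> L \<Longrightarrow> d (c u) (c v) \<le> v - u"
  by (simp add: short_curve_def)

lemma short_curve_append:
  assumes "short_curve L c x y" "short_curve L' c' y z"
  shows "short_curve (L + L') (\<lambda>t. if t \<le> L then c t else c' (t - L)) x z"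
proof -
  note c = short_curveD[OF assms(1)] and c' = short_curveD[OF assms(2)]
  have ends: "0 \<le> L" "0 \<le> L'" "c 0 = x" "c L = y" "c' 0 = y" "c' L' = z"
    using assms by (auto simp: short_curve_def)
  have mixed: "d (c u) (c' (v - L)) \<le> v - u" if "0 \<le> u" "u \<le> L" "L < v" "v \<le> L + L'" for u v
    using triangle[of "c u" y "c' (v - L)"] c[of u L] c'[of 0 "v - L"] ends that by simp
  have "d (c' (u - L)) (c' (v - L)) \<le> v - u" if "L < u" "u \<le> v" "v \<le> L + L'" for u v
    using c'[of "u - L" "v - L"] that by simp
  with mixed show ?thesis
    unfolding short_curve_def using c ends by (auto simp: not_le)
qed

lemma short_curve_initial:
  "short_curve L c x y \<Longrightarrow> 0 \<le> t \<Longrightarrow> t \<le> L \<Longrightarrow> short_curve t c x (c t)"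
  unfolding short_curve_def by auto

lemma length_metric_le_short_curve:
  assumes "short_curve L c x y"
  shows "length_metric d x y \<le> ennreal L"
  using length_metric_le_increment[of 0 L "\<lambda>t. t" c] assms
  unfolding short_curve_def by (auto simp: continuous_on_id)

end

text \<open>
  Continuity with respect to the given topology, which the length metric generates, needs a bound on
  lengths; continuity with respect to the metric itself would not suffice.
\<close>

lemma continuous_on_length_metric:
  fixes F :: "real \<Rightarrow> real" and c :: "real \<Rightarrow> 'a::topological_space"
  assumes metric: "metric_on_type d" and gen: "generates_topology (length_metric d)"
    and cont: "continuous_on {a..b} F"
    and le: "\<And>u v. a \<le> u \<Longrightarrow> u \<le> v \<Longrightarrow> v \<le> b \<Longrightarrow> d (c u) (c v) \<le> F v - F u"
  shows "continuous_on {a..b} c"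
  unfolding continuous_on_open_invariant
proof (intro allI impI)
  interpret metric_on_type d by fact
  fix U :: "'a set" assume "open U"
  have "openin (top_of_set {a..b}) ({a..b} \<inter> c -` U)"
    unfolding openin_euclidean_subtopology_iff
  proof (intro conjI ballI)
    fix x assume x: "x \<in> {a..b} \<inter> c -` U"
    then obtain e where e: "e > 0" "{y. length_metric d (c x) y < ennreal e} \<subseteq> U"
      using gen \<open>open U\<close> unfolding generates_topology_def by blast
    obtain \<delta> where \<delta>: "\<delta> > 0" "\<And>y. y \<in> {a..b} \<Longrightarrow> dist y x < \<delta> \<Longrightarrow> \<bar>F y - F x\<bar> < e"
      using cont x e(1) unfolding continuous_on_iff dist_real_def by blast
    have "y \<in> {a..b} \<inter> c -` U" if y: "y \<in> {a..b}" "dist y x < \<delta>" for y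
    proof -
      have "length_metric d (c x) (c y) \<le> ennreal \<bar>F y - F x\<bar>"
        using x y by (intro length_metric_le_abs[OF cont le]) auto
      also have "\<dots> < ennreal e" using \<delta>(2)[OF y] by (intro ennreal_lessI) (use e in auto)
      finally show ?thesis using e(2) y(1) by auto
    qed
    with \<delta>(1) show "\<exists>\<delta>>0. \<forall>y\<in>{a..b}. dist y x < \<delta> \<longrightarrow> y \<in> {a..b} \<inter> c -` U" by blast
  qed simp
  then show "\<exists>A. open A \<and> A \<inter> {a..b} = c -` U \<inter> {a..b}"
    unfolding openin_open by (metis Int_commute)
qed

text \<open>
  These sets are the open balls of the length metric. Appending curves replaces the triangle
  inequality of the length metric in the proof that they are open.
\<close>

lemma open_short_curve_ball:
  fixes x :: "'b::topological_space"
  assumes "metric_on_type \<rho>" "generates_topology (length_metric \<rho>)"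
  shows "open {y. \<exists>L c. metric_on_type.short_curve \<rho> L c x y \<and> L < e}"
proof -
  interpret \<rho>: metric_on_type \<rho> by fact
  have "\<exists>\<epsilon>>0. {z. length_metric \<rho> y z < ennreal \<epsilon>} \<subseteq> {y. \<exists>L c. \<rho>.short_curve L c x y \<and> L < e}"
    if "\<rho>.short_curve L c x y" "L < e" for y L c
  proof (intro exI conjI)
    show "e - L > 0" using that by simp
    show "{z. length_metric \<rho> y z < ennreal (e - L)} \<subseteq> {y. \<exists>L c. \<rho>.short_curve L c x y \<and> L < e}"
    proof
      fix z assume "z \<in> {z. length_metric \<rho> y z < ennreal (e - L)}"
      then obtain L' c' where "\<rho>.short_curve L' c' y z" "L' < e - L"
        using \<rho>.short_curve_exists by blast
      then show "z \<in> {y. \<exists>L c. \<rho>.short_curve L c x y \<and> L < e}"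
        using \<rho>.short_curve_append[OF that(1)] by fastforce
    qed
  qed
  then show ?thesis
    using assms(2) unfolding generates_topology_def by blast
qed

section \<open>Comparison of the metrics of the family\<close>

locale lipschitz_spacetime =
  fixes I :: "real set"
    and h :: "real \<times> 'a::topological_space \<Rightarrow> real"
    and d :: "real \<Rightarrow> 'a \<Rightarrow> 'a \<Rightarrow> real"
  assumes locally_compact: "locally_compact_space (euclidean :: 'a topology)"
    and open_I: "open I" and interval_I: "is_interval I"
    and continuous_h: "continuous_on (I \<times> UNIV) h"
    and h_pos: "\<And>s x. s \<in> I \<Longrightarrow> h (s, x) > 0"
    and metric_family: "\<And>s. s \<in> I \<Longrightarrow> Metric_space UNIV (d s)"
    and length_topology: "\<And>s. s \<in> I \<Longrightarrow> generates_topology (length_metric (d s))"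
    and log_Lipschitz: "\<And>J (K :: 'a set). \<lbrakk>compact J; J \<subseteq> I; compact K\<rbrakk> \<Longrightarrow>
      \<exists>C>0. \<exists>r>0. \<forall>s\<in>J. \<forall>s'\<in>J. \<forall>x\<in>K. \<forall>y\<in>K.
        x \<noteq> y \<and> (INF u\<in>J. d u x y) < r \<longrightarrow> \<bar>ln (d s x y / d s' x y)\<bar> \<le> C * \<bar>s - s'\<bar>"
    and h_Lipschitz: "\<And>J (K :: 'a set). \<lbrakk>compact J; J \<subseteq> I; compact K\<rbrakk> \<Longrightarrow>
      \<exists>C'>0. \<forall>s\<in>J. \<forall>s'\<in>J. \<forall>x\<in>K. \<bar>h (s, x) - h (s', x)\<bar> \<le> C' * \<bar>s - s'\<bar>"
begin

lemma metric_d: "s \<in> I \<Longrightarrow> metric_on_type (d s)"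
  using metric_family by (simp add: metric_on_type_def)

lemma interval_subset: "l \<in> I \<Longrightarrow> r \<in> I \<Longrightarrow> {l..r} \<subseteq> I"
  using mem_is_interval_1_I[OF interval_I, of l r] by auto

text \<open>
  The infimum over the parameters is at most the distance for any one of them, so closeness may be
  measured by the metric on the right-hand side.
\<close>

lemma dist_ratio_bound:
  assumes "compact J" "J \<subseteq> I" "compact K"
  obtains C r where "C > 0" "r > 0"
    "\<forall>s\<in>J. \<forall>s'\<in>J. \<forall>x\<in>K. \<forall>y\<in>K. d s' x y < r \<longrightarrow>
       d s x y \<le> exp (C * \<bar>s - s'\<bar>) * d s' x y"
proof -
  obtain C r where Cr: "C > 0" "r > 0" "\<forall>s\<in>J. \<forall>s'\<in>J. \<forall>x\<in>K. \<forall>y\<in>K.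
        x \<noteq> y \<and> (INF u\<in>J. d u x y) < r \<longrightarrow> \<bar>ln (d s x y / d s' x y)\<bar> \<le> C * \<bar>s - s'\<bar>"
    using log_Lipschitz[OF assms] by (elim exE conjE) (rule that)
  have "d s x y \<le> exp (C * \<bar>s - s'\<bar>) * d s' x y"
    if J: "s \<in> J" "s' \<in> J" and K: "x \<in> K" "y \<in> K" and small: "d s' x y < r" for s s' x y
  proof (cases "x = y")
    case True
    interpret s: metric_on_type "d s" using metric_d J assms by auto
    interpret s': metric_on_type "d s'" using metric_d J assms by auto
    show ?thesis using True by simp
  next
    case False
    interpret s: metric_on_type "d s" using metric_d J assms by auto
    interpret s': metric_on_type "d s'" using metric_d J assms by auto
    have pos: "d s x y > 0" "d s' x y > 0"
      using s.mdist_pos_less[of x y] s'.mdist_pos_less[of x y] False by auto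
    have "0 \<le> d u x y" if "u \<in> J" for u
      by (rule Metric_space.nonneg[OF metric_family]) (use that assms(2) in auto)
    then have "(INF u\<in>J. d u x y) \<le> d s' x y"
      using J(2) by (intro cINF_lower bdd_belowI2[of _ 0]) auto
    then have "x \<noteq> y \<and> (INF u\<in>J. d u x y) < r" using small False by linarith
    then have "\<bar>ln (d s x y / d s' x y)\<bar> \<le> C * \<bar>s - s'\<bar>"
      by (rule Cr(3)[rule_format, OF J K])
    then have "ln (d s x y / d s' x y) \<le> C * \<bar>s - s'\<bar>"
      by linarith
    then have "d s x y / d s' x y \<le> exp (C * \<bar>s - s'\<bar>)"
      using pos by (metis divide_pos_pos exp_le_cancel_iff exp_ln)
    then show ?thesis using pos by (simp add: pos_divide_le_eq)
  qed
  then show ?thesis by (intro that[OF Cr(1,2)]) auto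
qed

text \<open>
  On a compact set \<open>h\<close> is bounded away from zero, so Lipschitz continuity of \<open>h\<close> in the parameter gives
  Lipschitz continuity of \<open>ln h\<close>.
\<close>

lemma h_ratio_bound:
  assumes "compact J" "J \<subseteq> I" "compact K"
  obtains C where "C > 0"
    "\<forall>s\<in>J. \<forall>s'\<in>J. \<forall>x\<in>K. h (s, x) \<le> exp (C * \<bar>s - s'\<bar>) * h (s', x)"
proof (cases "J \<times> K = {}")
  case True
  then show ?thesis by (intro that[of 1]) auto
next
  case False
  obtain C' where C': "C' > 0"
    "\<forall>s\<in>J. \<forall>s'\<in>J. \<forall>x\<in>K. \<bar>h (s, x) - h (s', x)\<bar> \<le> C' * \<bar>s - s'\<bar>"
    using h_Lipschitz[OF assms] by (elim exE conjE) (rule that)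
  have "continuous_on (J \<times> K) h"
    by (rule continuous_on_subset[OF continuous_h]) (use assms(2) in auto)
  then obtain p where p: "p \<in> J \<times> K" "\<And>q. q \<in> J \<times> K \<Longrightarrow> h p \<le> h q"
    using continuous_attains_inf[OF compact_Times[OF assms(1,3)] False] by blast
  have p_pos: "h p > 0" using p(1) assms(2) h_pos by (cases p) auto
  have "h (s, x) \<le> exp (C' / h p * \<bar>s - s'\<bar>) * h (s', x)"
    if J: "s \<in> J" "s' \<in> J" and x: "x \<in> K" for s s' x
  proof -
    have hp: "h p \<le> h (s', x)" using p(2) J x by auto
    have "h (s, x) \<le> h (s', x) + C' * \<bar>s - s'\<bar>" using C'(2)[rule_format, OF J x] by linarith
    also have "C' * \<bar>s - s'\<bar> = (C' / h p * \<bar>s - s'\<bar>) * h p" using p_pos by simp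
    also have "\<dots> \<le> (C' / h p * \<bar>s - s'\<bar>) * h (s', x)"
      using hp C'(1) p_pos by (intro mult_left_mono) auto
    also have "h (s', x) + (C' / h p * \<bar>s - s'\<bar>) * h (s', x)
        = (1 + C' / h p * \<bar>s - s'\<bar>) * h (s', x)" by (simp add: algebra_simps)
    also have "\<dots> \<le> exp (C' / h p * \<bar>s - s'\<bar>) * h (s', x)"
      using hp p_pos by (intro mult_right_mono exp_ge_add_one_self) auto
    finally show ?thesis by simp
  qed
  then show ?thesis using C'(1) p_pos by (intro that[of "C' / h p"]) auto
qed

lemma abs_continuous_imp_continuous:
  assumes "s \<in> I" "abs_continuous_curve (d s) \<beta> a b"
  shows "continuous_on {a..b} \<beta>"
proof -
  interpret metric_on_type "d s" using metric_d assms by auto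
  obtain V where V: "abs_continuous_curve dist V a b"
    "\<And>u v. a \<le> u \<Longrightarrow> u \<le> v \<Longrightarrow> v \<le> b \<Longrightarrow> d s (\<beta> u) (\<beta> v) \<le> V v - V u"
    using abs_continuous_curve_arclength[OF assms(2)] by blast
  show ?thesis
    by (rule continuous_on_length_metric[OF metric_d[OF assms(1)] length_topology[OF assms(1)]
          abs_continuous_imp_continuous_on[OF V(1)]]) (rule V(2))
qed

text \<open>
  The image of the curve is compact, and sufficiently short chords have comparable lengths in both
  metrics.
\<close>

lemma abs_continuous_change_metric:
  assumes "s \<in> I" "s' \<in> I" and ac: "abs_continuous_curve (d s) \<beta> a b"
  shows "abs_continuous_curve (d s') \<beta> a b"
proof -
  have K: "compact (\<beta> ` {a..b})"
    by (rule compact_continuous_image[OF abs_continuous_imp_continuous[OF assms(1) ac]]) simp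
  have J: "compact {s, s'}" "{s, s'} \<subseteq> I" using assms by auto
  obtain C r where "C > 0" "r > 0"
    "\<forall>p\<in>{s, s'}. \<forall>q\<in>{s, s'}. \<forall>x\<in>\<beta> ` {a..b}. \<forall>y\<in>\<beta> ` {a..b}. d q x y < r \<longrightarrow>
       d p x y \<le> exp (C * \<bar>p - q\<bar>) * d q x y"
    by (rule dist_ratio_bound[OF J K])
  then have C: "r > 0"
    "\<And>x y. x \<in> \<beta> ` {a..b} \<Longrightarrow> y \<in> \<beta> ` {a..b} \<Longrightarrow> d s x y < r \<Longrightarrow>
       d s' x y \<le> exp (C * \<bar>s' - s\<bar>) * d s x y"
    by auto
  obtain \<delta> where \<delta>: "\<delta> > 0"
    "\<And>u v. a \<le> u \<Longrightarrow> u \<le> v \<Longrightarrow> v \<le> b \<Longrightarrow> v - u < \<delta> \<Longrightarrow> d s (\<beta> u) (\<beta> v) < r"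
    using abs_continuous_curve_uniform[OF ac C(1)] by blast
  show ?thesis
  proof (rule abs_continuous_curve_locally_dominated[OF ac ac])
    show "d s' (\<beta> u) (\<beta> v) \<le> exp (C * \<bar>s' - s\<bar>) * d s (\<beta> u) (\<beta> v) + 0 * d s (\<beta> u) (\<beta> v)"
      if "a \<le> u" "u \<le> v" "v \<le> b" "v - u < \<delta>" for u v
      using C(2)[of "\<beta> u" "\<beta> v"] \<delta>(2)[OF that] that by simp
  qed (use \<delta> in auto)
qed

lemma metric_family_curveI:
  assumes "\<And>s. s \<in> I \<Longrightarrow> abs_continuous_curve (d s) \<beta> a b" "a < b"
  shows "metric_family_curve d I \<beta> a b"
  by (rule metric_family_curve.intro) (use metric_d assms in auto)

definition speed_ratio_bound :: "real \<Rightarrow> real set \<Rightarrow> 'a set \<Rightarrow> bool" where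
  "speed_ratio_bound C J K \<longleftrightarrow> (\<forall>\<beta> a b u v t s s'. (\<forall>s\<in>I. abs_continuous_curve (d s) \<beta> a b) \<and>
     a \<le> u \<and> v \<le> b \<and> t \<in> {u<..<v} \<and> \<beta> ` {u<..<v} \<subseteq> K \<and> s \<in> J \<and> s' \<in> J \<longrightarrow>
     gen_metric_speed d \<beta> s t \<le> ereal (exp (C * \<bar>s - s'\<bar>)) * gen_metric_speed d \<beta> s' t)"

lemma speed_ratio_boundD:
  assumes "speed_ratio_bound C J K" "\<And>s. s \<in> I \<Longrightarrow> abs_continuous_curve (d s) \<beta> a b"
    "a \<le> u" "v \<le> b" "t \<in> {u<..<v}" "\<beta> ` {u<..<v} \<subseteq> K" "s \<in> J" "s' \<in> J"
  shows "gen_metric_speed d \<beta> s t \<le> ereal (exp (C * \<bar>s - s'\<bar>)) * gen_metric_speed d \<beta> s' t"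
  using assms(1)[unfolded speed_ratio_bound_def, rule_format, of \<beta> a b u v t s s'] assms(2-) by simp

text \<open>
  The bound on ratios of distances passes to difference quotients, hence to metric speeds almost
  everywhere, and from there to the generalized speeds at every time. The constant depends on the
  compact sets alone, which matters because it is used for curves that are constructed afterwards.
\<close>

lemma gen_metric_speed_ratio_bound:
  assumes "compact J" "J \<subseteq> I" "compact K"
  obtains C where "C > 0" "speed_ratio_bound C J K"
proof -
  obtain C r where C: "C > 0" "r > 0"
    "\<forall>s\<in>J. \<forall>s'\<in>J. \<forall>x\<in>K. \<forall>y\<in>K. d s' x y < r \<longrightarrow>
       d s x y \<le> exp (C * \<bar>s - s'\<bar>) * d s' x y"
    by (rule dist_ratio_bound[OF assms])
  have "gen_metric_speed d \<beta> s t \<le> ereal (exp (C * \<bar>s - s'\<bar>)) * gen_metric_speed d \<beta> s' t"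
    if ac: "\<And>s. s \<in> I \<Longrightarrow> abs_continuous_curve (d s) \<beta> a b"
      and uv: "a \<le> u" "v \<le> b" "t \<in> {u<..<v}" and K: "\<beta> ` {u<..<v} \<subseteq> K" and J: "s \<in> J" "s' \<in> J"
    for \<beta> a b u v t s s'
  proof -
    have "a < b" using uv by auto
    interpret metric_family_curve d I \<beta> a b by (rule metric_family_curveI[OF ac \<open>a < b\<close>])
    have sI: "s \<in> I" "s' \<in> I" using J assms(2) by auto
    interpret s': metric_on_type "d s'" by (rule metric_d[OF sI(2)])
    obtain \<delta> where \<delta>: "\<delta> > 0"
      "\<And>x y. a \<le> x \<Longrightarrow> x \<le> y \<Longrightarrow> y \<le> b \<Longrightarrow> y - x < \<delta> \<Longrightarrow> d s' (\<beta> x) (\<beta> y) < r"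
      using abs_continuous_curve_uniform[OF ac[OF sI(2)] C(2)] by blast
    show ?thesis
    proof (rule gen_metric_speed_le_mult[OF sI uv(3) uv(1,2)])
      show "AE x in lebesgue. x \<in> {u<..<v} \<longrightarrow>
          metric_speed (d s) \<beta> x \<le> exp (C * \<bar>s - s'\<bar>) * metric_speed (d s') \<beta> x"
        using metric_on_type.metric_speed_tendsto[OF metric[OF sI(1)] ac[OF sI(1)] \<open>a < b\<close>]
          metric_on_type.metric_speed_tendsto[OF metric[OF sI(2)] ac[OF sI(2)] \<open>a < b\<close>]
      proof eventually_elim
        case (elim x)
        show ?case
        proof
          assume x: "x \<in> {u<..<v}"
          then have xab: "x \<in> {a<..<b}" using uv by auto
          show "metric_speed (d s) \<beta> x \<le> exp (C * \<bar>s - s'\<bar>) * metric_speed (d s') \<beta> x"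
          proof (rule tendsto_le)
            show "((\<lambda>y. d s (\<beta> y) (\<beta> x) / \<bar>y - x\<bar>) \<longlongrightarrow> metric_speed (d s) \<beta> x) (at x)"
              using elim xab by simp
            show "((\<lambda>y. exp (C * \<bar>s - s'\<bar>) * (d s' (\<beta> y) (\<beta> x) / \<bar>y - x\<bar>))
                \<longlongrightarrow> exp (C * \<bar>s - s'\<bar>) * metric_speed (d s') \<beta> x) (at x)"
              using elim xab by (intro tendsto_mult_left) simp
            have "eventually (\<lambda>y. y \<in> {u<..<v} \<inter> ball x \<delta>) (at x)"
              using x \<delta>(1) by (intro eventually_at_in_open') (auto intro: open_Int)
            then show "eventually (\<lambda>y. d s (\<beta> y) (\<beta> x) / \<bar>y - x\<bar>
                \<le> exp (C * \<bar>s - s'\<bar>) * (d s' (\<beta> y) (\<beta> x) / \<bar>y - x\<bar>)) (at x)"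
            proof eventually_elim
              case (elim y)
              have "d s' (\<beta> y) (\<beta> x) < r"
                using \<delta>(2)[of x y] \<delta>(2)[of y x] elim x uv s'.commute[of "\<beta> x" "\<beta> y"]
                by (cases "x \<le> y") (auto simp: dist_real_def)
              then have "d s (\<beta> y) (\<beta> x) \<le> exp (C * \<bar>s - s'\<bar>) * d s' (\<beta> y) (\<beta> x)"
                using K elim x by (intro C(3)[rule_format, OF J]) auto
              then show ?case
                using divide_right_mono[of _ _ "\<bar>y - x\<bar>"] by fastforce
            qed
          qed simp
        qed
      qed
    qed simp
  qed
  note bound = this
  show ?thesis
  proof (rule that[OF C(1)], unfold speed_ratio_bound_def, intro allI impI, elim conjE)
    fix \<beta> a b u v t s s'
    assume "\<forall>s\<in>I. abs_continuous_curve (d s) \<beta> a b" "a \<le> u" "v \<le> b" "t \<in> {u<..<v}"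
      "\<beta> ` {u<..<v} \<subseteq> K" "s \<in> J" "s' \<in> J"
    then show "gen_metric_speed d \<beta> s t \<le> ereal (exp (C * \<bar>s - s'\<bar>)) * gen_metric_speed d \<beta> s' t"
      by (intro bound[of \<beta> a b u v]) simp_all
  qed
qed

end

section \<open>Timelike curves\<close>

lemma ereal_square_less_iff:
  assumes "0 \<le> g" "0 < x"
  shows "g\<^sup>2 < ereal (x\<^sup>2) \<longleftrightarrow> g < ereal x"
proof (cases g)
  case (real r)
  then have "r \<ge> 0" using assms by simp
  have "r\<^sup>2 < x\<^sup>2 \<longleftrightarrow> r < x"
    using \<open>r \<ge> 0\<close> assms(2) power_strict_mono[of r x 2] power_mono[of x r 2]
    by (auto simp: not_less[symmetric] simp del: power_mono_iff)
  then show ?thesis using real by (simp add: power2_eq_square)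
qed (use assms in auto)

context lipschitz_spacetime
begin

text \<open>
  Both sides of the defining inequality are squares of nonnegative quantities, so the squares can be
  removed; differentiability is packaged with the value of the derivative.
\<close>

lemma timelike_curve_iff:
  "timelike_curve I h d \<gamma> a b \<longleftrightarrow>
     a < b \<and> (\<forall>t\<in>{a..b}. fst (\<gamma> t) \<in> I) \<and> abs_continuous_curve dist (\<lambda>t. fst (\<gamma> t)) a b \<and>
     (\<forall>s\<in>I. abs_continuous_curve (d s) (\<lambda>t. snd (\<gamma> t)) a b) \<and>
     (AE t in lebesgue. t \<in> {a<..<b} \<longrightarrow> (\<exists>D>0. ((\<lambda>t. fst (\<gamma> t)) has_real_derivative D) (at t) \<and>
        gen_metric_speed d (\<lambda>t. snd (\<gamma> t)) (fst (\<gamma> t)) t < ereal (h (\<gamma> t) * D)))"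
  (is "_ \<longleftrightarrow> ?basic \<and> ?I \<and> ?ac1 \<and> ?ac2 \<and> (AE t in lebesgue. ?P t)")
proof -
  define \<alpha> \<beta> where "\<alpha> = (\<lambda>t. fst (\<gamma> t))" and "\<beta> = (\<lambda>t. snd (\<gamma> t))"
  have comp: "fst \<circ> \<gamma> = \<alpha>" "snd \<circ> \<gamma> = \<beta>" by (auto simp: \<alpha>_def \<beta>_def)
  have image: "\<gamma> ` {a..b} \<subseteq> I \<times> UNIV \<longleftrightarrow> ?I" by (simp add: image_subset_iff mem_Times_iff)
  have pointwise: "((t \<in> {a<..<b} \<longrightarrow> \<alpha> differentiable (at t) \<and> deriv \<alpha> t > 0) \<and>
      (t \<in> {a<..<b} \<longrightarrow> (gen_metric_speed d \<beta> (\<alpha> t) t)\<^sup>2 < ereal ((h (\<gamma> t))\<^sup>2 * (deriv \<alpha> t)\<^sup>2))) \<longleftrightarrow> ?P t"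
    if ?basic ?I ?ac2 for t
  proof (cases "t \<in> {a<..<b}")
    case True
    interpret metric_family_curve d I \<beta> a b
      by (rule metric_family_curveI) (use that in \<open>auto simp: \<beta>_def\<close>)
    have sI: "\<alpha> t \<in> I" using that(2) True by (auto simp: \<alpha>_def)
    have hp: "h (\<gamma> t) > 0" using h_pos[of "fst (\<gamma> t)" "snd (\<gamma> t)"] sI by (simp add: \<alpha>_def)
    have square: "(gen_metric_speed d \<beta> (\<alpha> t) t)\<^sup>2 < ereal ((h (\<gamma> t))\<^sup>2 * D\<^sup>2) \<longleftrightarrow>
        gen_metric_speed d \<beta> (\<alpha> t) t < ereal (h (\<gamma> t) * D)" if "D > 0" for D
      using ereal_square_less_iff[OF gen_metric_speed_nonneg[OF sI True], of "h (\<gamma> t) * D"] hp that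
      by (simp add: power_mult_distrib)
    have der: "\<alpha> differentiable (at t) \<longleftrightarrow> (\<exists>D. (\<alpha> has_real_derivative D) (at t))"
      by (rule real_differentiable_def)
    have eq: "deriv \<alpha> t = D" if "(\<alpha> has_real_derivative D) (at t)" for D
      using that by (rule DERIV_imp_deriv)
    have "(\<alpha> differentiable (at t) \<and> deriv \<alpha> t > 0 \<and>
        (gen_metric_speed d \<beta> (\<alpha> t) t)\<^sup>2 < ereal ((h (\<gamma> t))\<^sup>2 * (deriv \<alpha> t)\<^sup>2)) \<longleftrightarrow>
        (\<exists>D>0. (\<alpha> has_real_derivative D) (at t) \<and> gen_metric_speed d \<beta> (\<alpha> t) t < ereal (h (\<gamma> t) * D))"
      using der eq square by metis
    moreover have "fst (\<gamma> t) = \<alpha> t" by (simp add: \<alpha>_def)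
    ultimately show ?thesis
      using True unfolding \<alpha>_def[symmetric] \<beta>_def[symmetric] by simp
  next
    case False
    then show ?thesis by blast
  qed
  show ?thesis
  proof (cases "?basic \<and> ?I \<and> ?ac2")
    case True
    have "(AE t in lebesgue. (t \<in> {a<..<b} \<longrightarrow> \<alpha> differentiable (at t) \<and> deriv \<alpha> t > 0) \<and>
        (t \<in> {a<..<b} \<longrightarrow> (gen_metric_speed d \<beta> (\<alpha> t) t)\<^sup>2 < ereal ((h (\<gamma> t))\<^sup>2 * (deriv \<alpha> t)\<^sup>2)))
        \<longleftrightarrow> (AE t in lebesgue. ?P t)"
      by (rule AE_cong, rule pointwise) (use True in blast)+
    then show ?thesis
      unfolding timelike_curve_def Let_def comp image AE_conj_iff
      by (auto simp: \<alpha>_def \<beta>_def)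
  next
    case False
    then show ?thesis
      unfolding timelike_curve_def Let_def comp image
      by (auto simp: \<alpha>_def \<beta>_def)
  qed
qed

text \<open>
  The time component is absolutely continuous, hence the integral of its derivative \<open>f\<close>; inequalities
  for \<open>f\<close> that hold almost everywhere can thus be integrated.
\<close>

lemma timelike_curve_components:
  assumes "timelike_curve I h d \<gamma> a b" "fst \<circ> \<gamma> = \<alpha>" "snd \<circ> \<gamma> = \<beta>"
  obtains f where "a < b" "\<And>t. t \<in> {a..b} \<Longrightarrow> \<alpha> t \<in> I"
    "abs_continuous_curve dist \<alpha> a b" "\<And>s. s \<in> I \<Longrightarrow> abs_continuous_curve (d s) \<beta> a b"
    "f absolutely_integrable_on {a..b}"
    "\<And>u v. a \<le> u \<Longrightarrow> u \<le> v \<Longrightarrow> v \<le> b \<Longrightarrow> (f has_integral (\<alpha> v - \<alpha> u)) {u..v}"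
    "AE t in lebesgue. t \<in> {a<..<b} \<longrightarrow> (\<alpha> has_real_derivative f t) (at t) \<and> 0 < f t \<and>
       gen_metric_speed d \<beta> (\<alpha> t) t < ereal (h (\<alpha> t, \<beta> t) * f t)"
proof -
  have \<alpha>\<beta>: "(\<lambda>t. fst (\<gamma> t)) = \<alpha>" "(\<lambda>t. snd (\<gamma> t)) = \<beta>" "\<And>t. \<gamma> t = (\<alpha> t, \<beta> t)" "\<And>t. fst (\<gamma> t) = \<alpha> t"
    using assms(2,3) by auto
  note tl = assms(1)[unfolded timelike_curve_iff, unfolded \<alpha>\<beta>]
  have ab: "a < b" and ac: "abs_continuous_curve dist \<alpha> a b" using tl by auto
  obtain f where f: "f absolutely_integrable_on {a..b}"
    "\<And>u v. a \<le> u \<Longrightarrow> u \<le> v \<Longrightarrow> v \<le> b \<Longrightarrow> (f has_integral (\<alpha> v - \<alpha> u)) {u..v}"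
    "AE t in lebesgue. t \<in> {a<..<b} \<longrightarrow> (\<alpha> has_real_derivative f t) (at t)"
    by (rule abs_continuous_derivative[OF ac ab]) blast
  have "AE t in lebesgue. t \<in> {a<..<b} \<longrightarrow> (\<exists>D>0. (\<alpha> has_real_derivative D) (at t) \<and>
        gen_metric_speed d \<beta> (\<alpha> t) t < ereal (h (\<alpha> t, \<beta> t) * D))"
    using tl by (simp add: \<alpha>\<beta>)
  with f(3) have "AE t in lebesgue. t \<in> {a<..<b} \<longrightarrow> (\<alpha> has_real_derivative f t) (at t) \<and> 0 < f t \<and>
       gen_metric_speed d \<beta> (\<alpha> t) t < ereal (h (\<alpha> t, \<beta> t) * f t)"
  proof eventually_elim
    case (elim t)
    then show ?case using DERIV_unique by blast
  qed
  with ab ac f(1,2) tl show ?thesis by (intro that[of f]) auto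
qed

lemma AE_pos_integral_nonneg:
  fixes f :: "real \<Rightarrow> real"
  assumes "(f has_integral y) {u..v}" "AE t in lebesgue. t \<in> {u<..<v} \<longrightarrow> 0 \<le> f t"
  shows "0 \<le> y"
proof -
  obtain N where N: "negligible N" "\<And>t. t \<in> {u..v} - N \<Longrightarrow> 0 \<le> f t"
    using AE_interval_negligible[OF assms(2)] by blast
  have "((\<lambda>t. \<bar>f t\<bar>) has_integral y) {u..v}"
    by (rule has_integral_spike[OF N(1) _ assms(1)]) (use N(2) in auto)
  then show ?thesis by (rule has_integral_nonneg) simp
qed

lemma timelike_curve_mono:
  assumes "timelike_curve I h d \<gamma> a b" "a \<le> u" "u \<le> v" "v \<le> b"
  shows "fst (\<gamma> u) \<le> fst (\<gamma> v)"
proof -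
  obtain f where f: "\<And>u v. a \<le> u \<Longrightarrow> u \<le> v \<Longrightarrow> v \<le> b \<Longrightarrow> (f has_integral ((fst \<circ> \<gamma>) v - (fst \<circ> \<gamma>) u)) {u..v}"
    "AE t in lebesgue. t \<in> {a<..<b} \<longrightarrow> ((fst \<circ> \<gamma>) has_real_derivative f t) (at t) \<and> 0 < f t \<and>
       gen_metric_speed d (snd \<circ> \<gamma>) ((fst \<circ> \<gamma>) t) t < ereal (h ((fst \<circ> \<gamma>) t, (snd \<circ> \<gamma>) t) * f t)"
    by (rule timelike_curve_components[OF assms(1) refl refl]) blast
  have "AE t in lebesgue. t \<in> {u<..<v} \<longrightarrow> 0 \<le> f t"
    using f(2) by eventually_elim (use assms in auto)
  then have "0 \<le> (fst \<circ> \<gamma>) v - (fst \<circ> \<gamma>) u"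
    by (rule AE_pos_integral_nonneg[OF f(1)[OF assms(2-4)]])
  then show ?thesis by simp
qed

section \<open>Small diamonds\<close>

lemma chron_vertical:
  assumes "s \<in> I" "s' \<in> I" "s < s'"
  shows "chron I h d (s, x) (s', x)"
proof -
  have "timelike_curve I h d (\<lambda>t. (t, x)) s s'"
    unfolding timelike_curve_iff
  proof (intro conjI ballI)
    show "fst (t, x) \<in> I" if "t \<in> {s..s'}" for t
      using interval_subset[OF assms(1,2)] that by auto
    show "abs_continuous_curve dist (\<lambda>t. fst (t, x)) s s'"
      using abs_continuous_curve_id by simp
    show "abs_continuous_curve (d r) (\<lambda>t. snd (t, x)) s s'" if "r \<in> I" for r
    proof -
      interpret metric_on_type "d r" using metric_d[OF that] .
      show ?thesis by (rule abs_continuous_curve_Lipschitz[of 0]) auto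
    qed
    have still: "gen_metric_speed d (\<lambda>t. x) t t = 0" if "t \<in> I" for t
    proof -
      interpret metric_on_type "d t" using metric_d[OF that] .
      have "metric_speed (d t) (\<lambda>t. x) u = 0" for u
        unfolding metric_speed_def by (intro tendsto_Lim) auto
      moreover have "(LINT u = ereal y..ereal z|lebesgue. (0::real)) = 0" for y z
        by (cases "y \<le> z") (simp_all add: interval_lebesgue_integral_def set_lebesgue_integral_def)
      ultimately show ?thesis by (simp add: gen_metric_speed_def Limsup_const)
    qed
    show "AE t in lebesgue. t \<in> {s<..<s'} \<longrightarrow> (\<exists>D>0. ((\<lambda>t. fst (t, x)) has_real_derivative D) (at t) \<and>
        gen_metric_speed d (\<lambda>t. snd (t, x)) (fst (t, x)) t < ereal (h (t, x) * D))"
    proof (intro AE_I2 impI exI[of _ 1] conjI)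
      fix t assume "t \<in> {s<..<s'}"
      then have "t \<in> I" using interval_subset[OF assms(1,2)] by auto
      then show "gen_metric_speed d (\<lambda>t. snd (t, x)) (fst (t, x)) t < ereal (h (t, x) * 1)"
        using still h_pos by simp
      show "((\<lambda>t. fst (t, x)) has_real_derivative 1) (at t)" by simp
    qed simp
  qed fact
  then show ?thesis unfolding chron_def by blast
qed

text \<open>
  After a change of the metric parameter, which costs a bounded factor on compact sets, the speed for a
  fixed metric is at most a constant times the derivative of the time component, whose integral is the
  elapsed time.
\<close>

lemma timelike_length_bound:
  assumes J: "s1 \<in> I" "s2 \<in> I" and K: "compact K"
  obtains B where "B > 0"
    "\<forall>\<gamma> a b u s0. timelike_curve I h d \<gamma> a b \<and> (\<forall>t\<in>{a..b}. fst (\<gamma> t) \<in> {s1..s2}) \<and> s0 \<in> {s1..s2} \<and>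
       u \<in> {a..b} \<and> (\<forall>t\<in>{a<..<u}. snd (\<gamma> t) \<in> K) \<longrightarrow>
       length_metric (d s0) (snd (\<gamma> a)) (snd (\<gamma> u)) \<le> ennreal (B * (fst (\<gamma> u) - fst (\<gamma> a)))"
proof -
  have JI: "{s1..s2} \<subseteq> I" by (rule interval_subset[OF J])
  obtain C where C: "C > 0" "speed_ratio_bound C {s1..s2} K"
    by (rule gen_metric_speed_ratio_bound[OF compact_Icc JI K])
  have "continuous_on ({s1..s2} \<times> K) h"
    by (rule continuous_on_subset[OF continuous_h]) (use JI in auto)
  then have "compact (h ` ({s1..s2} \<times> K))"
    by (rule compact_continuous_image) (intro compact_Times compact_Icc K)
  then obtain H0 where H0: "\<forall>y\<in>h ` ({s1..s2} \<times> K). y \<le> H0"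
    using compact_imp_bounded bounded_imp_bdd_above unfolding bdd_above_def by blast
  define H where "H = max 1 H0"
  have H: "H > 0" "\<And>s x. s \<in> {s1..s2} \<Longrightarrow> x \<in> K \<Longrightarrow> h (s, x) \<le> H"
    using H0 by (auto simp: H_def le_max_iff_disj)
  define B where "B = exp (C * (s2 - s1)) * H"
  have B: "B > 0" using H by (simp add: B_def)
  have bound: "length_metric (d s0) (snd (\<gamma> a)) (snd (\<gamma> u)) \<le> ennreal (B * (fst (\<gamma> u) - fst (\<gamma> a)))"
    if tl: "timelike_curve I h d \<gamma> a b" and time: "\<forall>t\<in>{a..b}. fst (\<gamma> t) \<in> {s1..s2}"
      and s0: "s0 \<in> {s1..s2}" and u: "u \<in> {a..b}" and inK: "\<forall>t\<in>{a<..<u}. snd (\<gamma> t) \<in> K"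
    for \<gamma> a b u s0
  proof -
    define \<alpha> \<beta> where "\<alpha> = fst \<circ> \<gamma>" and "\<beta> = snd \<circ> \<gamma>"
    obtain f where ab: "a < b" and ac: "\<And>s. s \<in> I \<Longrightarrow> abs_continuous_curve (d s) \<beta> a b"
      and f: "f absolutely_integrable_on {a..b}"
        "\<And>u v. a \<le> u \<Longrightarrow> u \<le> v \<Longrightarrow> v \<le> b \<Longrightarrow> (f has_integral (\<alpha> v - \<alpha> u)) {u..v}"
        "AE t in lebesgue. t \<in> {a<..<b} \<longrightarrow> (\<alpha> has_real_derivative f t) (at t) \<and> 0 < f t \<and>
         gen_metric_speed d \<beta> (\<alpha> t) t < ereal (h (\<alpha> t, \<beta> t) * f t)"
      by (rule timelike_curve_components[OF tl \<alpha>_def[symmetric] \<beta>_def[symmetric]]) blast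
    interpret metric_family_curve d I \<beta> a b by (rule metric_family_curveI[OF ac ab])
    have s0I: "s0 \<in> I" using s0 JI by auto
    have "AE t in lebesgue. t \<in> {a<..<u} \<longrightarrow> 0 \<le> B * f t - metric_speed (d s0) \<beta> t"
      using f(3) gen_metric_speed_AE[OF s0I]
    proof eventually_elim
      case (elim t)
      show ?case
      proof
        assume t: "t \<in> {a<..<u}"
        then have tab: "t \<in> {a<..<b}" using u by auto
        have \<alpha>t: "\<alpha> t \<in> {s1..s2}" using time tab by (auto simp: \<alpha>_def)
        have fpos: "0 < f t" using elim tab by blast
        have "\<beta> ` {a<..<u} \<subseteq> K" using inK by (auto simp: \<beta>_def)
        then have "gen_metric_speed d \<beta> s0 t
            \<le> ereal (exp (C * \<bar>s0 - \<alpha> t\<bar>)) * gen_metric_speed d \<beta> (\<alpha> t) t"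
          using speed_ratio_boundD[OF C(2), of \<beta> a b a u t s0 "\<alpha> t"] ac u t s0 \<alpha>t by auto
        also have "\<dots> \<le> ereal (exp (C * \<bar>s0 - \<alpha> t\<bar>)) * ereal (h (\<alpha> t, \<beta> t) * f t)"
          using elim tab by (intro ereal_mult_left_mono) auto
        also have "\<dots> = ereal (exp (C * \<bar>s0 - \<alpha> t\<bar>) * (h (\<alpha> t, \<beta> t) * f t))" by simp
        also have "\<dots> \<le> ereal (exp (C * (s2 - s1)) * (H * f t))"
        proof -
          have "\<bar>s0 - \<alpha> t\<bar> \<le> s2 - s1" using s0 \<alpha>t by auto
          then have "exp (C * \<bar>s0 - \<alpha> t\<bar>) \<le> exp (C * (s2 - s1))"
            using C(1) by (simp add: mult_left_mono)
          moreover have "0 \<le> h (\<alpha> t, \<beta> t)" using h_pos[of "\<alpha> t" "\<beta> t"] \<alpha>t JI by auto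
          moreover have "h (\<alpha> t, \<beta> t) \<le> H"
            using H(2)[OF \<alpha>t, of "\<beta> t"] inK t by (auto simp: \<beta>_def)
          ultimately show ?thesis using fpos by (auto intro!: mult_mono)
        qed
        finally show "0 \<le> B * f t - metric_speed (d s0) \<beta> t"
          using elim(2) tab by (simp add: B_def mult.assoc)
      qed
    qed
    moreover have "((\<lambda>t. B * f t - metric_speed (d s0) \<beta> t) has_integral
        (B * (\<alpha> u - \<alpha> a) - (travelled s0 u - travelled s0 a))) {a..u}"
    proof (intro has_integral_diff has_integral_mult_right f(2))
      have "metric_speed (d s0) \<beta> integrable_on {a..b}"
        using metric_on_type.metric_speed_integrable[OF metric_d[OF s0I] ac[OF s0I] ab]
        by (simp add: absolutely_integrable_on_def)
      then have "metric_speed (d s0) \<beta> integrable_on {a..u}"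
        by (rule integrable_on_subinterval) (use u in auto)
      then show "(metric_speed (d s0) \<beta> has_integral (travelled s0 u - travelled s0 a)) {a..u}"
        using travelled_diff[OF s0I, of a u] u by (simp add: has_integral_integral)
    qed (use u in auto)
    ultimately have "0 \<le> B * (\<alpha> u - \<alpha> a) - (travelled s0 u - travelled s0 a)"
      by (rule AE_pos_integral_nonneg[rotated])
    then have le: "travelled s0 u - travelled s0 a \<le> B * (\<alpha> u - \<alpha> a)" by simp
    have "length_metric (d s0) (\<beta> a) (\<beta> u) \<le> ennreal (travelled s0 u - travelled s0 a)"
    proof (rule metric_on_type.length_metric_le_increment[OF metric_d[OF s0I]])
      show "continuous_on {a..u} (travelled s0)"
        by (rule continuous_on_subset[OF continuous_on_travelled[OF s0I]]) (use u in auto)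
      show "d s0 (\<beta> x) (\<beta> y) \<le> travelled s0 y - travelled s0 x" if "a \<le> x" "x \<le> y" "y \<le> u" for x y
        using dist_le_travelled[OF s0I, of x y] that u by auto
    qed (use u in auto)
    also have "\<dots> \<le> ennreal (B * (\<alpha> u - \<alpha> a))" using le by (rule ennreal_leI)
    finally show ?thesis by (simp add: \<alpha>_def \<beta>_def)
  qed
  show ?thesis
    by (rule that[OF B], intro allI impI, elim conjE) (rule bound)
qed

text \<open>
  At the first time at which the curve is outside a ball of the length metric contained in \<open>K\<close>, the
  preceding bound still applies.
\<close>

lemma timelike_curve_stays_near:
  assumes J: "s1 \<in> I" "s2 \<in> I" and tl: "timelike_curve I h d \<gamma> a b"
    and time: "\<forall>t\<in>{a..b}. fst (\<gamma> t) \<in> {s1..s2}" and s0: "s0 \<in> {s1..s2}"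
    and U: "open U" "U \<subseteq> K"
    and bound: "\<forall>u. u \<in> {a..b} \<and> (\<forall>t\<in>{a<..<u}. snd (\<gamma> t) \<in> K) \<longrightarrow>
       length_metric (d s0) (snd (\<gamma> a)) (snd (\<gamma> u)) < ennreal e"
    and ball: "{y. length_metric (d s0) (snd (\<gamma> a)) y < ennreal e} \<subseteq> U"
    and "t \<in> {a..b}"
  shows "snd (\<gamma> t) \<in> U"
proof (rule ccontr)
  assume "snd (\<gamma> t) \<notin> U"
  have s0I: "s0 \<in> I" using s0 interval_subset[OF J] by auto
  have "continuous_on {a..b} (\<lambda>t. snd (\<gamma> t))"
    using tl s0I abs_continuous_imp_continuous[OF s0I] unfolding timelike_curve_iff by blast
  then obtain A where A: "open A" "A \<inter> {a..b} = (\<lambda>t. snd (\<gamma> t)) -` U \<inter> {a..b}"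
    using U(1) unfolding continuous_on_open_invariant by blast
  define T where "T = {a..b} - A"
  have T: "u \<in> T \<longleftrightarrow> u \<in> {a..b} \<and> snd (\<gamma> u) \<notin> U" for u
    using A(2) unfolding T_def by blast
  have compact_T: "compact T" unfolding T_def by (intro compact_diff A(1)) simp
  have "t \<in> T" using T \<open>t \<in> {a..b}\<close> \<open>snd (\<gamma> t) \<notin> U\<close> by blast
  then have "T \<noteq> {}" by blast
  from compact_attains_inf[OF compact_T this] obtain u where u: "u \<in> T" "\<forall>v\<in>T. u \<le> v"
    by blast
  have "snd (\<gamma> v) \<in> K" if "v \<in> {a<..<u}" for v
  proof -
    have "v \<notin> T" using u(2) that by force
    moreover have "v \<in> {a..b}" using T[of u] u(1) that by auto
    ultimately show ?thesis using T U(2) by blast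
  qed
  then have "length_metric (d s0) (snd (\<gamma> a)) (snd (\<gamma> u)) < ennreal e"
    using bound u(1) T by blast
  then show False using ball u(1) T by blast
qed

lemma compact_neighbourhood:
  obtains U K where "open U" "(x :: 'a) \<in> U" "U \<subseteq> K" "compact K"
proof -
  have "\<exists>U. open U \<and> (\<exists>K. compact K \<and> x \<in> U \<and> U \<subseteq> K)"
    using locally_compact unfolding locally_compact_space_def by (simp add: compactin_euclidean_iff)
  then show ?thesis using that by blast
qed

text \<open>
  The time of every point of the diamond is between the times of its vertices, and the spatial part of
  a curve from the lower vertex has too little time to leave a small ball of the length metric.
\<close>

lemma small_diamond_exists:
  assumes W: "open W" "(s0, x0) \<in> W" "s0 \<in> I"
  obtains p q where "p \<in> I \<times> UNIV" "q \<in> I \<times> UNIV"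
    "(s0, x0) \<in> diamond I h d p q" "diamond I h d p q \<subseteq> W"
proof -
  obtain S V where SV: "open S" "open V" "(s0, x0) \<in> S \<times> V" "S \<times> V \<subseteq> W"
    using open_prod_elim[OF W(1,2)] by blast
  obtain U0 K where U0: "open U0" "x0 \<in> U0" "U0 \<subseteq> K" and K: "compact K"
    by (rule compact_neighbourhood)
  define U where "U = U0 \<inter> V"
  have U: "open U" "x0 \<in> U" "U \<subseteq> K" using U0 SV by (auto simp: U_def)
  have "open (S \<inter> I)" "s0 \<in> S \<inter> I" using SV W(3) open_I by (auto simp: open_Int)
  then obtain \<eta>0 where \<eta>0: "\<eta>0 > 0" "cball s0 \<eta>0 \<subseteq> S \<inter> I"
    unfolding open_contains_cball by blast
  have near: "s \<in> S \<and> s \<in> I" if "\<bar>s - s0\<bar> \<le> \<eta>0" for s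
    using \<eta>0(2) that by (auto simp: subset_iff dist_real_def abs_minus_commute)
  have J: "s0 - \<eta>0 \<in> I" "s0 + \<eta>0 \<in> I" using near[of "s0 - \<eta>0"] near[of "s0 + \<eta>0"] \<eta>0(1) by auto
  obtain e where e: "e > 0" "{y. length_metric (d s0) x0 y < ennreal e} \<subseteq> U"
    using length_topology[OF W(3)] U(1,2) unfolding generates_topology_def by blast
  obtain B where B: "B > 0"
    "\<forall>\<gamma> a b u s. timelike_curve I h d \<gamma> a b \<and> (\<forall>t\<in>{a..b}. fst (\<gamma> t) \<in> {s0 - \<eta>0..s0 + \<eta>0}) \<and>
       s \<in> {s0 - \<eta>0..s0 + \<eta>0} \<and> u \<in> {a..b} \<and> (\<forall>t\<in>{a<..<u}. snd (\<gamma> t) \<in> K) \<longrightarrow>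
       length_metric (d s) (snd (\<gamma> a)) (snd (\<gamma> u)) \<le> ennreal (B * (fst (\<gamma> u) - fst (\<gamma> a)))"
    by (rule timelike_length_bound[OF J K])
  define \<eta> where "\<eta> = min \<eta>0 (e / (4 * B))"
  have \<eta>: "\<eta> > 0" "\<eta> \<le> \<eta>0" "B * (2 * \<eta>) < e"
  proof -
    show "\<eta> > 0" "\<eta> \<le> \<eta>0" using \<eta>0(1) e(1) B(1) by (auto simp: \<eta>_def)
    have "B * (2 * \<eta>) \<le> B * (2 * (e / (4 * B)))"
      using B(1) by (intro mult_left_mono) (auto simp: \<eta>_def)
    also have "\<dots> < e" using B(1) e(1) by simp
    finally show "B * (2 * \<eta>) < e" .
  qed
  have pI: "s0 - \<eta> \<in> I" "s0 + \<eta> \<in> I" using near[of "s0 - \<eta>"] near[of "s0 + \<eta>"] \<eta> by auto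
  show ?thesis
  proof (rule that)
    show "(s0 - \<eta>, x0) \<in> I \<times> UNIV" "(s0 + \<eta>, x0) \<in> I \<times> UNIV" using pI by auto
    show "(s0, x0) \<in> diamond I h d (s0 - \<eta>, x0) (s0 + \<eta>, x0)"
      using pI W(3) \<eta>(1) by (auto simp: diamond_def intro!: chron_vertical)
    show "diamond I h d (s0 - \<eta>, x0) (s0 + \<eta>, x0) \<subseteq> W"
    proof
      fix z assume z: "z \<in> diamond I h d (s0 - \<eta>, x0) (s0 + \<eta>, x0)"
      obtain \<gamma> a b where \<gamma>: "timelike_curve I h d \<gamma> a b" "\<gamma> a = (s0 - \<eta>, x0)" "\<gamma> b = z"
        using z by (auto simp: diamond_def chron_def)
      obtain \<gamma>' a' b' where \<gamma>': "timelike_curve I h d \<gamma>' a' b'" "\<gamma>' a' = z" "\<gamma>' b' = (s0 + \<eta>, x0)"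
        using z by (auto simp: diamond_def chron_def)
      have ab: "a \<le> b" "a' \<le> b'" using \<gamma>(1) \<gamma>'(1) by (auto simp: timelike_curve_iff)
      have zle: "fst z \<le> s0 + \<eta>" using timelike_curve_mono[OF \<gamma>'(1), of a' b'] \<gamma>' ab by simp
      have time': "s0 - \<eta> \<le> fst (\<gamma> t) \<and> fst (\<gamma> t) \<le> s0 + \<eta>" if "t \<in> {a..b}" for t
        using timelike_curve_mono[OF \<gamma>(1), of a t] timelike_curve_mono[OF \<gamma>(1), of t b] \<gamma> that zle by auto
      then have time: "\<forall>t\<in>{a..b}. fst (\<gamma> t) \<in> {s0 - \<eta>0..s0 + \<eta>0}"
        using \<eta>(2) by fastforce
      have s0: "s0 \<in> {s0 - \<eta>0..s0 + \<eta>0}" using \<eta>0(1) by auto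
      have "snd (\<gamma> b) \<in> U"
      proof (rule timelike_curve_stays_near[OF J \<gamma>(1) time s0 U(1,3)])
        show "{y. length_metric (d s0) (snd (\<gamma> a)) y < ennreal e} \<subseteq> U" using e(2) \<gamma>(2) by simp
        show "b \<in> {a..b}" using ab by simp
        show "\<forall>u. u \<in> {a..b} \<and> (\<forall>t\<in>{a<..<u}. snd (\<gamma> t) \<in> K) \<longrightarrow>
           length_metric (d s0) (snd (\<gamma> a)) (snd (\<gamma> u)) < ennreal e"
        proof (intro allI impI, elim conjE)
          fix u assume u: "u \<in> {a..b}" "\<forall>t\<in>{a<..<u}. snd (\<gamma> t) \<in> K"
          have "length_metric (d s0) (snd (\<gamma> a)) (snd (\<gamma> u)) \<le> ennreal (B * (fst (\<gamma> u) - fst (\<gamma> a)))"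
            using B(2)[rule_format, of \<gamma> a b s0 u] \<gamma>(1) time s0 u by blast
          also have "\<dots> \<le> ennreal (B * (2 * \<eta>))"
            using time'[OF u(1)] \<gamma>(2) B(1) by (intro ennreal_leI mult_left_mono) auto
          also have "\<dots> < ennreal e" using \<eta>(3) e(1) by (intro ennreal_lessI)
          finally show "length_metric (d s0) (snd (\<gamma> a)) (snd (\<gamma> u)) < ennreal e" .
        qed
      qed
      then have "snd z \<in> V" using \<gamma>(3) by (simp add: U_def)
      moreover have "fst z \<in> S" using near[of "fst z"] time'[of b] \<gamma>(3) ab \<eta>(2) by auto
      ultimately show "z \<in> W" using SV(4) by (cases z) auto
    qed
  qed
qed

end

section \<open>Arriving earlier along the same spatial curve\<close>

context lipschitz_spacetime
begin

text \<open>
  For each fixed metric the generalized speed is measurable in time, and it depends continuously on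
  the metric parameter, uniformly enough to replace the parameter by step functions.
\<close>

lemma gen_metric_speed_along_measurable:
  assumes J: "l \<in> I" "r \<in> I" and ac: "\<And>s. s \<in> I \<Longrightarrow> abs_continuous_curve (d s) \<beta> a b" and ab: "a < b"
    and \<alpha>: "continuous_on {a..b} \<alpha>" "\<And>t. t \<in> {a..b} \<Longrightarrow> \<alpha> t \<in> {l..r}"
  shows "(\<lambda>t. if t \<in> {a<..<b} then real_of_ereal (gen_metric_speed d \<beta> (\<alpha> t) t) else 0)
           \<in> borel_measurable (lebesgue_on {a..b})"
proof -
  interpret metric_family_curve d I \<beta> a b by (rule metric_family_curveI[OF ac ab])
  have JI: "{l..r} \<subseteq> I" by (rule interval_subset[OF J])
  have lr: "l \<le> r" using \<alpha>(2)[of a] ab by auto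
  have K: "compact (\<beta> ` {a..b})"
    by (rule compact_continuous_image[OF abs_continuous_imp_continuous[OF J(1) ac[OF J(1)]]]) simp
  obtain C where C: "C > 0" "speed_ratio_bound C {l..r} (\<beta> ` {a..b})"
    by (rule gen_metric_speed_ratio_bound[OF compact_Icc JI K])
  define R where "R s t = (if t \<in> {a<..<b} then real_of_ereal (gen_metric_speed d \<beta> s t) else 0)" for s t
  have R_le: "R s t \<le> exp (C * \<bar>s - s'\<bar>) * R s' t" if s: "s \<in> {l..r}" "s' \<in> {l..r}" for s s' t
  proof (cases "t \<in> {a<..<b}")
    case True
    have sub: "\<beta> ` {a<..<b} \<subseteq> \<beta> ` {a..b}" by auto
    have le: "gen_metric_speed d \<beta> x t \<le> ereal (exp (C * \<bar>x - y\<bar>)) * gen_metric_speed d \<beta> y t"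
      if "x \<in> {l..r}" "y \<in> {l..r}" for x y
      using speed_ratio_boundD[OF C(2), of \<beta> a b a b t x y] ac True that sub by auto
    have nn: "0 \<le> gen_metric_speed d \<beta> s t" "0 \<le> gen_metric_speed d \<beta> s' t"
      using s JI True by (auto intro!: gen_metric_speed_nonneg)
    show ?thesis
    proof (cases "gen_metric_speed d \<beta> s' t")
      case (real y)
      then show ?thesis
        using le[OF s] nn True by (cases "gen_metric_speed d \<beta> s t") (auto simp: R_def)
    next
      case PInf
      then have "gen_metric_speed d \<beta> s t = \<infinity>"
        using le[OF s(2,1)] nn by (cases "gen_metric_speed d \<beta> s t") auto
      then show ?thesis using PInf by (simp add: R_def)
    qed (use nn in auto)
  next
    case False
    have "R x t = 0" for x unfolding R_def by (rule if_not_P[OF False])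
    then show ?thesis by simp
  qed
  have R_nonneg: "0 \<le> R s t" if "s \<in> {l..r}" for s t
    using gen_metric_speed_nonneg[of s t] that JI by (auto simp: R_def real_of_ereal_pos)
  have R_meas: "R s \<in> borel_measurable (lebesgue_on {a..b})" if "s \<in> I" for s
  proof -
    have AE_R: "AE t in lebesgue. t \<in> {a<..<b} \<longrightarrow> R s t = metric_speed (d s) \<beta> t"
      using gen_metric_speed_AE[OF that] by eventually_elim (simp add: R_def)
    obtain N where N: "negligible N" "\<And>t. t \<in> {a..b} - N \<Longrightarrow> R s t = metric_speed (d s) \<beta> t"
      using AE_interval_negligible[OF AE_R] by blast
    have "metric_speed (d s) \<beta> integrable_on {a..b}"
      using metric_on_type.metric_speed_integrable[OF metric_d[OF that] ac[OF that] ab]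
      by (simp add: absolutely_integrable_on_def)
    then have "R s integrable_on {a..b}" by (rule integrable_spike[OF _ N])
    then show ?thesis by (rule integrable_imp_measurable)
  qed
  define \<sigma> where "\<sigma> n t = min r (max l (real_of_int \<lfloor>real (Suc n) * \<alpha> t\<rfloor> / real (Suc n)))" for n t
  have \<sigma>_mem: "\<sigma> n t \<in> {l..r}" for n t using lr by (auto simp: \<sigma>_def)
  have \<sigma>_close: "\<bar>\<sigma> n t - \<alpha> t\<bar> \<le> 1 / real (Suc n)" if "t \<in> {a..b}" for n t
  proof -
    define x where "x = real_of_int \<lfloor>real (Suc n) * \<alpha> t\<rfloor> / real (Suc n)"
    have "real_of_int \<lfloor>real (Suc n) * \<alpha> t\<rfloor> \<le> real (Suc n) * \<alpha> t"
      "real (Suc n) * \<alpha> t - 1 \<le> real_of_int \<lfloor>real (Suc n) * \<alpha> t\<rfloor>" by linarith+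
    then have "x \<le> real (Suc n) * \<alpha> t / real (Suc n)" "(real (Suc n) * \<alpha> t - 1) / real (Suc n) \<le> x"
      unfolding x_def by (intro divide_right_mono; simp)+
    then have "x \<le> \<alpha> t" "\<alpha> t - 1 / real (Suc n) \<le> x"
      by (simp_all add: diff_divide_distrib del: of_nat_Suc)
    moreover have "\<sigma> n t = min r (max l x)" by (simp add: \<sigma>_def x_def)
    moreover have "0 \<le> 1 / real (Suc n)" by simp
    ultimately show ?thesis using \<alpha>(2)[OF that] unfolding atLeastAtMost_iff by linarith
  qed
  have \<alpha>_meas: "\<alpha> \<in> borel_measurable (lebesgue_on {a..b})"
    using \<alpha>(1) by (rule continuous_imp_measurable_on_sets_lebesgue) simp
  have step: "(\<lambda>t. R (\<sigma> n t) t) \<in> borel_measurable (lebesgue_on {a..b})" for n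
  proof -
    have "(\<lambda>t. \<lfloor>real (Suc n) * \<alpha> t\<rfloor>) \<in> measurable (lebesgue_on {a..b}) (count_space UNIV)"
      using \<alpha>_meas by measurable
    moreover have "R (min r (max l (real_of_int k / real (Suc n)))) \<in> borel_measurable (lebesgue_on {a..b})" for k
      using lr JI by (intro R_meas) auto
    ultimately show ?thesis
      unfolding \<sigma>_def by (intro measurable_compose_countable[where g = "\<lambda>t. \<lfloor>real (Suc n) * \<alpha> t\<rfloor>"
        and f = "\<lambda>k. R (min r (max l (real_of_int k / real (Suc n))))"])
  qed
  have "(\<lambda>t. R (\<alpha> t) t) \<in> borel_measurable (lebesgue_on {a..b})"
  proof (rule borel_measurable_LIMSEQ_real[OF _ step])
    fix t assume "t \<in> space (lebesgue_on {a..b})"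
    then have t: "t \<in> {a..b}" by simp
    have dist0: "(\<lambda>n. \<bar>\<sigma> n t - \<alpha> t\<bar>) \<longlonglongrightarrow> 0"
      by (rule tendsto_sandwich[OF _ _ tendsto_const LIMSEQ_Suc[OF lim_1_over_n]])
        (use \<sigma>_close[OF t] in auto)
    show "(\<lambda>n. R (\<sigma> n t) t) \<longlonglongrightarrow> R (\<alpha> t) t"
    proof (rule tendsto_sandwich)
      have "(\<lambda>n. exp (- (C * \<bar>\<sigma> n t - \<alpha> t\<bar>)) * R (\<alpha> t) t) \<longlonglongrightarrow> exp (- (C * 0)) * R (\<alpha> t) t"
        by (intro tendsto_intros dist0)
      then show "(\<lambda>n. exp (- (C * \<bar>\<sigma> n t - \<alpha> t\<bar>)) * R (\<alpha> t) t) \<longlonglongrightarrow> R (\<alpha> t) t" by simp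
      have "(\<lambda>n. exp (C * \<bar>\<sigma> n t - \<alpha> t\<bar>) * R (\<alpha> t) t) \<longlonglongrightarrow> exp (C * 0) * R (\<alpha> t) t"
        by (intro tendsto_intros dist0)
      then show "(\<lambda>n. exp (C * \<bar>\<sigma> n t - \<alpha> t\<bar>) * R (\<alpha> t) t) \<longlonglongrightarrow> R (\<alpha> t) t" by simp
      have "exp (- (C * \<bar>\<sigma> n t - \<alpha> t\<bar>)) * R (\<alpha> t) t \<le> R (\<sigma> n t) t" for n
        using R_le[OF \<alpha>(2)[OF t] \<sigma>_mem, of t n]
        by (simp add: exp_minus field_simps abs_minus_commute)
      then show "\<forall>\<^sub>F n in sequentially. exp (- (C * \<bar>\<sigma> n t - \<alpha> t\<bar>)) * R (\<alpha> t) t \<le> R (\<sigma> n t) t" by simp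
      show "\<forall>\<^sub>F n in sequentially. R (\<sigma> n t) t \<le> exp (C * \<bar>\<sigma> n t - \<alpha> t\<bar>) * R (\<alpha> t) t"
        using R_le[OF \<sigma>_mem \<alpha>(2)[OF t]] by simp
    qed
  qed
  then show ?thesis by (simp only: R_def)
qed

lemma exp_le_one_add_double:
  fixes x :: real
  assumes "0 \<le> x" "x \<le> 1"
  shows "exp x \<le> 1 + 2 * x"
proof -
  have "exp x \<le> 1 + x + x\<^sup>2" using assms by (rule exp_bound)
  also have "x\<^sup>2 \<le> x" using assms by (simp add: power2_eq_square mult_left_le)
  finally show ?thesis by simp
qed

lemma AE_interval_ex:
  fixes a b :: real
  assumes "AE t in lebesgue. t \<in> {a<..<b} \<longrightarrow> P t" "a < b"
  obtains t where "t \<in> {a<..<b}" "P t"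
proof -
  obtain N where N: "negligible N" "\<And>t. t \<in> {a..b} - N \<Longrightarrow> t \<in> {a<..<b} \<longrightarrow> P t"
    using assms(1) by (metis AE_interval_negligible)
  have "\<not> {a<..<b} \<subseteq> N"
    using N(1) negligible_subset[of N "box a b"] negligible_interval(2)[of a b] assms(2) by auto
  then obtain t where "t \<in> {a<..<b}" "t \<notin> N" by blast
  then show ?thesis using N(2)[of t] that by auto
qed

text \<open>
  Let \<open>\<alpha>\<close> be the time component, \<open>f\<close> its derivative, and \<open>r\<close> the quotient of the generalized speed and
  \<open>h\<close> along the curve; so \<open>f > r\<close> almost everywhere, but the gap \<open>f - r\<close> may be arbitrarily small. The
  new time component is \<open>\<alpha> - \<epsilon> w\<close>, where \<open>w = exp (- 2 L \<alpha>) u\<close>, the derivative of \<open>u\<close> is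
  \<open>exp (2 L \<alpha>) (f - r)\<close>, and \<open>L\<close> is a Lipschitz constant of \<open>ln r\<close> in the metric parameter. Lowering
  the parameter by \<open>\<epsilon> w\<close> increases \<open>r\<close> at most by the factor \<open>1 + 2 L \<epsilon> w\<close>. The exponential weight
  is an integrating factor: the derivative of \<open>\<alpha> - \<epsilon> w\<close> exceeds \<open>(1 + 2 L \<epsilon> w) r\<close> by
  \<open>(f - r) (1 - \<epsilon> + 2 L \<epsilon> w)\<close>, which is positive.
\<close>

lemma timelike_curve_arrive_earlier:
  assumes tl: "timelike_curve I h d \<gamma> a b"
  obtains \<alpha>' where "timelike_curve I h d (\<lambda>t. (\<alpha>' t, snd (\<gamma> t))) a b"
    "\<alpha>' a = fst (\<gamma> a)" "\<alpha>' b < fst (\<gamma> b)"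
proof -
  define \<alpha> \<beta> where "\<alpha> = fst \<circ> \<gamma>" and "\<beta> = snd \<circ> \<gamma>"
  obtain f where ab: "a < b" and \<alpha>I: "\<And>t. t \<in> {a..b} \<Longrightarrow> \<alpha> t \<in> I"
    and ac_\<alpha>: "abs_continuous_curve dist \<alpha> a b" and ac: "\<And>s. s \<in> I \<Longrightarrow> abs_continuous_curve (d s) \<beta> a b"
    and f: "f absolutely_integrable_on {a..b}"
    "\<And>u v. a \<le> u \<Longrightarrow> u \<le> v \<Longrightarrow> v \<le> b \<Longrightarrow> (f has_integral (\<alpha> v - \<alpha> u)) {u..v}"
    "AE t in lebesgue. t \<in> {a<..<b} \<longrightarrow> (\<alpha> has_real_derivative f t) (at t) \<and> 0 < f t \<and>
       gen_metric_speed d \<beta> (\<alpha> t) t < ereal (h (\<alpha> t, \<beta> t) * f t)"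
    by (rule timelike_curve_components[OF tl \<alpha>_def[symmetric] \<beta>_def[symmetric]]) blast
  interpret metric_family_curve d I \<beta> a b by (rule metric_family_curveI[OF ac ab])
  have \<alpha>_mono: "\<alpha> u \<le> \<alpha> v" if "a \<le> u" "u \<le> v" "v \<le> b" for u v
    using timelike_curve_mono[OF tl that] by (simp add: \<alpha>_def)
  have \<alpha>aI: "\<alpha> a \<in> I" and \<alpha>bI: "\<alpha> b \<in> I" using \<alpha>I ab by auto
  obtain \<rho> where \<rho>: "\<rho> > 0" "cball (\<alpha> a) \<rho> \<subseteq> I"
    using open_I \<alpha>aI unfolding open_contains_cball by blast
  define l where "l = \<alpha> a - \<rho>"
  have "l \<in> cball (\<alpha> a) \<rho>" using \<rho>(1) by (simp add: l_def dist_real_def)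
  then have lI: "l \<in> I" using \<rho>(2) by blast
  have JI: "{l..\<alpha> b} \<subseteq> I" by (rule interval_subset[OF lI \<alpha>bI])
  have \<alpha>J: "\<alpha> t \<in> {l..\<alpha> b}" if "t \<in> {a..b}" for t
    using \<alpha>_mono[of a t] \<alpha>_mono[of t b] that \<rho>(1) by (auto simp: l_def)
  have \<beta>_cont: "continuous_on {a..b} \<beta>" by (rule abs_continuous_imp_continuous[OF \<alpha>aI ac[OF \<alpha>aI]])
  have \<alpha>_cont: "continuous_on {a..b} \<alpha>" by (rule abs_continuous_imp_continuous_on[OF ac_\<alpha>])
  have K: "compact (\<beta> ` {a..b})" by (rule compact_continuous_image[OF \<beta>_cont]) simp
  obtain C1 where C1: "C1 > 0" "speed_ratio_bound C1 {l..\<alpha> b} (\<beta> ` {a..b})"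
    by (rule gen_metric_speed_ratio_bound[OF compact_Icc JI K])
  obtain C2 where C2: "C2 > 0"
    "\<forall>s\<in>{l..\<alpha> b}. \<forall>s'\<in>{l..\<alpha> b}. \<forall>x\<in>\<beta> ` {a..b}. h (s, x) \<le> exp (C2 * \<bar>s - s'\<bar>) * h (s', x)"
    by (rule h_ratio_bound[OF compact_Icc JI K])
  define L where "L = C1 + C2"
  have L: "L > 0" using C1 C2 by (simp add: L_def)
  define R where "R t = (if t \<in> {a<..<b} then real_of_ereal (gen_metric_speed d \<beta> (\<alpha> t) t) else 0)" for t
  have R_meas: "R \<in> borel_measurable (lebesgue_on {a..b})"
    unfolding R_def[abs_def]
    by (rule gen_metric_speed_along_measurable[OF lI \<alpha>bI ac ab \<alpha>_cont \<alpha>J])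
  define H where "H t = h (\<alpha> t, \<beta> t)" for t
  have H_pos: "H t > 0" if "t \<in> {a..b}" for t using h_pos[OF \<alpha>I[OF that]] by (simp add: H_def)
  have "continuous_on {a..b} H"
    unfolding H_def[abs_def]
    by (rule continuous_on_compose2[OF continuous_h])
      (use \<alpha>I in \<open>auto intro!: continuous_intros \<alpha>_cont \<beta>_cont\<close>)
  then have H_meas: "H \<in> borel_measurable (lebesgue_on {a..b})"
    by (rule continuous_imp_measurable_on_sets_lebesgue) simp
  have \<alpha>_meas: "\<alpha> \<in> borel_measurable (lebesgue_on {a..b})"
    using \<alpha>_cont by (rule continuous_imp_measurable_on_sets_lebesgue) simp
  have f_abs: "(\<lambda>t. \<bar>f t\<bar>) integrable_on {a..b}" and f_int: "f integrable_on {a..b}"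
    using f(1) by (simp_all add: absolutely_integrable_on_def)
  have f_meas: "f \<in> borel_measurable (lebesgue_on {a..b})"
    using f_int by (rule integrable_imp_measurable)
  define B where "B = exp (2 * L * \<alpha> b)"
  have B: "B > 0" by (simp add: B_def)
  \<comment> \<open>Clipping to \<open>[0, B \<bar>f\<bar>]\<close> changes nothing almost everywhere and makes the function integrable.\<close>
  define k where "k t = max 0 (min (exp (2 * L * \<alpha> t) * (f t - R t / H t)) (B * \<bar>f t\<bar>))" for t
  have k_bounds: "0 \<le> k t" "k t \<le> B * \<bar>f t\<bar>" for t using B by (auto simp: k_def)
  have k_int: "k integrable_on {a..b}"
  proof (rule measurable_bounded_by_integrable_imp_integrable)
    show "k \<in> borel_measurable (lebesgue_on {a..b})"
      unfolding k_def[abs_def] using \<alpha>_meas f_meas R_meas H_meas by measurable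
    show "(\<lambda>t. B * \<bar>f t\<bar>) integrable_on {a..b}" using f_abs by (rule integrable_on_mult_right)
    show "norm (k t) \<le> B * \<bar>f t\<bar>" for t using k_bounds[of t] by simp
  qed auto
  define u where "u t = integral {a..t} k" for t
  have u_diff: "u y - u x = integral {x..y} k" if "a \<le> x" "x \<le> y" "y \<le> b" for x y
  proof -
    have "k integrable_on {a..y}" by (rule integrable_on_subinterval[OF k_int]) (use that in auto)
    then show ?thesis
      using Henstock_Kurzweil_Integration.integral_combine[of a x y k] that by (simp add: u_def)
  qed
  have AE_f: "AE t in lebesgue. t \<in> {a<..<b} \<longrightarrow> \<bar>f t\<bar> = f t" using f(3) by eventually_elim auto
  obtain N where N: "negligible N" "\<And>t. t \<in> {a..b} - N \<Longrightarrow> \<bar>f t\<bar> = f t"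
    using AE_interval_negligible[OF AE_f] by blast
  have f_abs_int: "((\<lambda>t. \<bar>f t\<bar>) has_integral (\<alpha> y - \<alpha> x)) {x..y}" if "a \<le> x" "x \<le> y" "y \<le> b" for x y
    by (rule has_integral_spike[OF N(1) _ f(2)[OF that]]) (use N(2) that in auto)
  have u_inc: "0 \<le> u y - u x" "u y - u x \<le> B * (\<alpha> y - \<alpha> x)" if xy: "a \<le> x" "x \<le> y" "y \<le> b" for x y
  proof -
    have kxy: "k integrable_on {x..y}" by (rule integrable_on_subinterval[OF k_int]) (use xy in auto)
    show "0 \<le> u y - u x" unfolding u_diff[OF xy] using k_bounds by (intro integral_nonneg kxy) auto
    have "integral {x..y} k \<le> B * (\<alpha> y - \<alpha> x)"
      using has_integral_le[OF integrable_integral[OF kxy] has_integral_mult_right[OF f_abs_int[OF xy], of B]]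
        k_bounds by simp
    then show "u y - u x \<le> B * (\<alpha> y - \<alpha> x)" using u_diff[OF xy] by simp
  qed
  have ua: "u a = 0" by (simp add: u_def)
  have u_nonneg: "0 \<le> u t" "u t \<le> u b" if "t \<in> {a..b}" for t
    using u_inc(1)[of a t] u_inc(1)[of t b] that ua by auto
  define E where "E = exp (- 2 * L * \<alpha> a)"
  have E: "E > 0" by (simp add: E_def)
  have E_ge: "exp (- 2 * L * \<alpha> t) \<le> E" if "t \<in> {a..b}" for t
    using \<alpha>_mono[of a t] that L by (simp add: E_def)
  define w where "w t = exp (- 2 * L * \<alpha> t) * u t" for t
  have w: "0 \<le> w t" "w t \<le> E * u b" if "t \<in> {a..b}" for t
    using u_nonneg[OF that] E_ge[OF that] E unfolding w_def by (auto intro!: mult_mono)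
  define W where "W = E * u b"
  have W: "W \<ge> 0" using w[of a] ab by (auto simp: W_def)
  \<comment> \<open>Keeps the new times in \<open>{l..\<alpha> b}\<close>, and \<open>L \<epsilon> w \<le> 1\<close>, the range in which \<open>exp x \<le> 1 + 2 x\<close> is used.\<close>
  define \<epsilon> where "\<epsilon> = min (1 / 2) (min (\<rho> / (W + 1)) (1 / (L * W + 1)))"
  have \<epsilon>: "\<epsilon> > 0" "\<epsilon> < 1" using \<rho>(1) W L by (auto simp: \<epsilon>_def add_nonneg_pos)
  have \<epsilon>w: "0 \<le> \<epsilon> * w t" "\<epsilon> * w t \<le> \<rho>" "L * (\<epsilon> * w t) \<le> 1" if "t \<in> {a..b}" for t
  proof -
    show "0 \<le> \<epsilon> * w t" using \<epsilon> w[OF that] by simp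
    have le: "\<epsilon> * w t \<le> \<epsilon> * W" using \<epsilon> w(2)[OF that] by (intro mult_left_mono) (auto simp: W_def)
    have "\<epsilon> * W \<le> \<rho> / (W + 1) * W" using W by (intro mult_right_mono) (auto simp: \<epsilon>_def)
    also have "\<dots> \<le> \<rho>" using W \<rho>(1) by (simp add: field_simps)
    finally show "\<epsilon> * w t \<le> \<rho>" using le by linarith
    have "L * (\<epsilon> * w t) \<le> \<epsilon> * (L * W)" using mult_left_mono[OF le, of L] L by (simp add: mult_ac)
    also have "\<dots> \<le> 1 / (L * W + 1) * (L * W)" using W L by (intro mult_right_mono) (auto simp: \<epsilon>_def)
    also have "\<dots> \<le> 1"
    proof -
      have "0 < L * W + 1" using W L by (intro add_nonneg_pos mult_nonneg_nonneg) auto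
      then show ?thesis by (simp add: pos_divide_le_eq)
    qed
    finally show "L * (\<epsilon> * w t) \<le> 1" .
  qed
  define \<alpha>' where "\<alpha>' t = \<alpha> t - \<epsilon> * w t" for t
  have \<alpha>'J: "\<alpha>' t \<in> {l..\<alpha> b}" if "t \<in> {a..b}" for t
    using \<epsilon>w[OF that] \<alpha>_mono[of a t] \<alpha>_mono[of t b] that by (auto simp: \<alpha>'_def l_def)
  have w_lip: "\<bar>w y - w x\<bar> \<le> (E * B + u b * (2 * L * E)) * \<bar>\<alpha> y - \<alpha> x\<bar>"
    if xy: "a \<le> x" "x \<le> y" "y \<le> b" for x y
  proof -
    define D where "D = \<alpha> y - \<alpha> x"
    have D: "D \<ge> 0" using \<alpha>_mono[OF xy] by (simp add: D_def)
    have split: "w y - w x = exp (- 2 * L * \<alpha> y) * (u y - u x)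
        - u x * (exp (- 2 * L * \<alpha> x) - exp (- 2 * L * \<alpha> y))"
      by (simp add: w_def algebra_simps)
    have x: "x \<in> {a..b}" and y: "y \<in> {a..b}" using xy by auto
    have 1: "0 \<le> exp (- 2 * L * \<alpha> y) * (u y - u x)" "exp (- 2 * L * \<alpha> y) * (u y - u x) \<le> E * (B * D)"
      using u_inc[OF xy] E_ge[OF y] E B D unfolding D_def by (auto intro!: mult_mono)
    have "exp (- 2 * L * \<alpha> y) = exp (- 2 * L * \<alpha> x) * exp (- (2 * L * D))"
      by (simp add: D_def algebra_simps flip: exp_add)
    then have eq: "exp (- 2 * L * \<alpha> x) - exp (- 2 * L * \<alpha> y) = exp (- 2 * L * \<alpha> x) * (1 - exp (- (2 * L * D)))"
      by (simp add: algebra_simps)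
    have "1 - exp (- (2 * L * D)) \<le> 2 * L * D" using exp_ge_add_one_self[of "- (2 * L * D)"] by simp
    moreover have "0 \<le> 1 - exp (- (2 * L * D))" using L D by simp
    ultimately have 2: "0 \<le> exp (- 2 * L * \<alpha> x) - exp (- 2 * L * \<alpha> y)"
      "exp (- 2 * L * \<alpha> x) - exp (- 2 * L * \<alpha> y) \<le> E * (2 * L * D)"
      unfolding eq using E_ge[OF x] E by (auto intro!: mult_mono)
    have 3: "0 \<le> u x * (exp (- 2 * L * \<alpha> x) - exp (- 2 * L * \<alpha> y))"
      "u x * (exp (- 2 * L * \<alpha> x) - exp (- 2 * L * \<alpha> y)) \<le> u b * (E * (2 * L * D))"
      using 2 u_nonneg[OF x] by (auto intro!: mult_mono)
    have "\<bar>w y - w x\<bar> \<le> E * (B * D) + u b * (E * (2 * L * D))"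
      using split 1 3 by linarith
    also have "\<dots> = (E * B + u b * (2 * L * E)) * D" by (simp add: algebra_simps)
    finally show ?thesis using D by (simp add: D_def)
  qed
  have ac_\<alpha>': "abs_continuous_curve dist \<alpha>' a b"
  proof (rule abs_continuous_curve_dominated[OF ac_\<alpha> ac_\<alpha>, where d = dist and c = \<alpha>'
        and A = 1 and B = "\<epsilon> * (E * B + u b * (2 * L * E))"])
    show "0 \<le> \<epsilon> * (E * B + u b * (2 * L * E))"
      using \<epsilon> E B L u_nonneg[of a] ab by (intro mult_nonneg_nonneg add_nonneg_nonneg) auto
    show "dist (\<alpha>' x) (\<alpha>' y) \<le> 1 * dist (\<alpha> x) (\<alpha> y) + \<epsilon> * (E * B + u b * (2 * L * E)) * dist (\<alpha> x) (\<alpha> y)"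
      if xy: "a \<le> x" "x \<le> y" "y \<le> b" for x y
    proof -
      have "\<bar>\<alpha>' y - \<alpha>' x\<bar> \<le> \<bar>\<alpha> y - \<alpha> x\<bar> + \<epsilon> * \<bar>w y - w x\<bar>"
      proof -
        have "\<alpha>' y - \<alpha>' x = (\<alpha> y - \<alpha> x) - \<epsilon> * (w y - w x)" by (simp add: \<alpha>'_def algebra_simps)
        also have "\<bar>\<dots>\<bar> \<le> \<bar>\<alpha> y - \<alpha> x\<bar> + \<bar>\<epsilon> * (w y - w x)\<bar>" by linarith
        also have "\<bar>\<epsilon> * (w y - w x)\<bar> = \<epsilon> * \<bar>w y - w x\<bar>" using \<epsilon> by (simp add: abs_mult)
        finally show ?thesis .
      qed
      also have "\<epsilon> * \<bar>w y - w x\<bar> \<le> \<epsilon> * ((E * B + u b * (2 * L * E)) * \<bar>\<alpha> y - \<alpha> x\<bar>)"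
        using w_lip[OF xy] \<epsilon> by (intro mult_left_mono) auto
      finally show ?thesis by (simp add: dist_real_def abs_minus_commute mult.assoc)
    qed
  qed simp
  have good: "AE t in lebesgue. t \<in> {a<..<b} \<longrightarrow> (\<alpha> has_real_derivative f t) (at t) \<and>
      (u has_real_derivative k t) (at t) \<and> 0 < f t \<and> 0 \<le> R t / H t \<and> R t / H t < f t \<and>
      k t = exp (2 * L * \<alpha> t) * (f t - R t / H t) \<and> gen_metric_speed d \<beta> (\<alpha> t) t = ereal (R t)"
    using f(3) Lebesgue_differentiation[OF k_int]
  proof eventually_elim
    case (elim t)
    show ?case
    proof
      assume t: "t \<in> {a<..<b}"
      then have t': "t \<in> {a..b}" by auto
      have g: "(\<alpha> has_real_derivative f t) (at t)" "0 < f t"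
        "gen_metric_speed d \<beta> (\<alpha> t) t < ereal (H t * f t)"
        using elim(1) t by (auto simp: H_def)
      have u': "(u has_real_derivative k t) (at t)" using elim(2) t unfolding u_def[abs_def] by blast
      have nn: "0 \<le> gen_metric_speed d \<beta> (\<alpha> t) t" by (rule gen_metric_speed_nonneg[OF \<alpha>I[OF t'] t])
      have Rt: "R t = real_of_ereal (gen_metric_speed d \<beta> (\<alpha> t) t)" unfolding R_def by (rule if_P[OF t])
      have gR: "gen_metric_speed d \<beta> (\<alpha> t) t = ereal (R t)"
        using g(3) nn unfolding Rt by (cases "gen_metric_speed d \<beta> (\<alpha> t) t") auto
      have RH: "0 \<le> R t / H t" "R t / H t < f t"
        using g(3) nn H_pos[OF t'] unfolding gR by (auto simp: field_simps)
      have "exp (2 * L * \<alpha> t) * (f t - R t / H t) \<le> B * \<bar>f t\<bar>"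
        using RH \<alpha>_mono[of t b] t' L unfolding B_def by (intro mult_mono) auto
      moreover have "0 \<le> exp (2 * L * \<alpha> t) * (f t - R t / H t)" using RH by simp
      ultimately have "k t = exp (2 * L * \<alpha> t) * (f t - R t / H t)" by (simp add: k_def)
      then show "(\<alpha> has_real_derivative f t) (at t) \<and>
        (u has_real_derivative k t) (at t) \<and> 0 < f t \<and> 0 \<le> R t / H t \<and> R t / H t < f t \<and>
        k t = exp (2 * L * \<alpha> t) * (f t - R t / H t) \<and> gen_metric_speed d \<beta> (\<alpha> t) t = ereal (R t)"
        using g u' RH gR by blast
    qed
  qed
  have ub: "u b > 0"
  proof (rule ccontr)
    assume "\<not> u b > 0"
    then have zero: "u t = 0" if "t \<in> {a..b}" for t using u_nonneg[OF that] by simp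
    obtain t where t: "t \<in> {a<..<b}" "(u has_real_derivative k t) (at t)" "R t / H t < f t"
      "k t = exp (2 * L * \<alpha> t) * (f t - R t / H t)"
      by (rule AE_interval_ex[OF good ab]) blast
    have "((\<lambda>_. 0) has_real_derivative k t) (at t)"
      by (rule has_field_derivative_transform_within_open[OF t(2) open_greaterThanLessThan t(1)])
        (use zero in auto)
    then have "k t = 0" using DERIV_unique[OF _ DERIV_const] by blast
    then show False using t(3,4) by simp
  qed
  have "timelike_curve I h d (\<lambda>t. (\<alpha>' t, \<beta> t)) a b"
    unfolding timelike_curve_iff fst_conv snd_conv
  proof (intro conjI ballI ab ac_\<alpha>' ac)
    show "\<alpha>' t \<in> I" if "t \<in> {a..b}" for t using \<alpha>'J[OF that] JI by blast
    show "AE t in lebesgue. t \<in> {a<..<b} \<longrightarrow> (\<exists>D>0. (\<alpha>' has_real_derivative D) (at t) \<and>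
        gen_metric_speed d \<beta> (\<alpha>' t) t < ereal (h (\<alpha>' t, \<beta> t) * D))"
      using good
    proof eventually_elim
      case (elim t)
      show ?case
      proof
        assume t: "t \<in> {a<..<b}"
        then have t': "t \<in> {a..b}" by auto
        define r where "r = R t / H t"
        have g: "(\<alpha> has_real_derivative f t) (at t)" "(u has_real_derivative k t) (at t)" "0 < f t"
          "0 \<le> r" "r < f t" "k t = exp (2 * L * \<alpha> t) * (f t - r)"
          "gen_metric_speed d \<beta> (\<alpha> t) t = ereal (r * H t)"
          using elim t H_pos[OF t'] by (auto simp: r_def)
        define p where "p = \<epsilon> * w t"
        have p: "0 \<le> p" "L * p \<le> 1" using \<epsilon>w[OF t'] by (auto simp: p_def)
        define D where "D = f t - \<epsilon> * (f t - r) + 2 * L * p * f t"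
        have der: "(\<alpha>' has_real_derivative D) (at t)"
        proof -
          have der0: "((\<lambda>t. \<alpha> t - \<epsilon> * (exp (- 2 * L * \<alpha> t) * u t)) has_real_derivative
              f t - \<epsilon> * (exp (- 2 * L * \<alpha> t) * (- 2 * L * f t) * u t + k t * exp (- 2 * L * \<alpha> t))) (at t)"
            by (auto intro!: derivative_eq_intros g(1,2))
          have k: "k t * exp (- 2 * L * \<alpha> t) = f t - r"
            unfolding g(6) by (simp add: mult.commute mult.left_commute flip: exp_add)
          have D: "D = f t - \<epsilon> * (exp (- 2 * L * \<alpha> t) * (- 2 * L * f t) * u t + k t * exp (- 2 * L * \<alpha> t))"
            unfolding k by (simp add: D_def p_def w_def algebra_simps)
          have \<alpha>': "\<alpha>' = (\<lambda>t. \<alpha> t - \<epsilon> * (exp (- 2 * L * \<alpha> t) * u t))"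
            by (rule ext) (simp add: \<alpha>'_def w_def)
          show ?thesis unfolding D \<alpha>' by (rule der0)
        qed
        have gap: "(1 + 2 * (L * p)) * r < D"
        proof -
          have "D - (1 + 2 * (L * p)) * r = (f t - r) * ((1 - \<epsilon>) + 2 * (L * p))"
            by (simp add: D_def algebra_simps)
          moreover have "0 < (f t - r) * ((1 - \<epsilon>) + 2 * (L * p))"
            using g(5) \<epsilon>(2) L p by (intro mult_pos_pos add_pos_nonneg) auto
          ultimately show ?thesis by linarith
        qed
        have Dpos: "D > 0"
        proof -
          have "0 \<le> (1 + 2 * (L * p)) * r" using g(4) L p by (intro mult_nonneg_nonneg) auto
          with gap show ?thesis by linarith
        qed
        have \<alpha>'t: "\<alpha>' t \<in> {l..\<alpha> b}" and \<alpha>t: "\<alpha> t \<in> {l..\<alpha> b}" by (rule \<alpha>'J[OF t'], rule \<alpha>J[OF t'])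
        have dist_p: "\<bar>\<alpha>' t - \<alpha> t\<bar> = p" "\<bar>\<alpha> t - \<alpha>' t\<bar> = p" using p by (auto simp: \<alpha>'_def p_def)
        have sub: "\<beta> ` {a<..<b} \<subseteq> \<beta> ` {a..b}" by auto
        define H' where "H' = h (\<alpha>' t, \<beta> t)"
        have H': "H' > 0" using h_pos[of "\<alpha>' t" "\<beta> t"] \<alpha>'t JI by (auto simp: H'_def)
        have HH': "H t \<le> exp (C2 * p) * H'"
          using C2(2)[rule_format, OF \<alpha>t \<alpha>'t, of "\<beta> t"] t' by (simp add: H_def H'_def dist_p)
        have "gen_metric_speed d \<beta> (\<alpha>' t) t \<le> ereal (exp (C1 * p)) * gen_metric_speed d \<beta> (\<alpha> t) t"
          using speed_ratio_boundD[OF C1(2), of \<beta> a b a b t "\<alpha>' t" "\<alpha> t"] ac t \<alpha>'t \<alpha>t sub by (simp add: dist_p)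
        also have "\<dots> = ereal (exp (C1 * p) * (r * H t))" unfolding g(7) by simp
        also have "\<dots> \<le> ereal (exp (C1 * p) * (r * (exp (C2 * p) * H')))"
          using HH' g(4) by (auto intro!: mult_left_mono)
        also have "exp (C1 * p) * (r * (exp (C2 * p) * H')) = exp (L * p) * r * H'"
          by (simp add: L_def distrib_right exp_add)
        also have "ereal (exp (L * p) * r * H') \<le> ereal ((1 + 2 * (L * p)) * r * H')"
          using exp_le_one_add_double[of "L * p"] p L g(4) H' by (auto intro!: mult_right_mono)
        also have "\<dots> < ereal (H' * D)"
          using gap H' by (simp add: mult.commute)
        finally show "\<exists>D>0. (\<alpha>' has_real_derivative D) (at t) \<and>
            gen_metric_speed d \<beta> (\<alpha>' t) t < ereal (h (\<alpha>' t, \<beta> t) * D)"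
          using der Dpos unfolding H'_def by blast
      qed
    qed
  qed
  moreover have "\<alpha>' a = fst (\<gamma> a)" by (simp add: \<alpha>'_def w_def ua \<alpha>_def)
  moreover have "\<alpha>' b < fst (\<gamma> b)" using \<epsilon> ub by (simp add: \<alpha>'_def w_def \<alpha>_def)
  ultimately show ?thesis by (intro that[of \<alpha>']) (simp_all add: \<beta>_def)
qed

end

section \<open>Openness of chronological futures and pasts\<close>

context lipschitz_spacetime
begin

lemma timelike_curve_append:
  assumes tl1: "timelike_curve I h d \<gamma>1 a m" and tl2: "timelike_curve I h d \<gamma>2 m b" and eq: "\<gamma>1 m = \<gamma>2 m"
  shows "timelike_curve I h d (\<lambda>t. if t \<le> m then \<gamma>1 t else \<gamma>2 t) a b"
proof -
  define \<gamma> where "\<gamma> t = (if t \<le> m then \<gamma>1 t else \<gamma>2 t)" for t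
  have \<gamma>1: "\<gamma> t = \<gamma>1 t" if "t \<le> m" for t using that by (simp add: \<gamma>_def)
  have \<gamma>2: "\<gamma> t = \<gamma>2 t" if "m \<le> t" for t using that eq by (cases "t = m") (auto simp: \<gamma>_def)
  note t1 = tl1[unfolded timelike_curve_iff] and t2 = tl2[unfolded timelike_curve_iff]
  have am: "a < m" and mb: "m < b" using t1 t2 by auto
  define P where "P \<gamma> t \<longleftrightarrow> (\<exists>D>0. ((\<lambda>t. fst (\<gamma> t)) has_real_derivative D) (at t) \<and>
        gen_metric_speed d (\<lambda>t. snd (\<gamma> t)) (fst (\<gamma> t)) t < ereal (h (\<gamma> t) * D))"
    for \<gamma> :: "real \<Rightarrow> real \<times> 'a" and t
  have P_cong: "P \<gamma> t" if P: "P \<gamma>' t" and t: "t \<in> {x<..<y}" and same: "\<And>t. t \<in> {x<..<y} \<Longrightarrow> \<gamma> t = \<gamma>' t"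
    for \<gamma>' t x y
  proof -
    obtain D where D: "D > 0" "((\<lambda>t. fst (\<gamma>' t)) has_real_derivative D) (at t)"
      "gen_metric_speed d (\<lambda>t. snd (\<gamma>' t)) (fst (\<gamma>' t)) t < ereal (h (\<gamma>' t) * D)"
      using P unfolding P_def by blast
    have "((\<lambda>t. fst (\<gamma> t)) has_real_derivative D) (at t)"
      by (rule has_field_derivative_transform_within_open[OF D(2) open_greaterThanLessThan t]) (simp add: same)
    moreover have "gen_metric_speed d (\<lambda>t. snd (\<gamma> t)) s t = gen_metric_speed d (\<lambda>t. snd (\<gamma>' t)) s t" for s
      by (rule gen_metric_speed_cong[OF _ t]) (simp add: same)
    ultimately show ?thesis using D same[OF t] unfolding P_def by auto
  qed
  have "timelike_curve I h d \<gamma> a b"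
    unfolding timelike_curve_iff P_def[symmetric]
  proof (intro conjI ballI)
    show "a < b" using am mb by simp
    show "fst (\<gamma> t) \<in> I" if "t \<in> {a..b}" for t
      using t1 t2 that \<gamma>1[of t] \<gamma>2[of t] by (cases "t \<le> m") auto
    show "abs_continuous_curve dist (\<lambda>t. fst (\<gamma> t)) a b"
    proof (rule metric_on_type.abs_continuous_curve_append[OF metric_on_type_dist])
      show "abs_continuous_curve dist (\<lambda>t. fst (\<gamma> t)) a m"
        by (rule abs_continuous_curve_cong[of _ "\<lambda>t. fst (\<gamma>1 t)"]) (use t1 \<gamma>1 in auto)
      show "abs_continuous_curve dist (\<lambda>t. fst (\<gamma> t)) m b"
        by (rule abs_continuous_curve_cong[of _ "\<lambda>t. fst (\<gamma>2 t)"]) (use t2 \<gamma>2 in auto)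
    qed (use am mb in auto)
    show "abs_continuous_curve (d s) (\<lambda>t. snd (\<gamma> t)) a b" if "s \<in> I" for s
    proof (rule metric_on_type.abs_continuous_curve_append[OF metric_d[OF that]])
      show "abs_continuous_curve (d s) (\<lambda>t. snd (\<gamma> t)) a m"
        by (rule abs_continuous_curve_cong[of _ "\<lambda>t. snd (\<gamma>1 t)"]) (use t1 \<gamma>1 that in auto)
      show "abs_continuous_curve (d s) (\<lambda>t. snd (\<gamma> t)) m b"
        by (rule abs_continuous_curve_cong[of _ "\<lambda>t. snd (\<gamma>2 t)"]) (use t2 \<gamma>2 that in auto)
    qed (use am mb in auto)
    have "AE t in lebesgue. t \<in> {a<..<m} \<longrightarrow> P \<gamma>1 t" using t1 unfolding P_def by blast
    moreover have "AE t in lebesgue. t \<in> {m<..<b} \<longrightarrow> P \<gamma>2 t" using t2 unfolding P_def by blast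
    moreover have "AE t in lebesgue. t \<noteq> m"
      unfolding eventually_ae_filter_negligible by (intro exI[of _ "{m}"]) simp
    ultimately show "AE t in lebesgue. t \<in> {a<..<b} \<longrightarrow> P \<gamma> t"
    proof eventually_elim
      case (elim t)
      show ?case
      proof
        assume t: "t \<in> {a<..<b}"
        show "P \<gamma> t"
        proof (cases "t < m")
          case True
          then have tm: "t \<in> {a<..<m}" using t by simp
          show ?thesis by (rule P_cong[OF _ tm]) (use elim(1) tm \<gamma>1 in auto)
        next
          case False
          then have tm: "t \<in> {m<..<b}" using t elim(3) by simp
          show ?thesis by (rule P_cong[OF _ tm]) (use elim(2) tm \<gamma>2 in auto)
        qed
      qed
    qed
  qed
  then show ?thesis by (simp add: \<gamma>_def[abs_def])
qed

text \<open>
  The time component is affine and the spatial part \<open>B\<close>-Lipschitz for the metric with parameter \<open>s0\<close>;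
  changing this parameter to the time of the curve costs at most the factor \<open>exp (C * (s3 - s1))\<close>.
\<close>

lemma timelike_curve_affine:
  assumes "s1 \<in> I" "s3 \<in> I" "s1 < s2" "a < b" and s23: "s2 \<le> s3" and s0: "s0 \<in> {s1..s3}"
    and lip: "\<And>u v. a \<le> u \<Longrightarrow> u \<le> v \<Longrightarrow> v \<le> b \<Longrightarrow> d s0 (\<beta> u) (\<beta> v) \<le> B * (v - u)" "B \<ge> 0"
    and C: "C \<ge> 0" "\<And>t s s'. t \<in> {a<..<b} \<Longrightarrow> s \<in> {s1..s3} \<Longrightarrow> s' \<in> {s1..s3} \<Longrightarrow>
       (\<And>s. s \<in> I \<Longrightarrow> abs_continuous_curve (d s) \<beta> a b) \<Longrightarrow>
       gen_metric_speed d \<beta> s t \<le> ereal (exp (C * \<bar>s - s'\<bar>)) * gen_metric_speed d \<beta> s' t"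
    and slow: "\<And>t s. t \<in> {a<..<b} \<Longrightarrow> s \<in> {s1..s3} \<Longrightarrow>
       exp (C * (s3 - s1)) * B < h (s, \<beta> t) * ((s2 - s1) / (b - a))"
  shows "timelike_curve I h d (\<lambda>t. (s1 + (t - a) * ((s2 - s1) / (b - a)), \<beta> t)) a b"
proof -
  define k where "k = (s2 - s1) / (b - a)"
  have k: "k > 0" using assms(3,4) by (simp add: k_def)
  define \<alpha> where "\<alpha> t = s1 + (t - a) * k" for t
  have \<alpha>J: "\<alpha> t \<in> {s1..s3}" if "t \<in> {a..b}" for t
  proof -
    have "(t - a) * k \<le> (b - a) * k" using that k by (intro mult_right_mono) auto
    also have "\<dots> = s2 - s1" using assms(4) by (simp add: k_def)
    finally show ?thesis using that k s23 by (simp add: \<alpha>_def)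
  qed
  have JI: "{s1..s3} \<subseteq> I" by (rule interval_subset[OF assms(1,2)])
  then have s0I: "s0 \<in> I" using s0 by auto
  have "abs_continuous_curve (d s0) \<beta> a b"
    by (rule abs_continuous_curve_Lipschitz[OF lip(2)]) (rule lip(1))
  then have ac: "abs_continuous_curve (d s) \<beta> a b" if "s \<in> I" for s
    by (rule abs_continuous_change_metric[OF s0I that])
  interpret metric_family_curve d I \<beta> a b by (rule metric_family_curveI[OF ac assms(4)])
  interpret s0: metric_on_type "d s0" by (rule metric_d[OF s0I])
  have "timelike_curve I h d (\<lambda>t. (\<alpha> t, \<beta> t)) a b"
    unfolding timelike_curve_iff fst_conv snd_conv
  proof (intro conjI ballI assms(4) ac)
    show "\<alpha> t \<in> I" if "t \<in> {a..b}" for t using \<alpha>J[OF that] JI by blast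
    show "abs_continuous_curve dist \<alpha> a b"
    proof (rule abs_continuous_curve_Lipschitz[of k])
      show "dist (\<alpha> u) (\<alpha> v) \<le> k * (v - u)" if "a \<le> u" "u \<le> v" "v \<le> b" for u v
      proof -
        have "\<alpha> u - \<alpha> v = - (k * (v - u))" by (simp add: \<alpha>_def algebra_simps)
        then show ?thesis using that k by (simp add: dist_real_def)
      qed
    qed (use k in simp)
    show "AE t in lebesgue. t \<in> {a<..<b} \<longrightarrow> (\<exists>D>0. (\<alpha> has_real_derivative D) (at t) \<and>
        gen_metric_speed d \<beta> (\<alpha> t) t < ereal (h (\<alpha> t, \<beta> t) * D))"
      using s0.metric_speed_tendsto[OF ac[OF s0I] assms(4)] gen_metric_speed_AE[OF s0I]
    proof eventually_elim
      case (elim t)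
      show ?case
      proof
        assume t: "t \<in> {a<..<b}"
        then have t': "t \<in> {a..b}" by auto
        have "eventually (\<lambda>u. u \<in> {a<..<b}) (at t)"
          using t by (intro eventually_at_in_open') auto
        moreover have "eventually (\<lambda>u. u \<noteq> t) (at t)" by (simp add: eventually_at_filter)
        ultimately have "eventually (\<lambda>u. d s0 (\<beta> u) (\<beta> t) / \<bar>u - t\<bar> \<le> B) (at t)"
        proof eventually_elim
          case (elim u)
          have "d s0 (\<beta> u) (\<beta> t) \<le> B * \<bar>u - t\<bar>"
            using lip(1)[of u t] lip(1)[of t u] elim t s0.commute[of "\<beta> u" "\<beta> t"]
            by (cases "u \<le> t") auto
          then show ?case using elim by (simp add: pos_divide_le_eq)
        qed
        then have "metric_speed (d s0) \<beta> t \<le> B"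
          using elim(1) t by (intro tendsto_upperbound[of _ "metric_speed (d s0) \<beta> t" "at t"]) auto
        then have g0: "gen_metric_speed d \<beta> s0 t \<le> ereal B" using elim(2) t by simp
        have "gen_metric_speed d \<beta> (\<alpha> t) t
            \<le> ereal (exp (C * \<bar>\<alpha> t - s0\<bar>)) * gen_metric_speed d \<beta> s0 t"
          by (rule C(2)[OF t \<alpha>J[OF t'] s0 ac])
        also have "\<dots> \<le> ereal (exp (C * \<bar>\<alpha> t - s0\<bar>)) * ereal B"
          using g0 by (intro ereal_mult_left_mono) auto
        also have "\<dots> = ereal (exp (C * \<bar>\<alpha> t - s0\<bar>) * B)" by simp
        also have "\<dots> \<le> ereal (exp (C * (s3 - s1)) * B)"
        proof -
          have "\<bar>\<alpha> t - s0\<bar> \<le> s3 - s1" using \<alpha>J[OF t'] s0 by auto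
          then show ?thesis using C(1) lip(2) by (auto intro!: mult_right_mono mult_left_mono)
        qed
        also have "\<dots> < ereal (h (\<alpha> t, \<beta> t) * k)"
          using slow[OF t \<alpha>J[OF t']] by (simp add: k_def)
        finally have "gen_metric_speed d \<beta> (\<alpha> t) t < ereal (h (\<alpha> t, \<beta> t) * k)" .
        moreover have "(\<alpha> has_real_derivative k) (at t)"
          unfolding \<alpha>_def[abs_def] by (auto intro!: derivative_eq_intros)
        ultimately show "\<exists>D>0. (\<alpha> has_real_derivative D) (at t) \<and>
            gen_metric_speed d \<beta> (\<alpha> t) t < ereal (h (\<alpha> t, \<beta> t) * D)"
          using k by blast
      qed
    qed
  qed
  then show ?thesis by (simp add: \<alpha>_def[abs_def] k_def)
qed

text \<open>
  A timelike curve to \<open>z\<close> may be arbitrarily close to lightlike at its end. But the same spatial point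
  can also be reached strictly earlier, and the time gained suffices to go on along a short curve to any
  spatial point near that of \<open>z\<close> and to arrive there at any time near that of \<open>z\<close>.
\<close>

lemma chron_future_open:
  assumes "chron I h d p z"
  obtains S where "open S" "z \<in> S" "\<And>z'. z' \<in> S \<Longrightarrow> fst z' \<in> I \<and> chron I h d p z'"
proof -
  obtain \<gamma> a b where \<gamma>: "timelike_curve I h d \<gamma> a b" "\<gamma> a = p" "\<gamma> b = z"
    using assms unfolding chron_def by blast
  obtain \<alpha> where \<alpha>: "timelike_curve I h d (\<lambda>t. (\<alpha> t, snd (\<gamma> t))) a b" "\<alpha> a = fst (\<gamma> a)" "\<alpha> b < fst (\<gamma> b)"
    by (rule timelike_curve_arrive_earlier[OF \<gamma>(1)])
  have ab: "a < b" using \<gamma>(1) by (simp add: timelike_curve_iff)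
  define \<gamma>1 where "\<gamma>1 t = (\<alpha> t, snd (\<gamma> t))" for t
  have \<gamma>1: "timelike_curve I h d \<gamma>1 a b" using \<alpha>(1) by (simp add: \<gamma>1_def[abs_def])
  define s1 s0 x0 where "s1 = \<alpha> b" and "s0 = fst z" and "x0 = snd z"
  have \<gamma>1_ends: "\<gamma>1 a = p" "\<gamma>1 b = (s1, x0)"
    using \<alpha>(2) \<gamma>(2,3) by (auto simp: \<gamma>1_def s1_def x0_def)
  have s1I: "s1 \<in> I" using \<gamma>1 ab unfolding timelike_curve_iff \<gamma>1_def by (auto simp: s1_def)
  have s0I: "s0 \<in> I" using \<gamma>(1,3) ab unfolding timelike_curve_iff by (auto simp: s0_def)
  have s10: "s1 < s0" using \<alpha>(3) \<gamma>(3) by (simp add: s1_def s0_def)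
  obtain \<eta> where \<eta>: "\<eta> > 0" "cball s0 \<eta> \<subseteq> I"
    using open_I s0I unfolding open_contains_cball by blast
  have "s0 + \<eta> \<in> cball s0 \<eta>" using \<eta>(1) by (simp add: dist_real_def)
  then have topI: "s0 + \<eta> \<in> I" using \<eta>(2) by blast
  have JI: "{s1..s0 + \<eta>} \<subseteq> I" by (rule interval_subset[OF s1I topI])
  obtain U K where U: "open U" "x0 \<in> U" "U \<subseteq> K" and K: "compact K"
    by (rule compact_neighbourhood)
  obtain C where C: "C > 0" "speed_ratio_bound C {s1..s0 + \<eta>} K"
    by (rule gen_metric_speed_ratio_bound[OF compact_Icc JI K])
  have "continuous_on ({s1..s0 + \<eta>} \<times> K) h"
    by (rule continuous_on_subset[OF continuous_h]) (use JI in auto)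
  moreover have "compact ({s1..s0 + \<eta>} \<times> K)" by (intro compact_Times compact_Icc K)
  moreover have "(s0, x0) \<in> {s1..s0 + \<eta>} \<times> K" using s10 \<eta>(1) U by auto
  ultimately obtain q where q: "q \<in> {s1..s0 + \<eta>} \<times> K" "\<forall>y\<in>{s1..s0 + \<eta>} \<times> K. h q \<le> h y"
    using continuous_attains_inf by blast
  define h0 where "h0 = h q"
  have h0: "h0 > 0" "\<And>s x. s \<in> {s1..s0 + \<eta>} \<Longrightarrow> x \<in> K \<Longrightarrow> h0 \<le> h (s, x)"
    using q JI h_pos by (cases q; auto simp: h0_def)+
  interpret s0: metric_on_type "d s0" by (rule metric_d[OF s0I])
  obtain e1 where e1: "e1 > 0" "{y. length_metric (d s0) x0 y < ennreal e1} \<subseteq> U"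
    using length_topology[OF s0I] U(1,2) unfolding generates_topology_def by blast
  \<comment> \<open>For curves shorter than \<open>e2\<close> the speed stays below \<open>h0\<close> times half of the time gained.\<close>
  define e2 where "e2 = min e1 (h0 * ((s0 - s1) / 2) / exp (C * (s0 + \<eta> - s1)))"
  have e2: "e2 > 0" using e1(1) h0(1) s10 by (simp add: e2_def)
  define V where "V = {y. \<exists>L c. s0.short_curve L c x0 y \<and> L < e2}"
  have "open V" unfolding V_def by (rule open_short_curve_ball[OF metric_d[OF s0I] length_topology[OF s0I]])
  have "s0.short_curve 0 (\<lambda>_. x0) x0 x0" unfolding s0.short_curve_def by auto
  then have "x0 \<in> V" unfolding V_def using e2 by blast
  have VU: "y \<in> U" if "s0.short_curve L c x0 y" "L < e2" for y L c
  proof -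
    have "length_metric (d s0) x0 y \<le> ennreal L" by (rule s0.length_metric_le_short_curve[OF that(1)])
    also have "\<dots> < ennreal e1" using that e1(1) by (intro ennreal_lessI) (auto simp: e2_def)
    finally show ?thesis using e1(2) by blast
  qed
  \<comment> \<open>After the midpoint of \<open>s1\<close> and \<open>s0\<close>, at least half of the time gained is still available.\<close>
  define T where "T = {max (s0 - \<eta>) ((s0 + s1) / 2)<..<s0 + \<eta>}"
  have T: "s0 \<in> T" "\<And>s. s \<in> T \<Longrightarrow> s \<in> I \<and> (s0 + s1) / 2 < s \<and> s < s0 + \<eta>"
    using s10 \<eta>(1) JI by (auto simp: T_def)
  have reach: "chron I h d p (s, y)" if s: "s \<in> T" and y: "y \<in> V" for s y
  proof -
    obtain L c where c: "s0.short_curve L c x0 y" "L < e2" using y unfolding V_def by blast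
    have L: "0 \<le> L" and ends: "c 0 = x0" "c L = y" using c(1) by (auto simp: s0.short_curve_def)
    have sT: "s \<in> I" "(s0 + s1) / 2 < s" "s < s0 + \<eta>" using T(2)[OF s] by auto
    have "s1 < (s0 + s1) / 2" using s10 by (simp add: field_simps)
    then have s1s: "s1 < s" using sT(2) by (rule less_trans)
    define s2 where "s2 = s0 + \<eta>"
    define \<beta> where "\<beta> t = c (L * (t - b))" for t
    have par: "0 \<le> L * (t - b) \<and> L * (t - b) \<le> L" if "t \<in> {b..b + 1}" for t
      using L that mult_left_mono[of "t - b" 1 L] by auto
    have \<beta>K: "\<beta> t \<in> K" if "t \<in> {b..b + 1}" for t
      using VU[OF s0.short_curve_initial[OF c(1), of "L * (t - b)"]] par[OF that] c(2) U(3)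
      by (auto simp: \<beta>_def)
    have \<beta>_lip: "d s0 (\<beta> u) (\<beta> v) \<le> L * (v - u)" if "b \<le> u" "u \<le> v" "v \<le> b + 1" for u v
    proof -
      have "d s0 (\<beta> u) (\<beta> v) \<le> L * (v - b) - L * (u - b)"
        unfolding \<beta>_def using par[of u] par[of v] L that
        by (intro s0.short_curveD[OF c(1)] mult_left_mono) auto
      then show ?thesis by (simp add: algebra_simps)
    qed
    have sJ: "{s1..s} \<subseteq> {s1..s0 + \<eta>}" using sT by auto
    have tl2: "timelike_curve I h d (\<lambda>t. (s1 + (t - b) * ((s - s1) / ((b + 1) - b)), \<beta> t)) b (b + 1)"
    proof (rule timelike_curve_affine[OF s1I topI s1s, where B = L and C = C])
      show "b < b + 1" "s \<le> s0 + \<eta>" "0 \<le> L" "0 \<le> C" using sT L C(1) by auto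
      show "s0 \<in> {s1..s0 + \<eta>}" using s10 \<eta>(1) by auto
      show "d s0 (\<beta> u) (\<beta> v) \<le> L * (v - u)" if "b \<le> u" "u \<le> v" "v \<le> b + 1" for u v
        by (rule \<beta>_lip[OF that])
      have "\<beta> ` {b<..<b + 1} \<subseteq> K" using \<beta>K by auto
      then show "gen_metric_speed d \<beta> r t \<le> ereal (exp (C * \<bar>r - r'\<bar>)) * gen_metric_speed d \<beta> r' t"
        if "t \<in> {b<..<b + 1}" "r \<in> {s1..s0 + \<eta>}" "r' \<in> {s1..s0 + \<eta>}"
          "\<And>s. s \<in> I \<Longrightarrow> abs_continuous_curve (d s) \<beta> b (b + 1)" for t r r'
        using speed_ratio_boundD[OF C(2), of \<beta> b "b + 1" b "b + 1" t r r'] that by auto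
      show "exp (C * (s0 + \<eta> - s1)) * L < h (r, \<beta> t) * ((s - s1) / (b + 1 - b))"
        if "t \<in> {b<..<b + 1}" "r \<in> {s1..s0 + \<eta>}" for t r
      proof -
        have "L < h0 * ((s0 - s1) / 2) / exp (C * (s0 + \<eta> - s1))" using c(2) by (simp add: e2_def)
        then have "exp (C * (s0 + \<eta> - s1)) * L < h0 * ((s0 - s1) / 2)"
          by (simp add: pos_less_divide_eq mult.commute)
        also have "\<dots> \<le> h (r, \<beta> t) * (s - s1)"
          using h0(1) h0(2)[OF that(2) \<beta>K[of t]] that(1) sT(2) s10 by (intro mult_mono) auto
        finally show ?thesis by simp
      qed
    qed
    have "timelike_curve I h d (\<lambda>t. if t \<le> b then \<gamma>1 t else
        (s1 + (t - b) * ((s - s1) / ((b + 1) - b)), \<beta> t)) a (b + 1)"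
      by (rule timelike_curve_append[OF \<gamma>1 tl2]) (simp add: \<gamma>1_ends \<beta>_def ends)
    then show ?thesis
      unfolding chron_def using ab \<gamma>1_ends(1)
      by (intro exI[of _ "\<lambda>t. if t \<le> b then \<gamma>1 t else
        (s1 + (t - b) * ((s - s1) / ((b + 1) - b)), \<beta> t)"] exI[of _ a] exI[of _ "b + 1"])
        (simp add: \<beta>_def ends)
  qed
  show ?thesis
  proof (rule that[of "T \<times> V"])
    show "open (T \<times> V)" using \<open>open V\<close> by (intro open_Times) (simp add: T_def)
    show "z \<in> T \<times> V" using T(1) \<open>x0 \<in> V\<close> by (simp add: s0_def x0_def mem_Times_iff)
    show "fst z' \<in> I \<and> chron I h d p z'" if "z' \<in> T \<times> V" for z'
      using that T(2) reach by (cases z') auto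
  qed
qed

end

section \<open>Time reversal\<close>

text \<open>
  Reversing time exchanges futures and pasts, and the hypotheses are invariant under it; so openness of
  pasts is openness of futures in the reversed spacetime.
\<close>

definition reverse_time :: "real \<times> 'a \<Rightarrow> real \<times> 'a" where
  "reverse_time p = (- fst p, snd p)"

lemma reverse_time_involution [simp]: "reverse_time (reverse_time p) = p"
  by (simp add: reverse_time_def)

lemma (in lipschitz_spacetime) lipschitz_spacetime_reverse:
  "lipschitz_spacetime (uminus ` I) (\<lambda>p. h (reverse_time p)) (\<lambda>s. d (- s))"
proof (rule lipschitz_spacetime.intro)
  show "locally_compact_space (euclidean :: 'a topology)" by (rule locally_compact)
  show "open (uminus ` I)" by (rule open_negations[OF open_I])
  show "is_interval (uminus ` I)" using interval_I by simp
  show "continuous_on (uminus ` I \<times> UNIV) (\<lambda>p. h (reverse_time p))"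
    unfolding reverse_time_def
    by (rule continuous_on_compose2[OF continuous_h]) (auto intro!: continuous_intros)
  show "0 < h (reverse_time (s, x))" if "s \<in> uminus ` I" for s x
    using that h_pos by (auto simp: reverse_time_def)
  show "Metric_space UNIV (d (- s))" if "s \<in> uminus ` I" for s
    using that metric_family by auto
  show "generates_topology (length_metric (d (- s)))" if "s \<in> uminus ` I" for s
    using that length_topology by auto
  fix J :: "real set" and K :: "'a set" assume J: "compact J" "J \<subseteq> uminus ` I" and K: "compact K"
  have J': "compact (uminus ` J)" "uminus ` J \<subseteq> I"
    using compact_negations[OF J(1)] J(2) by auto
  have INF_eq: "(INF u\<in>uminus ` J. d u x y) = (INF u\<in>J. d (- u) x y)" for x y
    by (simp add: image_image)
  obtain C r where C: "C > 0" "r > 0" "\<forall>s\<in>uminus ` J. \<forall>s'\<in>uminus ` J. \<forall>x\<in>K. \<forall>y\<in>K.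
      x \<noteq> y \<and> (INF u\<in>uminus ` J. d u x y) < r \<longrightarrow> \<bar>ln (d s x y / d s' x y)\<bar> \<le> C * \<bar>s - s'\<bar>"
    using log_Lipschitz[OF J' K] by (elim exE conjE) (rule that)
  have "\<bar>ln (d (- s) x y / d (- s') x y)\<bar> \<le> C * \<bar>s - s'\<bar>"
    if "s \<in> J" "s' \<in> J" "x \<in> K" "y \<in> K" "x \<noteq> y \<and> (INF u\<in>J. d (- u) x y) < r" for s s' x y
    using C(3)[rule_format, of "- s" "- s'" x y] that unfolding INF_eq by (simp add: abs_minus_commute)
  with C(1,2) show "\<exists>C>0. \<exists>r>0. \<forall>s\<in>J. \<forall>s'\<in>J. \<forall>x\<in>K. \<forall>y\<in>K.
      x \<noteq> y \<and> (INF u\<in>J. d (- u) x y) < r \<longrightarrow> \<bar>ln (d (- s) x y / d (- s') x y)\<bar> \<le> C * \<bar>s - s'\<bar>"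
    by (intro exI[of _ C] exI[of _ r] conjI ballI impI) simp_all
  obtain C' where C': "C' > 0"
    "\<forall>s\<in>uminus ` J. \<forall>s'\<in>uminus ` J. \<forall>x\<in>K. \<bar>h (s, x) - h (s', x)\<bar> \<le> C' * \<bar>s - s'\<bar>"
    using h_Lipschitz[OF J' K] by (elim exE conjE) (rule that)
  have "\<bar>h (reverse_time (s, x)) - h (reverse_time (s', x))\<bar> \<le> C' * \<bar>s - s'\<bar>"
    if "s \<in> J" "s' \<in> J" "x \<in> K" for s s' x
    using C'(2)[rule_format, of "- s" "- s'" x] that by (simp add: reverse_time_def abs_minus_commute)
  with C'(1) show "\<exists>C'>0. \<forall>s\<in>J. \<forall>s'\<in>J. \<forall>x\<in>K.
      \<bar>h (reverse_time (s, x)) - h (reverse_time (s', x))\<bar> \<le> C' * \<bar>s - s'\<bar>"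
    by blast
qed

lemma AE_lebesgue_uminus:
  assumes "AE t in lebesgue. P (t :: real)"
  shows "AE t in lebesgue. P (- t)"
proof -
  obtain N where N: "negligible N" "{t. \<not> P t} \<subseteq> N"
    using assms unfolding eventually_ae_filter_negligible by blast
  have "{t. \<not> P (- t)} \<subseteq> uminus ` N"
  proof
    fix t assume "t \<in> {t. \<not> P (- t)}"
    then have "- t \<in> N" using N(2) by blast
    then show "t \<in> uminus ` N" by (rule rev_image_eqI) simp
  qed
  then show ?thesis
    unfolding eventually_ae_filter_negligible using negligible_uminus[OF N(1)] by blast
qed

lemma (in lipschitz_spacetime) chron_reverse:
  assumes "chron I h d p q"
  shows "chron (uminus ` I) (\<lambda>p. h (reverse_time p)) (\<lambda>s. d (- s)) (reverse_time q) (reverse_time p)"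
proof -
  obtain \<gamma> a b where \<gamma>: "timelike_curve I h d \<gamma> a b" "\<gamma> a = p" "\<gamma> b = q"
    using assms unfolding chron_def by blast
  note tl = \<gamma>(1)[unfolded timelike_curve_iff]
  define \<gamma>' where "\<gamma>' t = reverse_time (\<gamma> (- t))" for t
  have \<gamma>': "fst (\<gamma>' t) = - fst (\<gamma> (- t))" "snd (\<gamma>' t) = snd (\<gamma> (- t))" "reverse_time (\<gamma>' t) = \<gamma> (- t)" for t
    by (simp_all add: \<gamma>'_def) (simp_all add: reverse_time_def)
  have "timelike_curve (uminus ` I) (\<lambda>p. h (reverse_time p)) (\<lambda>s. d (- s)) \<gamma>' (- b) (- a)"
    unfolding lipschitz_spacetime.timelike_curve_iff[OF lipschitz_spacetime_reverse] \<gamma>'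
  proof (intro conjI ballI)
    show "- b < - a" using tl by simp
    show "- fst (\<gamma> (- t)) \<in> uminus ` I" if "t \<in> {- b..- a}" for t
      using tl that by (intro imageI) auto
    have rev: "abs_continuous_curve dist (\<lambda>t. fst (\<gamma> (- t))) (- b) (- a)"
      using tl by (intro abs_continuous_curve_reverse[of dist "\<lambda>t. fst (\<gamma> t)"]) (auto simp: dist_commute)
    show "abs_continuous_curve dist (\<lambda>t. - fst (\<gamma> (- t))) (- b) (- a)"
      by (rule abs_continuous_curve_dominated[OF rev rev, where A = 1 and B = 0]) (simp_all add: dist_minus)
    show "abs_continuous_curve (d (- s)) (\<lambda>t. snd (\<gamma> (- t))) (- b) (- a)" if "s \<in> uminus ` I" for s
    proof -
      have sI: "- s \<in> I" using that by auto
      interpret metric_on_type "d (- s)" by (rule metric_d[OF sI])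
      show ?thesis
        using tl sI by (intro abs_continuous_curve_reverse[of "d (- s)" "\<lambda>t. snd (\<gamma> t)"] commute) auto
    qed
    have "AE t in lebesgue. - t \<in> {a<..<b} \<longrightarrow> (\<exists>D>0. ((\<lambda>t. fst (\<gamma> t)) has_real_derivative D) (at (- t)) \<and>
        gen_metric_speed d (\<lambda>t. snd (\<gamma> t)) (fst (\<gamma> (- t))) (- t) < ereal (h (\<gamma> (- t)) * D))"
      using tl by (intro AE_lebesgue_uminus[where P = "\<lambda>t. t \<in> {a<..<b} \<longrightarrow> (\<exists>D>0. ((\<lambda>t. fst (\<gamma> t)) has_real_derivative D) (at t) \<and>
        gen_metric_speed d (\<lambda>t. snd (\<gamma> t)) (fst (\<gamma> t)) t < ereal (h (\<gamma> t) * D))"]) blast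
    then show "AE t in lebesgue. t \<in> {- b<..<- a} \<longrightarrow> (\<exists>D>0. ((\<lambda>t. - fst (\<gamma> (- t))) has_real_derivative D) (at t) \<and>
        gen_metric_speed (\<lambda>s. d (- s)) (\<lambda>t. snd (\<gamma> (- t))) (- fst (\<gamma> (- t))) t < ereal (h (\<gamma> (- t)) * D))"
    proof eventually_elim
      case (elim t)
      show ?case
      proof
        assume "t \<in> {- b<..<- a}"
        then have "- t \<in> {a<..<b}" by auto
        with elim obtain D where D: "D > 0" "((\<lambda>t. fst (\<gamma> t)) has_real_derivative D) (at (- t))"
          "gen_metric_speed d (\<lambda>t. snd (\<gamma> t)) (fst (\<gamma> (- t))) (- t) < ereal (h (\<gamma> (- t)) * D)"
          by blast
        have "((\<lambda>t. - fst (\<gamma> (- t))) has_real_derivative D) (at t)"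
          using DERIV_minus[OF DERIV_mirror[THEN iffD1, OF D(2)]] by simp
        moreover have "gen_metric_speed (\<lambda>s. d (- s)) (\<lambda>t. snd (\<gamma> (- t))) (- fst (\<gamma> (- t))) t
            = gen_metric_speed d (\<lambda>t. snd (\<gamma> t)) (fst (\<gamma> (- t))) (- t)"
          using gen_metric_speed_reflect[of d "\<lambda>t. snd (\<gamma> t)" "- fst (\<gamma> (- t))" t] by simp
        ultimately show "\<exists>D>0. ((\<lambda>t. - fst (\<gamma> (- t))) has_real_derivative D) (at t) \<and>
          gen_metric_speed (\<lambda>s. d (- s)) (\<lambda>t. snd (\<gamma> (- t))) (- fst (\<gamma> (- t))) t < ereal (h (\<gamma> (- t)) * D)"
          using D(1,3) by auto
      qed
    qed
  qed
  moreover have "\<gamma>' (- b) = reverse_time q" "\<gamma>' (- a) = reverse_time p"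
    using \<gamma> by (simp_all add: \<gamma>'_def)
  ultimately show ?thesis unfolding chron_def by blast
qed

context lipschitz_spacetime
begin

lemma chron_past_open:
  assumes "chron I h d z q"
  obtains S where "open S" "z \<in> S" "\<And>z'. z' \<in> S \<Longrightarrow> chron I h d z' q"
proof -
  interpret rev: lipschitz_spacetime "uminus ` I" "\<lambda>p. h (reverse_time p)" "\<lambda>s. d (- s)"
    by (rule lipschitz_spacetime_reverse)
  obtain S where S: "open S" "reverse_time z \<in> S"
    "\<And>z'. z' \<in> S \<Longrightarrow> fst z' \<in> uminus ` I \<and>
      chron (uminus ` I) (\<lambda>p. h (reverse_time p)) (\<lambda>s. d (- s)) (reverse_time q) z'"
    by (rule rev.chron_future_open[OF chron_reverse[OF assms]]) blast
  have "continuous_on UNIV (reverse_time :: real \<times> 'a \<Rightarrow> real \<times> 'a)"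
    unfolding reverse_time_def[abs_def] by (intro continuous_intros)
  then have "open (reverse_time -` S)" using S(1) by (simp add: continuous_on_open_vimage open_vimage)
  moreover have "chron I h d z' q" if "z' \<in> reverse_time -` S" for z'
  proof -
    have "chron (uminus ` I) (\<lambda>p. h (reverse_time p)) (\<lambda>s. d (- s)) (reverse_time q) (reverse_time z')"
      using S(3)[of "reverse_time z'"] that by simp
    from rev.chron_reverse[OF this] show ?thesis by (simp add: image_image)
  qed
  ultimately show ?thesis using S(2) by (intro that[of "reverse_time -` S"]) auto
qed

lemma open_diamond: "open (diamond I h d p q)"
proof (rule Topological_Spaces.openI)
  fix z assume "z \<in> diamond I h d p q"
  then have z: "chron I h d p z" "chron I h d z q" by (auto simp: diamond_def)
  obtain S where S: "open S" "z \<in> S" "\<And>z'. z' \<in> S \<Longrightarrow> fst z' \<in> I \<and> chron I h d p z'"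
    by (rule chron_future_open[OF z(1)]) blast
  obtain S' where S': "open S'" "z \<in> S'" "\<And>z'. z' \<in> S' \<Longrightarrow> chron I h d z' q"
    by (rule chron_past_open[OF z(2)]) blast
  have "S \<inter> S' \<subseteq> diamond I h d p q"
    using S(3) S'(3) by (auto simp: diamond_def mem_Times_iff)
  then show "\<exists>T. open T \<and> z \<in> T \<and> T \<subseteq> diamond I h d p q"
    using S(1,2) S'(1,2) by (intro exI[of _ "S \<inter> S'"]) auto
qed

lemma openin_spacetime_iff:
  "openin (prod_topology (top_of_set I) (euclidean :: 'a topology)) W \<longleftrightarrow> open W \<and> W \<subseteq> I \<times> UNIV"
proof -
  have "openin (prod_topology (top_of_set I) (euclidean :: 'a topology)) W \<longleftrightarrow>
      (\<forall>s x. (s, x) \<in> W \<longrightarrow> (\<exists>U V. open U \<and> U \<subseteq> I \<and> open V \<and> s \<in> U \<and> x \<in> V \<and> U \<times> V \<subseteq> W))"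
    unfolding openin_prod_topology_alt openin_open_eq[OF open_I] by (simp add: conj_assoc)
  also have "\<dots> \<longleftrightarrow> open W \<and> W \<subseteq> I \<times> UNIV" (is "?L \<longleftrightarrow> ?R")
  proof
    assume L: ?L
    have "open W"
    proof (rule Topological_Spaces.openI)
      fix z assume "z \<in> W"
      then have "(fst z, snd z) \<in> W" by simp
      with L[rule_format] obtain U V where "open U" "open V" "fst z \<in> U" "snd z \<in> V" "U \<times> V \<subseteq> W"
        by meson
      then show "\<exists>T. open T \<and> z \<in> T \<and> T \<subseteq> W"
        by (intro exI[of _ "U \<times> V"]) (simp add: open_Times mem_Times_iff)
    qed
    moreover have "s \<in> I" if "(s, x) \<in> W" for s x
      using L[rule_format, OF that] by blast
    ultimately show ?R by auto
  next
    assume R: ?R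
    show ?L
    proof (intro allI impI)
      fix s x assume sx: "(s, x) \<in> W"
      obtain U V where UV: "open U" "open V" "(s, x) \<in> U \<times> V" "U \<times> V \<subseteq> W"
        using R sx by (elim conjE open_prod_elim)
      have "U \<subseteq> I" using UV(3,4) R by blast
      with UV show "\<exists>U V. open U \<and> U \<subseteq> I \<and> open V \<and> s \<in> U \<and> x \<in> V \<and> U \<times> V \<subseteq> W" by blast
    qed
  qed
  finally show ?thesis .
qed

theorem strongly_causal: "strongly_causal I h d"
  unfolding strongly_causal_def
proof (rule ext)
  fix W :: "(real \<times> 'a) set"
  let ?diamond = "\<lambda>U. \<exists>p\<in>I \<times> UNIV. \<exists>q\<in>I \<times> UNIV. U = diamond I h d p q"
  show "openin (prod_topology (top_of_set I) euclidean) W = (arbitrary union_of ?diamond) W"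
  proof
    assume "openin (prod_topology (top_of_set I) euclidean) W"
    then have W: "open W" "W \<subseteq> I \<times> UNIV" by (simp_all add: openin_spacetime_iff)
    define \<U> where "\<U> = {U. ?diamond U \<and> U \<subseteq> W}"
    have "W \<subseteq> \<Union>\<U>"
    proof
      fix z assume z: "z \<in> W"
      obtain s x where sx: "z = (s, x)" by (cases z)
      have "s \<in> I" "(s, x) \<in> W" using z W(2) sx by auto
      then obtain p q where "p \<in> I \<times> UNIV" "q \<in> I \<times> UNIV" "(s, x) \<in> diamond I h d p q"
        "diamond I h d p q \<subseteq> W"
        using small_diamond_exists[OF W(1)] by blast
      then show "z \<in> \<Union>\<U>" unfolding \<U>_def sx by blast
    qed
    then have "\<Union>\<U> = W" unfolding \<U>_def by blast
    then show "(arbitrary union_of ?diamond) W"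
      unfolding union_of_def arbitrary_def by (intro exI[of _ \<U>]) (auto simp: \<U>_def)
  next
    assume "(arbitrary union_of ?diamond) W"
    then obtain \<U> where \<U>: "\<U> \<subseteq> Collect ?diamond" "\<Union>\<U> = W"
      unfolding union_of_def by blast
    have "open U \<and> U \<subseteq> I \<times> UNIV" if U: "U \<in> \<U>" for U
    proof -
      obtain p q where "U = diamond I h d p q" using \<U>(1) U by blast
      then show ?thesis using open_diamond by (auto simp: diamond_def)
    qed
    then have "open W \<and> W \<subseteq> I \<times> UNIV" using \<U>(2) by blast
    then show "openin (prod_topology (top_of_set I) euclidean) W" by (simp add: openin_spacetime_iff)
  qed
qed

end

theorem proposition5p4:
  fixes I :: "real set"
    and h :: "real \<times> 'a::topological_space \<Rightarrow> real"
    and d :: "real \<Rightarrow> 'a \<Rightarrow> 'a \<Rightarrow> real"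
  assumes "locally_compact_space (euclidean :: 'a topology)"
    and "open I" and "is_interval I"
    and "continuous_on (I \<times> UNIV) h"
    and "\<And>s x. s \<in> I \<Longrightarrow> h (s, x) > 0"
    and "\<And>s. s \<in> I \<Longrightarrow> Metric_space UNIV (d s)"
    and "\<And>s. s \<in> I \<Longrightarrow> generates_topology (length_metric (d s))"
    and log_Lipschitz: "\<And>J (K :: 'a set). \<lbrakk>compact J; J \<subseteq> I; compact K\<rbrakk> \<Longrightarrow>
      \<exists>C>0. \<exists>r>0. \<forall>s\<in>J. \<forall>s'\<in>J. \<forall>x\<in>K. \<forall>y\<in>K.
        x \<noteq> y \<and> (INF u\<in>J. d u x y) < r \<longrightarrow> \<bar>ln (d s x y / d s' x y)\<bar> \<le> C * \<bar>s - s'\<bar>"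
    and h_Lipschitz: "\<And>J (K :: 'a set). \<lbrakk>compact J; J \<subseteq> I; compact K\<rbrakk> \<Longrightarrow>
      \<exists>C'>0. \<forall>s\<in>J. \<forall>s'\<in>J. \<forall>x\<in>K. \<bar>h (s, x) - h (s', x)\<bar> \<le> C' * \<bar>s - s'\<bar>"
  shows "strongly_causal I h d"
  by (rule lipschitz_spacetime.strongly_causal[OF lipschitz_spacetime.intro]) (fact assms)+

end
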